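(* Let $p,q$ be odd primes with $q-p=2$, let $\varepsilon\in\{1,-1\}$, and let $E/\mathbb{Q}$ be the elliptic curve $y^2=x(x+\varepsilon p)(x+\varepsilon q)$. Let $D=D_1\cdots D_n$ ($n\ge 0$) be a product of $n$ distinct odd primes with $\gcd(pq,D)=1$, let $\mu\in\{1,-1\}$ with $\mu D\neq 1$, let $K=\mathbb{Q}(\sqrt{\mu D})$ and put $\mu_0=(1-\mu)/2$. Then $2n+\mu_0\le \delta(E,\mathbb{Q},K)\le 2n+4+\mu_0$. More precisely (all symbols $(\frac{\cdot}{\cdot})$ are Legendre symbols): (1) $\delta(E,\mathbb{Q},K)=2n+\mu_0$ if and only if $D\equiv\mu \pmod 8$ and $(\frac{\mu D}{p})=(\frac{\mu D}{q})=1$. (2) $\delta(E,\mathbb{Q},K)=2n+1+\mu_0$ if and only if one of the following holds: (2a) $D\equiv 5\mu\pmod 8$ and $(\frac{\mu D}{p})=(\frac{\mu D}{q})=1$; (2b) $D\equiv 7\mu\pmod 8$, $p\equiv 3\pmod 4$ and $(\frac{\mu D}{p})=(\frac{\mu D}{q})=1$; (2c) $D\equiv 3\mu\pmod 8$, $p\equiv 1\pmod 4$ and $(\frac{\mu D}{p})=(\frac{\mu D}{q})=1$; (2d) $D\equiv\mu\pmod 8$ and $(\frac{\mu D}{p})+(\frac{\mu D}{q})=0$. (3) $\delta(E,\mathbb{Q},K)=2n+2+\mu_0$ if and only if one of the following holds: (3a) $D\equiv 7\mu\pmod 8$, $p\equiv 1\pmod 4$ and $(\frac{\mu D}{p})=(\frac{\mu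 D}{q})=1$; (3b) $D\equiv 3\mu\pmod 8$, $p\equiv 3\pmod 4$ and $(\frac{\mu D}{p})=(\frac{\mu D}{q})=1$; (3c) $D\equiv 5\mu\pmod 8$ and $(\frac{\mu D}{p})+(\frac{\mu D}{q})=0$; (3d) $D\equiv 7\mu\pmod 8$, $p\equiv 3\pmod 4$ and $(\frac{\mu D}{p})+(\frac{\mu D}{q})=0$; (3e) $D\equiv 3\mu\pmod 8$, $p\equiv 1\pmod 4$ and $(\frac{\mu D}{p})+(\frac{\mu D}{q})=0$; (3f) $D\equiv\mu\pmod 8$ and $(\frac{\mu D}{p})=(\frac{\mu D}{q})=-1$. (4) $\delta(E,\mathbb{Q},K)=2n+3+\mu_0$ if and only if one of the following holds: (4a) $D\equiv 7\mu\pmod 8$, $p\equiv 1\pmod 4$ and $(\frac{\mu D}{p})+(\frac{\mu D}{q})=0$; (4b) $D\equiv 3\mu\pmod 8$, $p\equiv 3\pmod 4$ and $(\frac{\mu D}{p})+(\frac{\mu D}{q})=0$; (4c) $D\equiv 5\mu\pmod 8$ and $(\frac{\mu D}{p})=(\frac{\mu D}{q})=-1$; (4d) $D\equiv 7\mu\pmod 8$, $p\equiv 3\pmod 4$ and $(\frac{\mu D}{p})=(\frac{\mu D}{q})=-1$; (4e) $D\equiv 3\mu\pmod 8$, $p\equiv 1\pmod 4$ and $(\frac{\mu D}{p})=(\frac{\mu D}{q})=-1$. (5) $\delta(E,\mathbb{Q},K)=2n+4+\mu_0$ if and only if one of the following holds: (5a) $D\equiv 7\mu\pmod 8$, $p\equiv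 1\pmod 4$ and $(\frac{\mu D}{p})=(\frac{\mu D}{q})=-1$; (5b) $D\equiv 3\mu\pmod 8$, $p\equiv 3\pmod 4$ and $(\frac{\mu D}{p})=(\frac{\mu D}{q})=-1$.
   Context: For an elliptic curve $E$ over $\mathbb{Q}$ and a quadratic field $K$, for each place $v$ of $\mathbb{Q}$ (finite or infinite) fix a place $w$ of $K$ above $v$, and let $\delta_v=\log_2\big[E(\mathbb{Q}_v):N_{K_w/\mathbb{Q}_v}(E(K_w))\big]$ be the local norm index, where $N_{K_w/\mathbb{Q}_v}:E(K_w)\to E(\mathbb{Q}_v)$ is the norm (trace) map (trivially $\delta_v=0$ if $K_w=\mathbb{Q}_v$). Define $\delta(E,\mathbb{Q},K)=\sum_{v}\delta_v$, the sum over all places of $\mathbb{Q}$. *)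

theory Defs
  imports "HOL-Algebra.Ring" "HOL-Number_Theory.Number_Theory"
begin

definition padic_val_rat :: "nat \<Rightarrow> rat \<Rightarrow> int" where
  "padic_val_rat p x = (case quotient_of x of (a, b) \<Rightarrow>
      int (multiplicity (int p) a) - int (multiplicity (int p) b))"

definition padic_abs :: "nat \<Rightarrow> rat \<Rightarrow> real" where
  "padic_abs p x = (if x = 0 then 0 else real p powr (- real_of_int (padic_val_rat p x)))"

definition padic_cauchy :: "nat \<Rightarrow> (nat \<Rightarrow> rat) \<Rightarrow> bool" where
  "padic_cauchy p X \<longleftrightarrow> (\<forall>e>0. \<exists>N. \<forall>m\<ge>N. \<forall>k\<ge>N. padic_abs p (X m - X k) < e)"

definition padic_null :: "nat \<Rightarrow> (nat \<Rightarrow> rat) \<Rightarrow> bool" where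
  "padic_null p X \<longleftrightarrow> (\<forall>e>0. \<exists>N. \<forall>m\<ge>N. padic_abs p (X m) < e)"

definition padic_class :: "nat \<Rightarrow> (nat \<Rightarrow> rat) \<Rightarrow> (nat \<Rightarrow> rat) set" where
  "padic_class p X = {Y. padic_cauchy p Y \<and> padic_null p (\<lambda>n. X n - Y n)}"

definition padic_rep :: "(nat \<Rightarrow> rat) set \<Rightarrow> nat \<Rightarrow> rat" where
  "padic_rep A = (SOME X. X \<in> A)"

definition Qp :: "nat \<Rightarrow> (nat \<Rightarrow> rat) set ring" where
  "Qp p = \<lparr> carrier = padic_class p ` {X. padic_cauchy p X},
            mult = (\<lambda>A B. padic_class p (\<lambda>n. padic_rep A n * padic_rep B n)),
            one = padic_class p (\<lambda>_. 1),
            zero = padic_class p (\<lambda>_. 0),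
            add = (\<lambda>A B. padic_class p (\<lambda>n. padic_rep A n + padic_rep B n)) \<rparr>"

definition Qp_of_int :: "nat \<Rightarrow> int \<Rightarrow> (nat \<Rightarrow> rat) set" where
  "Qp_of_int p k = padic_class p (\<lambda>_. of_int k)"

definition real_field :: "real ring" where
  "real_field = \<lparr> carrier = UNIV, mult = (*), one = 1, zero = 0, add = (+) \<rparr>"

section \<open>Quadratic extension F(sqrt d) = F[t]/(t^2 - d) as pairs (a,b) = a + b sqrt d\<close>

definition quad_ext :: "('a, 'm) ring_scheme \<Rightarrow> 'a \<Rightarrow> ('a \<times> 'a) ring" where
  "quad_ext R d = \<lparr> carrier = carrier R \<times> carrier R,
     mult = (\<lambda>(a, b) (c, e). (add R (mult R a c) (mult R d (mult R b e)),
                              add R (mult R a e) (mult R b c))),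
     one = (one R, zero R),
     zero = (zero R, zero R),
     add = (\<lambda>(a, b) (c, e). (add R a c, add R b e)) \<rparr>"

definition quad_conj :: "('a, 'm) ring_scheme \<Rightarrow> 'a \<times> 'a \<Rightarrow> 'a \<times> 'a" where
  "quad_conj R z = (fst z, a_inv R (snd z))"

text \<open>Points: None is the point at infinity O, Some (x,y) an affine point.\<close>
definition ec_points :: "('a, 'm) ring_scheme \<Rightarrow> 'a \<Rightarrow> 'a \<Rightarrow> ('a \<times> 'a) option set" where
  "ec_points R a2 a4 = insert None
     {Some (x, y) | x y. x \<in> carrier R \<and> y \<in> carrier R \<and>
        mult R y y = add R (add R (mult R x (mult R x x)) (mult R a2 (mult R x x))) (mult R a4 x)}"

definition ec_add :: "('a, 'm) ring_scheme \<Rightarrow> 'a \<Rightarrow> 'a \<Rightarrow>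
    ('a \<times> 'a) option \<Rightarrow> ('a \<times> 'a) option \<Rightarrow> ('a \<times> 'a) option" where
  "ec_add R a2 a4 P Q =
    (case P of None \<Rightarrow> Q
     | Some (x1, y1) \<Rightarrow> (case Q of None \<Rightarrow> P
       | Some (x2, y2) \<Rightarrow>
         (if x1 = x2 \<and> y1 = a_inv R y2 then None
          else let
            two = add R (one R) (one R);
            three = add R two (one R);
            lam = (if x1 = x2
                   then mult R (add R (add R (mult R three (mult R x1 x1)) (mult R two (mult R a2 x1))) a4)
                               (m_inv R (mult R two y1))
                   else mult R (a_minus R y2 y1) (m_inv R (a_minus R x2 x1)));
            x3 = a_minus R (a_minus R (a_minus R (mult R lam lam) a2) x1) x2;
            y3 = a_inv R (add R (mult R lam (a_minus R x3 x1)) y1)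
          in Some (x3, y3))))"

text \<open>Norm (trace) map E(F(sqrt d)) -> E(F), P |-> P + sigma(P); the result has rational
  (i.e. F-) coordinates, which we project back to F.\<close>
definition ec_norm :: "('a, 'm) ring_scheme \<Rightarrow> 'a \<Rightarrow> 'a \<Rightarrow> 'a \<Rightarrow>
    (('a \<times> 'a) \<times> ('a \<times> 'a)) option \<Rightarrow> ('a \<times> 'a) option" where
  "ec_norm R d a2 a4 P =
    map_option (\<lambda>(x, y). (fst x, fst y))
      (ec_add (quad_ext R d) (a2, zero R) (a4, zero R) P
         (map_option (\<lambda>(x, y). (quad_conj R x, quad_conj R y)) P))"

definition norm_index :: "('a, 'm) ring_scheme \<Rightarrow> 'a \<Rightarrow> 'a \<Rightarrow> 'a \<Rightarrow> nat" where
  "norm_index R d a2 a4 =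
    (let N = ec_norm R d a2 a4 ` ec_points (quad_ext R d) (a2, zero R) (a4, zero R)
     in card ((\<lambda>P. ec_add R a2 a4 P ` N) ` ec_points R a2 a4))"

text \<open>delta_v for the local field F = Q_v (with embedding emb : Z -> F), K = Q(sqrt d):
  if d is a square in Q_v then K_w = Q_v and delta_v = 0; otherwise K_w = Q_v(sqrt d).\<close>
definition local_delta :: "('a, 'm) ring_scheme \<Rightarrow> (int \<Rightarrow> 'a) \<Rightarrow> int \<Rightarrow> int \<Rightarrow> int \<Rightarrow> real" where
  "local_delta R emb a2 a4 d =
    (if \<exists>s\<in>carrier R. mult R s s = emb d then 0
     else log 2 (real (norm_index R (emb d) (emb a2) (emb a4))))"

text \<open>Places of Q: None = the infinite place, Some p = the p-adic place (p prime).\<close>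
definition places_Q :: "nat option set" where
  "places_Q = insert None (Some ` {p. prime p})"

definition place_delta :: "int \<Rightarrow> int \<Rightarrow> int \<Rightarrow> nat option \<Rightarrow> real" where
  "place_delta a2 a4 d v = (case v of
      None \<Rightarrow> local_delta real_field of_int a2 a4 d
    | Some p \<Rightarrow> local_delta (Qp p) (Qp_of_int p) a2 a4 d)"

text \<open>delta(E, Q, Q(sqrt d)) for E : y^2 = x^3 + a2 x^2 + a4 x: the sum over all places
  (only finitely many terms are nonzero, so we sum over the support).\<close>
definition delta_EQK :: "int \<Rightarrow> int \<Rightarrow> int \<Rightarrow> real" where
  "delta_EQK a2 a4 d = (\<Sum>v\<in>{v\<in>places_Q. place_delta a2 a4 d v \<noteq> 0}. place_delta a2 a4 d v)"

end

theory Submission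
  imports Defs "HOL-Library.Z2" "HOL-Library.Product_Plus" "HOL-Decision_Procs.Algebra_Aux"
begin

text \<open>
  For E: y^2 = x(x + a)(x + b) over a local field F, the Kummer map sends (x, y) to the square classes
  of x and x + a, and it is a homomorphism because the abscissas of three collinear points multiply
  to a square. Kramer's criterion identifies the norms from F(sqrt d): a point of E is a norm if and
  only if its Kummer class is also the class of a point on the twist y^2 = x(x + d a)(x + d b). Hence
  the local norm index is the index of the intersection of the two Kummer images in the first one.
  Square classes are locally constant, so the images can be computed with rational x.

  At a prime l of good reduction the image consists of all unramified classes: over the residue field
  every point with trivial class has four halves, so the Kummer map takes at least four values. The
  twist has the same image if d is a unit, and one meeting it trivially if l divides d. For l = p, q
  and d a nonresidue the images meet in a subgroup of index 2. At 2 both images have eight elements,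
  and a finite computation in the residue classes modulo 8 remains. At the real place
  only the signs matter.
\<close>

section \<open>Identities in locale-based commutative rings\<close>

text \<open>The product of all commutative rings carried by subsets of a type, and of the integers (which
  provide 0 \<noteq> 1). Every single ring embeds into it, although not unitally, so the simplifier can
  prove identities between elements of a locale-based ring in a type class.\<close>
typedef 'a cring_prod =
  "{f :: 'a ring \<Rightarrow> 'a. \<forall>R. if cring R then f R \<in> carrier R else f R = undefined} \<times> (UNIV :: int set)"
proof -
  have "(\<lambda>R :: 'a ring. if cring R then zero R else undefined, 0) \<in>
    {f :: 'a ring \<Rightarrow> 'a. \<forall>R. if cring R then f R \<in> carrier R else f R = undefined} \<times> (UNIV :: int set)"
    by (auto intro: ring.ring_simprules cring.axioms)
  then show ?thesis by (rule exI)
qed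

setup_lifting type_definition_cring_prod

instantiation cring_prod :: (type) comm_ring_1
begin

lift_definition zero_cring_prod :: "'a cring_prod"
  is "(\<lambda>R. if cring R then zero R else undefined, 0)"
  by (auto intro: ring.ring_simprules cring.axioms)

lift_definition one_cring_prod :: "'a cring_prod"
  is "(\<lambda>R. if cring R then one R else undefined, 1)"
  by (auto intro: ring.ring_simprules cring.axioms)

lift_definition plus_cring_prod :: "'a cring_prod \<Rightarrow> 'a cring_prod \<Rightarrow> 'a cring_prod"
  is "\<lambda>(f, m) (g, n). (\<lambda>R. if cring R then add R (f R) (g R) else undefined, m + n)"
  by (force intro: ring.ring_simprules cring.axioms)

lift_definition uminus_cring_prod :: "'a cring_prod \<Rightarrow> 'a cring_prod"
  is "\<lambda>(f, m). (\<lambda>R. if cring R then a_inv R (f R) else undefined, - m)"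
  by (force intro: ring.ring_simprules cring.axioms)

lift_definition minus_cring_prod :: "'a cring_prod \<Rightarrow> 'a cring_prod \<Rightarrow> 'a cring_prod"
  is "\<lambda>(f, m) (g, n). (\<lambda>R. if cring R then a_minus R (f R) (g R) else undefined, m - n)"
  by (force intro: ring.ring_simprules cring.axioms)

lift_definition times_cring_prod :: "'a cring_prod \<Rightarrow> 'a cring_prod \<Rightarrow> 'a cring_prod"
  is "\<lambda>(f, m) (g, n). (\<lambda>R. if cring R then mult R (f R) (g R) else undefined, m * n)"
  by (force intro: ring.ring_simprules cring.axioms)

instance
proof
  fix x y z :: "'a cring_prod"
  show "x + y + z = x + (y + z)"
    by transfer (force simp: cring.cring_simprules)
  show "x + y = y + x"
    by transfer (force simp: cring.cring_simprules)
  show "0 + x = x"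
    by transfer (force simp: cring.cring_simprules)
  show "- x + x = 0"
    by transfer (force simp: cring.cring_simprules)
  show "x - y = x + - y"
    by transfer (force simp: cring.cring_simprules a_minus_def)
  show "x * y * z = x * (y * z)"
    by transfer (force simp: cring.cring_simprules)
  show "x * y = y * x"
    by transfer (force simp: cring.cring_simprules)
  show "1 * x = x"
    by transfer (force intro: monoid.l_one ring.axioms cring.axioms)
  show "(x + y) * z = x * z + y * z"
    by transfer (force simp: cring.cring_simprules algebra_simps)
  show "(0 :: 'a cring_prod) \<noteq> 1"
    by transfer simp
qed

end

definition of_ring :: "'a ring \<Rightarrow> 'a \<Rightarrow> 'a cring_prod" where
  "of_ring R x = Abs_cring_prod (\<lambda>R'. if R' = R then x else if cring R' then zero R' else undefined, 0)"

locale pure_cring = cring R for R :: "'a ring" (structure)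
begin

lemma Rep_of_ring:
  assumes "x \<in> carrier R"
  shows "Rep_cring_prod (of_ring R x) = (\<lambda>R'. if R' = R then x else if cring R' then zero R' else undefined, 0)"
  unfolding of_ring_def using assms is_cring
  by (subst Abs_cring_prod_inverse) (auto intro: ring.ring_simprules cring.axioms)

lemma of_ring_eq_iff:
  assumes "x \<in> carrier R" "y \<in> carrier R"
  shows "x = y \<longleftrightarrow> of_ring R x = of_ring R y"
proof
  assume "of_ring R x = of_ring R y"
  then have "fst (Rep_cring_prod (of_ring R x)) R = fst (Rep_cring_prod (of_ring R y)) R"
    by simp
  then show "x = y" using assms by (simp add: Rep_of_ring)
qed simp

lemma
  assumes "x \<in> carrier R" "y \<in> carrier R"
  shows of_ring_add: "of_ring R (x \<oplus> y) = of_ring R x + of_ring R y"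
    and of_ring_mult: "of_ring R (x \<otimes> y) = of_ring R x * of_ring R y"
    and of_ring_diff: "of_ring R (x \<ominus> y) = of_ring R x - of_ring R y"
  using assms is_cring
  by (auto simp: Rep_cring_prod_inject [symmetric] Rep_of_ring plus_cring_prod.rep_eq
      times_cring_prod.rep_eq minus_cring_prod.rep_eq fun_eq_iff cring.cring_simprules a_minus_def)

lemma of_ring_minus: "x \<in> carrier R \<Longrightarrow> of_ring R (\<ominus> x) = - of_ring R x"
  using is_cring
  by (auto simp: Rep_cring_prod_inject [symmetric] Rep_of_ring uminus_cring_prod.rep_eq fun_eq_iff
      cring.cring_simprules)

lemma of_ring_zero: "of_ring R \<zero> = 0"
  using is_cring
  by (auto simp: Rep_cring_prod_inject [symmetric] Rep_of_ring zero_cring_prod.rep_eq fun_eq_iff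
      cring.cring_simprules)

lemma of_ring_one:
  assumes "x \<in> carrier R"
  shows "of_ring R \<one> * of_ring R x = of_ring R x" "of_ring R x * of_ring R \<one> = of_ring R x"
  using assms by (simp_all flip: of_ring_mult)

text \<open>As rewrite rules, these turn every equation between elements of the ring into one in
  \<^typ>\<open>'a cring_prod\<close>.\<close>
lemmas class_transfer =
  of_ring_eq_iff of_ring_add of_ring_mult of_ring_diff of_ring_minus of_ring_zero of_ring_one

end

locale odd_char_field = field R for R :: "'a ring" (structure) +
  assumes two_nonzero: "\<one> \<oplus> \<one> \<noteq> \<zero>"
begin

sublocale pure_cring
  by unfold_locales

lemma mult_nonzero: "x \<in> carrier R \<Longrightarrow> y \<in> carrier R \<Longrightarrow> x \<noteq> \<zero> \<Longrightarrow> y \<noteq> \<zero> \<Longrightarrow> x \<otimes> y \<noteq> \<zero>"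
  using integral by blast

lemma add_self_eq_0_iff:
  assumes "x \<in> carrier R"
  shows "x \<oplus> x = \<zero> \<longleftrightarrow> x = \<zero>"
proof -
  have "x \<oplus> x = (\<one> \<oplus> \<one>) \<otimes> x" using assms by (simp add: l_distr)
  then show ?thesis using assms two_nonzero integral_iff[of "\<one> \<oplus> \<one>" x] by simp
qed

lemma eq_minus_self_iff: "x \<in> carrier R \<Longrightarrow> x = \<ominus> x \<longleftrightarrow> x = \<zero>"
  using add_self_eq_0_iff[of x] by (simp add: eq_neg_iff_add_eq_0)

lemma mult_inv_eq_iff:
  assumes "x \<in> carrier R" "y \<in> carrier R" "z \<in> carrier R" "y \<noteq> \<zero>"
  shows "x \<otimes> inv y = z \<longleftrightarrow> z \<otimes> y = x"
proof
  assume "x \<otimes> inv y = z"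
  then show "z \<otimes> y = x" using assms by (auto simp: m_assoc)
next
  assume "z \<otimes> y = x"
  then show "x \<otimes> inv y = z" using assms by (auto simp: m_assoc)
qed

end

section \<open>The chord and tangent construction\<close>

text \<open>The coefficients of X^3 + a2 X^2 + a4 X - (l X + n)^2 in terms of the elementary symmetric
  functions of its roots.\<close>

lemma vieta_chord:
  fixes x1 :: "'k::comm_ring_1"
  assumes "(l * x1 + n) * (l * x1 + n) = x1 * (x1 * x1) + a2 * (x1 * x1) + a4 * x1"
    and "(l * x2 + n) * (l * x2 + n) = x2 * (x2 * x2) + a2 * (x2 * x2) + a4 * x2"
    and "x3 = l * l - a2 - x1 - x2"
  shows "(x2 - x1) * (x1 * x2 + (x1 + x2) * x3) = (x2 - x1) * (a4 - 2 * (l * n))"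
proof -
  have "(x2 - x1) * (x1 * x2 + (x1 + x2) * x3) - (x2 - x1) * (a4 - 2 * (l * n))
    = ((l * x2 + n) * (l * x2 + n) - (x2 * (x2 * x2) + a2 * (x2 * x2) + a4 * x2))
     - ((l * x1 + n) * (l * x1 + n) - (x1 * (x1 * x1) + a2 * (x1 * x1) + a4 * x1))"
    unfolding assms(3) by (simp add: algebra_simps)
  then show ?thesis using assms by simp
qed

lemma vieta_tangent:
  fixes x :: "'k::comm_ring_1"
  assumes "x3 = l * l - a2 - x - x"
  shows "x * x + (x + x) * x3 = a4 - 2 * (l * n) \<longleftrightarrow>
    2 * (l * (l * x + n)) = 3 * (x * x) + 2 * (a2 * x) + a4"
proof -
  have "x * x + (x + x) * x3 - (a4 - 2 * (l * n))
    = 2 * (l * (l * x + n)) - (3 * (x * x) + 2 * (a2 * x) + a4)"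
    unfolding assms by (simp add: algebra_simps)
  then show ?thesis by (metis eq_iff_diff_eq_0)
qed

lemma vieta_product:
  fixes x1 :: "'k::comm_ring_1"
  assumes "(l * x1 + n) * (l * x1 + n) = x1 * (x1 * x1) + a2 * (x1 * x1) + a4 * x1"
    and "x1 * x2 + (x1 + x2) * x3 = a4 - 2 * (l * n)"
    and "x3 = l * l - a2 - x1 - x2"
  shows "x1 * x2 * x3 = n * n"
proof -
  have "n * n - x1 * x2 * x3
    = ((l * x1 + n) * (l * x1 + n) - (x1 * (x1 * x1) + a2 * (x1 * x1) + a4 * x1))
     - x1 * (x1 * x2 + (x1 + x2) * x3 - (a4 - 2 * (l * n)))"
    unfolding assms(3) by (simp add: algebra_simps)
  then show ?thesis using assms by simp
qed

lemma vieta_root: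
  fixes x :: "'k::comm_ring_1"
  assumes "s + x0 = l * l - a2" "c + s * x0 = a4 - 2 * (l * n)" "c * x0 = n * n"
    and "(x * x - s * x + c) * (x - x0) = 0"
  shows "(l * x + n) * (l * x + n) = x * (x * x) + a2 * (x * x) + a4 * x"
proof -
  have coeffs: "a2 = l * l - s - x0" "a4 = c + s * x0 + 2 * (l * n)"
    using assms by (simp_all add: algebra_simps)
  have "x * (x * x) + a2 * (x * x) + a4 * x - (l * x + n) * (l * x + n)
    = (x * x - s * x + c) * (x - x0) + (c * x0 - n * n)"
    unfolding coeffs by (simp add: algebra_simps)
  then show ?thesis using assms by simp
qed

locale weierstrass = odd_char_field +
  fixes a2 a4
  assumes coefficients_closed [simp]: "a2 \<in> carrier R" "a4 \<in> carrier R"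
begin

abbreviation cubic :: "'a \<Rightarrow> 'a" where
  "cubic x \<equiv> x \<otimes> (x \<otimes> x) \<oplus> a2 \<otimes> (x \<otimes> x) \<oplus> a4 \<otimes> x"

abbreviation E :: "('a \<times> 'a) option set" where
  "E \<equiv> ec_points R a2 a4"

abbreviation plus_pt :: "('a \<times> 'a) option \<Rightarrow> ('a \<times> 'a) option \<Rightarrow> ('a \<times> 'a) option" where
  "plus_pt \<equiv> ec_add R a2 a4"

definition neg_pt :: "('a \<times> 'a) option \<Rightarrow> ('a \<times> 'a) option" where
  "neg_pt = map_option (\<lambda>(x, y). (x, \<ominus> y))"

text \<open>The line y = l x + n meets the curve in a point with abscissa x and in two further points whose
  abscissas have sum s and product c. The latter two need not be rational.\<close>
definition line_meets :: "'a \<Rightarrow> 'a \<Rightarrow> 'a \<Rightarrow> 'a \<Rightarrow> 'a \<Rightarrow> bool" where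
  "line_meets l n s c x \<longleftrightarrow> {l, n, s, c, x} \<subseteq> carrier R \<and> s \<oplus> x = l \<otimes> l \<ominus> a2 \<and>
     c \<oplus> s \<otimes> x = a4 \<ominus> (l \<otimes> n \<oplus> l \<otimes> n) \<and> c \<otimes> x = n \<otimes> n"

lemma None_in_E: "None \<in> E"
  by (simp add: ec_points_def)

lemma Some_in_E_iff: "Some (x, y) \<in> E \<longleftrightarrow> x \<in> carrier R \<and> y \<in> carrier R \<and> y \<otimes> y = cubic x"
  by (auto simp: ec_points_def)

lemma finite_E: "finite (carrier R) \<Longrightarrow> finite E"
  by (rule finite_subset[of _ "insert None (Some ` (carrier R \<times> carrier R))"])
    (auto simp: ec_points_def)

lemma neg_pt_in_E: "P \<in> E \<Longrightarrow> neg_pt P \<in> E"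
  by (cases P) (auto simp: neg_pt_def Some_in_E_iff l_minus r_minus None_in_E)

lemma neg_neg_pt: "P \<in> E \<Longrightarrow> neg_pt (neg_pt P) = P"
  by (cases P) (auto simp: neg_pt_def Some_in_E_iff)

lemma line_meets_on_curve:
  assumes "line_meets l n s c x"
  shows "Some (x, l \<otimes> x \<oplus> n) \<in> E" "Some (x, \<ominus> (l \<otimes> x \<oplus> n)) \<in> E"
proof -
  show on_curve: "Some (x, l \<otimes> x \<oplus> n) \<in> E"
    using assms unfolding line_meets_def Some_in_E_iff
    by (auto simp: class_transfer intro!: vieta_root)
  show "Some (x, \<ominus> (l \<otimes> x \<oplus> n)) \<in> E"
    using neg_pt_in_E[OF on_curve] by (simp add: neg_pt_def)
qed

lemma chord_meets:
  assumes "Some (x1, y1) \<in> E" "Some (x2, y2) \<in> E" "x1 \<noteq> x2"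
    and l: "l \<in> carrier R" "l \<otimes> (x2 \<ominus> x1) = y2 \<ominus> y1"
  shows "y2 = l \<otimes> x2 \<oplus> (y1 \<ominus> l \<otimes> x1)"
    and "line_meets l (y1 \<ominus> l \<otimes> x1) (x1 \<oplus> x2) (x1 \<otimes> x2) (l \<otimes> l \<ominus> a2 \<ominus> x1 \<ominus> x2)"
proof -
  have closed: "x1 \<in> carrier R" "y1 \<in> carrier R" "x2 \<in> carrier R" "y2 \<in> carrier R"
    and on_curve: "y1 \<otimes> y1 = cubic x1" "y2 \<otimes> y2 = cubic x2"
    using assms by (auto simp: Some_in_E_iff)
  define n x3 where "n = y1 \<ominus> l \<otimes> x1" and "x3 = l \<otimes> l \<ominus> a2 \<ominus> x1 \<ominus> x2"
  have closed': "n \<in> carrier R" "x3 \<in> carrier R"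
    using closed l by (simp_all add: n_def x3_def)
  have y1: "y1 = l \<otimes> x1 \<oplus> n"
    using closed l by (simp add: n_def class_transfer)
  show y2: "y2 = l \<otimes> x2 \<oplus> (y1 \<ominus> l \<otimes> x1)"
    using closed l by (simp add: class_transfer algebra_simps)
  have "(x2 \<ominus> x1) \<otimes> (x1 \<otimes> x2 \<oplus> (x1 \<oplus> x2) \<otimes> x3) = (x2 \<ominus> x1) \<otimes> (a4 \<ominus> (l \<otimes> n \<oplus> l \<otimes> n))"
    using on_curve closed closed' l vieta_chord[of "of_ring R l" "of_ring R x1" "of_ring R n"
        "of_ring R a2" "of_ring R a4" "of_ring R x2" "of_ring R x3"]
    unfolding y1 y2[folded n_def] by (simp add: class_transfer x3_def)
  then have second: "x1 \<otimes> x2 \<oplus> (x1 \<oplus> x2) \<otimes> x3 = a4 \<ominus> (l \<otimes> n \<oplus> l \<otimes> n)"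
    using m_lcancel[of "x2 \<ominus> x1"] closed closed' l \<open>x1 \<noteq> x2\<close> by (simp add: eq_diff0)
  then have "x1 \<otimes> x2 \<otimes> x3 = n \<otimes> n"
    using on_curve(1) closed closed' l vieta_product[of "of_ring R l" "of_ring R x1" "of_ring R n"
        "of_ring R a2" "of_ring R a4" "of_ring R x2" "of_ring R x3"]
    unfolding y1 by (simp add: class_transfer x3_def)
  with second show "line_meets l (y1 \<ominus> l \<otimes> x1) (x1 \<oplus> x2) (x1 \<otimes> x2) (l \<otimes> l \<ominus> a2 \<ominus> x1 \<ominus> x2)"
    unfolding line_meets_def n_def[symmetric] x3_def[symmetric]
    using closed closed' l by (simp add: class_transfer x3_def)
qed

lemma line_meets_twice_iff:
  assumes "{x, l, n, x3} \<subseteq> carrier R"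
  shows "line_meets l n (x \<oplus> x) (x \<otimes> x) x3 \<longleftrightarrow> x3 = l \<otimes> l \<ominus> a2 \<ominus> x \<ominus> x \<and> Some (x, l \<otimes> x \<oplus> n) \<in> E \<and>
    l \<otimes> (l \<otimes> x \<oplus> n) \<oplus> l \<otimes> (l \<otimes> x \<oplus> n)
      = x \<otimes> x \<oplus> x \<otimes> x \<oplus> x \<otimes> x \<oplus> (a2 \<otimes> x \<oplus> a2 \<otimes> x) \<oplus> a4"
proof -
  have closed: "x \<in> carrier R" "l \<in> carrier R" "n \<in> carrier R" "x3 \<in> carrier R"
    using assms by auto
  have sum: "x \<oplus> x \<oplus> x3 = l \<otimes> l \<ominus> a2 \<longleftrightarrow> x3 = l \<otimes> l \<ominus> a2 \<ominus> x \<ominus> x"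
    using closed by (auto simp: class_transfer algebra_simps)
  have tangent: "x \<otimes> x \<oplus> (x \<oplus> x) \<otimes> x3 = a4 \<ominus> (l \<otimes> n \<oplus> l \<otimes> n) \<longleftrightarrow>
      l \<otimes> (l \<otimes> x \<oplus> n) \<oplus> l \<otimes> (l \<otimes> x \<oplus> n) = x \<otimes> x \<oplus> x \<otimes> x \<oplus> x \<otimes> x \<oplus> (a2 \<otimes> x \<oplus> a2 \<otimes> x) \<oplus> a4"
    if "x3 = l \<otimes> l \<ominus> a2 \<ominus> x \<ominus> x"
    using that closed vieta_tangent[of "of_ring R x3" "of_ring R l" "of_ring R a2" "of_ring R x"
        "of_ring R a4" "of_ring R n"]
    by (simp add: class_transfer algebra_simps)
  have product: "x \<otimes> x \<otimes> x3 = n \<otimes> n" if "Some (x, l \<otimes> x \<oplus> n) \<in> E"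
      "x3 = l \<otimes> l \<ominus> a2 \<ominus> x \<ominus> x" "x \<otimes> x \<oplus> (x \<oplus> x) \<otimes> x3 = a4 \<ominus> (l \<otimes> n \<oplus> l \<otimes> n)"
    using that closed vieta_product[of "of_ring R l" "of_ring R x" "of_ring R n" "of_ring R a2"
        "of_ring R a4" "of_ring R x" "of_ring R x3"]
    by (simp add: Some_in_E_iff class_transfer)
  have on_curve: "Some (x, l \<otimes> x \<oplus> n) \<in> E" if "line_meets l n (x \<oplus> x) (x \<otimes> x) x3"
    using that closed vieta_root[of "of_ring R (x \<oplus> x)" "of_ring R x3" "of_ring R l" "of_ring R a2"
        "of_ring R (x \<otimes> x)" "of_ring R a4" "of_ring R n" "of_ring R x"]
    by (simp add: line_meets_def Some_in_E_iff class_transfer algebra_simps)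
  show ?thesis
    using sum tangent product on_curve assms by (auto simp: line_meets_def)
qed

lemma equal_or_opposite:
  assumes "Some (x, y1) \<in> E" "Some (x, y2) \<in> E" "y1 \<noteq> \<ominus> y2"
  shows "y1 = y2" "y1 \<noteq> \<zero>"
proof -
  show "y1 = y2" using assms square_eq_iff[of y1 y2] by (auto simp: Some_in_E_iff)
  then show "y1 \<noteq> \<zero>" using assms by auto
qed

lemma line_through_points:
  assumes P: "Some (x1, y1) \<in> E" and Q: "Some (x2, y2) \<in> E" and not_opposite: "\<not> (x1 = x2 \<and> y1 = \<ominus> y2)"
  obtains l n x3 where "line_meets l n (x1 \<oplus> x2) (x1 \<otimes> x2) x3" "y1 = l \<otimes> x1 \<oplus> n" "y2 = l \<otimes> x2 \<oplus> n"
proof -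
  have closed: "x1 \<in> carrier R" "y1 \<in> carrier R" "x2 \<in> carrier R" "y2 \<in> carrier R"
    using P Q by (auto simp: Some_in_E_iff)
  have y1: "y1 = l \<otimes> x1 \<oplus> (y1 \<ominus> l \<otimes> x1)" if "l \<in> carrier R" for l
    using closed that by (simp add: class_transfer)
  show ?thesis
  proof (cases "x1 = x2")
    case False
    define l where "l = (y2 \<ominus> y1) \<otimes> inv (x2 \<ominus> x1)"
    have l: "l \<in> carrier R" "l \<otimes> (x2 \<ominus> x1) = y2 \<ominus> y1"
      using closed False mult_inv_eq_iff[of "y2 \<ominus> y1" "x2 \<ominus> x1" l] by (simp_all add: l_def eq_diff0)
    show ?thesis using that[OF chord_meets(2) y1 chord_meets(1)] P Q False l by blast
  next
    case True
    then have y: "y2 = y1" "y1 \<oplus> y1 \<noteq> \<zero>"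
      using equal_or_opposite[of x1 y1 y2] P Q not_opposite add_self_eq_0_iff closed by auto
    define t where "t = x1 \<otimes> x1 \<oplus> x1 \<otimes> x1 \<oplus> x1 \<otimes> x1 \<oplus> (a2 \<otimes> x1 \<oplus> a2 \<otimes> x1) \<oplus> a4"
    define l where "l = t \<otimes> inv (y1 \<oplus> y1)"
    have l: "l \<in> carrier R" "l \<otimes> y1 \<oplus> l \<otimes> y1 = t"
      using closed y mult_inv_eq_iff[of t "y1 \<oplus> y1" l] by (simp_all add: l_def t_def r_distr)
    then have "line_meets l (y1 \<ominus> l \<otimes> x1) (x1 \<oplus> x1) (x1 \<otimes> x1) (l \<otimes> l \<ominus> a2 \<ominus> x1 \<ominus> x1)"
      using closed P y1[OF l(1)] by (subst line_meets_twice_iff) (simp_all add: t_def)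
    then show ?thesis using that y1[OF l(1)] True y(1) by blast
  qed
qed

definition slope :: "'a \<Rightarrow> 'a \<Rightarrow> 'a \<Rightarrow> 'a \<Rightarrow> 'a" where
  "slope x1 y1 x2 y2 = (if x1 = x2
     then ((\<one> \<oplus> \<one> \<oplus> \<one>) \<otimes> (x1 \<otimes> x1) \<oplus> (\<one> \<oplus> \<one>) \<otimes> (a2 \<otimes> x1) \<oplus> a4) \<otimes> inv ((\<one> \<oplus> \<one>) \<otimes> y1)
     else (y2 \<ominus> y1) \<otimes> inv (x2 \<ominus> x1))"

lemma ec_add_slope:
  assumes "\<not> (x1 = x2 \<and> y1 = \<ominus> y2)"
  shows "plus_pt (Some (x1, y1)) (Some (x2, y2)) =
    (let l = slope x1 y1 x2 y2; x3 = l \<otimes> l \<ominus> a2 \<ominus> x1 \<ominus> x2 in Some (x3, \<ominus> (l \<otimes> (x3 \<ominus> x1) \<oplus> y1)))"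
  using assms unfolding ec_add_def slope_def by (auto simp: Let_def)

lemma slope_line_meets:
  assumes meets: "line_meets l n (x1 \<oplus> x2) (x1 \<otimes> x2) x3" and closed: "x1 \<in> carrier R" "x2 \<in> carrier R"
    and y: "y1 = l \<otimes> x1 \<oplus> n" "y2 = l \<otimes> x2 \<oplus> n" and not_opposite: "\<not> (x1 = x2 \<and> y1 = \<ominus> y2)"
  shows "slope x1 y1 x2 y2 = l"
proof -
  have closed': "l \<in> carrier R" "n \<in> carrier R" "x3 \<in> carrier R"
    using meets by (auto simp: line_meets_def)
  show ?thesis
  proof (cases "x1 = x2")
    case True
    then have tangent: "Some (x1, y1) \<in> E"
        "l \<otimes> y1 \<oplus> l \<otimes> y1 = x1 \<otimes> x1 \<oplus> x1 \<otimes> x1 \<oplus> x1 \<otimes> x1 \<oplus> (a2 \<otimes> x1 \<oplus> a2 \<otimes> x1) \<oplus> a4"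
      using meets closed closed' line_meets_twice_iff[of x1 l n x3] by (simp_all add: y)
    have "y1 \<noteq> \<zero>" using True y not_opposite by auto
    then have "(\<one> \<oplus> \<one>) \<otimes> y1 \<noteq> \<zero>" using closed closed' y two_nonzero mult_nonzero by simp
    moreover have "l \<otimes> ((\<one> \<oplus> \<one>) \<otimes> y1) = (\<one> \<oplus> \<one> \<oplus> \<one>) \<otimes> (x1 \<otimes> x1) \<oplus> (\<one> \<oplus> \<one>) \<otimes> (a2 \<otimes> x1) \<oplus> a4"
      using tangent(2) closed closed' y(1) by (simp add: class_transfer algebra_simps)
    ultimately show ?thesis
      using True closed closed' y(1) by (simp add: slope_def mult_inv_eq_iff)
  next
    case False
    have "l \<otimes> (x2 \<ominus> x1) = y2 \<ominus> y1"
      unfolding y using closed closed' by (simp add: class_transfer algebra_simps)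
    then show ?thesis
      using False closed closed' y mult_inv_eq_iff by (simp add: slope_def eq_diff0)
  qed
qed

lemma ec_add_line_meets:
  assumes "line_meets l n (x1 \<oplus> x2) (x1 \<otimes> x2) x3" and closed: "x1 \<in> carrier R" "x2 \<in> carrier R"
    and y: "y1 = l \<otimes> x1 \<oplus> n" "y2 = l \<otimes> x2 \<oplus> n" and not_opposite: "\<not> (x1 = x2 \<and> y1 = \<ominus> y2)"
  shows "plus_pt (Some (x1, y1)) (Some (x2, y2)) = Some (x3, \<ominus> (l \<otimes> x3 \<oplus> n))"
proof -
  have closed': "l \<in> carrier R" "n \<in> carrier R" "x3 \<in> carrier R"
    and sum: "x1 \<oplus> x2 \<oplus> x3 = l \<otimes> l \<ominus> a2"
    using assms by (auto simp: line_meets_def)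
  have x3: "l \<otimes> l \<ominus> a2 \<ominus> x1 \<ominus> x2 = x3"
    using sum closed closed' by (simp add: class_transfer algebra_simps)
  have y3: "l \<otimes> (x3 \<ominus> x1) \<oplus> y1 = l \<otimes> x3 \<oplus> n"
    unfolding y using closed closed' by (simp add: class_transfer algebra_simps)
  show ?thesis
    unfolding ec_add_slope[OF not_opposite] slope_line_meets[OF assms] by (simp add: x3 y3)
qed

end

section \<open>Quadratic extensions\<close>

lemma quad_ext_simps [simp]:
  "carrier (quad_ext R d) = carrier R \<times> carrier R"
  "mult (quad_ext R d) (x, y) (z, w) =
    (add R (mult R x z) (mult R d (mult R y w)), add R (mult R x w) (mult R y z))"
  "add (quad_ext R d) (x, y) (z, w) = (add R x z, add R y w)"
  "one (quad_ext R d) = (one R, zero R)"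
  "zero (quad_ext R d) = (zero R, zero R)"
  by (simp_all add: quad_ext_def)

locale nonsquare = odd_char_field +
  fixes d
  assumes d_closed [simp]: "d \<in> carrier R"
    and d_nonsquare: "s \<in> carrier R \<Longrightarrow> s \<otimes> s \<noteq> d"
begin

abbreviation K :: "('a \<times> 'a) ring" where
  "K \<equiv> quad_ext R d"

abbreviation norm_form :: "'a \<Rightarrow> 'a \<Rightarrow> 'a" where
  "norm_form u v \<equiv> u \<otimes> u \<ominus> d \<otimes> (v \<otimes> v)"

lemma d_nonzero: "d \<noteq> \<zero>"
  using d_nonsquare[of \<zero>] by auto

lemma norm_form_nonzero:
  assumes "u \<in> carrier R" "v \<in> carrier R" "u \<noteq> \<zero> \<or> v \<noteq> \<zero>"
  shows "norm_form u v \<noteq> \<zero>"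
proof
  assume norm_zero: "norm_form u v = \<zero>"
  then have uu: "u \<otimes> u = d \<otimes> (v \<otimes> v)" using assms by (simp add: eq_diff0)
  show False
  proof (cases "v = \<zero>")
    case True
    then show ?thesis using uu assms integral[of u u] by auto
  next
    case False
    then have inv: "inv v \<in> carrier R" "v \<otimes> inv v = \<one>" using assms by simp_all
    have "(u \<otimes> inv v) \<otimes> (u \<otimes> inv v) = (u \<otimes> u) \<otimes> (inv v \<otimes> inv v)"
      using assms inv(1) by (simp add: m_ac)
    also have "\<dots> = d \<otimes> ((v \<otimes> inv v) \<otimes> (v \<otimes> inv v))"
      unfolding uu using assms inv(1) by (simp add: class_transfer algebra_simps)
    also have "\<dots> = d" using inv by simp
    finally show ?thesis using d_nonsquare[of "u \<otimes> inv v"] assms inv by simp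
  qed
qed

lemma cring_K: "cring K"
proof (rule cringI)
  show "abelian_group K"
  proof (rule abelian_groupI)
    fix z assume "z \<in> carrier K"
    then show "\<exists>w\<in>carrier K. w \<oplus>\<^bsub>K\<^esub> z = \<zero>\<^bsub>K\<^esub>"
      by (cases z) (auto intro!: bexI[of _ "(\<ominus> fst z, \<ominus> snd z)"] simp: l_neg)
  qed (auto simp: a_ac)
  show "comm_monoid K"
    by (rule comm_monoidI) (auto simp: class_transfer algebra_simps)
  fix x y z assume "x \<in> carrier K" "y \<in> carrier K" "z \<in> carrier K"
  then show "(x \<oplus>\<^bsub>K\<^esub> y) \<otimes>\<^bsub>K\<^esub> z = x \<otimes>\<^bsub>K\<^esub> z \<oplus>\<^bsub>K\<^esub> y \<otimes>\<^bsub>K\<^esub> z"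
    by (auto simp: class_transfer algebra_simps)
qed

lemma field_K: "field K"
proof (rule cring.cring_fieldI2[OF cring_K])
  show "\<zero>\<^bsub>K\<^esub> \<noteq> \<one>\<^bsub>K\<^esub>" by simp
  fix z assume z: "z \<in> carrier K" "z \<noteq> \<zero>\<^bsub>K\<^esub>"
  then obtain u v where uv: "z = (u, v)" "u \<in> carrier R" "v \<in> carrier R" by (cases z) auto
  define i where "i = inv norm_form u v"
  have i: "i \<in> carrier R" "norm_form u v \<otimes> i = \<one>"
    using norm_form_nonzero[of u v] z uv by (auto simp: i_def)
  have "u \<otimes> (u \<otimes> i) \<oplus> d \<otimes> (v \<otimes> (\<ominus> v \<otimes> i)) = norm_form u v \<otimes> i"
    using uv i(1) by (simp add: class_transfer algebra_simps)
  moreover have "u \<otimes> (\<ominus> v \<otimes> i) \<oplus> v \<otimes> (u \<otimes> i) = \<zero>"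
    using uv i(1) by (simp add: class_transfer algebra_simps)
  ultimately show "\<exists>w\<in>carrier K. z \<otimes>\<^bsub>K\<^esub> w = \<one>\<^bsub>K\<^esub>"
    using uv i by (intro bexI[of _ "(u \<otimes> i, \<ominus> v \<otimes> i)"]) simp_all
qed

lemma odd_char_field_K: "odd_char_field K"
  using field_K two_nonzero by (simp add: odd_char_field_def odd_char_field_axioms_def)

lemma minus_K [simp]:
  assumes "u \<in> carrier R" "v \<in> carrier R"
  shows "\<ominus>\<^bsub>K\<^esub> (u, v) = (\<ominus> u, \<ominus> v)"
proof -
  interpret K: cring K by (rule cring_K)
  show ?thesis using assms by (intro K.minus_equality) (auto simp: l_neg)
qed

lemma diff_K [simp]:
  assumes "u \<in> carrier R" "v \<in> carrier R" "u' \<in> carrier R" "v' \<in> carrier R"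
  shows "(u', v') \<ominus>\<^bsub>K\<^esub> (u, v) = (u' \<ominus> u, v' \<ominus> v)"
  using assms by (simp add: a_minus_def[of K] a_minus_def[of R])

end

lemma vieta_conjugates:
  fixes u :: "'k::comm_ring_1"
  assumes x: "x = l * l - a2 - u - u"
  shows "2 * ((l * u + n) * (l * v)) = v * (3 * (u * u) + d * (v * v) + 2 * (a2 * u) + a4) \<longleftrightarrow>
      v * (u * u - d * (v * v) + (u + u) * x) = v * (a4 - 2 * (l * n))" (is "?im \<longleftrightarrow> ?second")
    and "u * u - d * (v * v) + (u + u) * x = a4 - 2 * (l * n) \<Longrightarrow>
      (l * u + n) * (l * u + n) + d * (l * v * (l * v)) =
        u * (u * u + 3 * d * (v * v)) + a2 * (u * u + d * (v * v)) + a4 * u \<longleftrightarrow>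
      (u * u - d * (v * v)) * x = n * n" (is "_ \<Longrightarrow> ?re \<longleftrightarrow> ?product")
proof -
  have "2 * ((l * u + n) * (l * v)) - v * (3 * (u * u) + d * (v * v) + 2 * (a2 * u) + a4)
    = v * (u * u - d * (v * v) + (u + u) * x) - v * (a4 - 2 * (l * n))"
    unfolding x by (simp add: algebra_simps)
  then show "?im \<longleftrightarrow> ?second" by (metis eq_iff_diff_eq_0)
  assume "u * u - d * (v * v) + (u + u) * x = a4 - 2 * (l * n)"
  then have a4: "a4 = u * u - d * (v * v) + (u + u) * x + 2 * (l * n)" by (simp add: algebra_simps)
  have "(l * u + n) * (l * u + n) + d * (l * v * (l * v))
      - (u * (u * u + 3 * d * (v * v)) + a2 * (u * u + d * (v * v)) + a4 * u)
    = n * n - (u * u - d * (v * v)) * x"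
    unfolding a4 x by (simp add: algebra_simps)
  then show "?re \<longleftrightarrow> ?product" by (metis eq_iff_diff_eq_0)
qed

locale weierstrass_nonsquare = weierstrass + nonsquare
begin

abbreviation E_K :: "(('a \<times> 'a) \<times> ('a \<times> 'a)) option set" where
  "E_K \<equiv> ec_points K (a2, \<zero>) (a4, \<zero>)"

abbreviation norm_pt :: "(('a \<times> 'a) \<times> ('a \<times> 'a)) option \<Rightarrow> ('a \<times> 'a) option" where
  "norm_pt \<equiv> ec_norm R d a2 a4"

lemma weierstrass_K: "weierstrass K (a2, \<zero>) (a4, \<zero>)"
  using odd_char_field_K by (simp add: weierstrass_def weierstrass_axioms_def)

lemma line_meets_K:
  assumes "line_meets l n s c x"
  shows "weierstrass.line_meets K (a2, \<zero>) (a4, \<zero>) (l, \<zero>) (n, \<zero>) (s, \<zero>) (c, \<zero>) (x, \<zero>)"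
  using assms by (simp add: weierstrass.line_meets_def[OF weierstrass_K] line_meets_def)

lemma Some_in_E_K_iff:
  "Some ((u, v), (r, s)) \<in> E_K \<longleftrightarrow> {u, v, r, s} \<subseteq> carrier R \<and>
     r \<otimes> r \<oplus> d \<otimes> (s \<otimes> s) = u \<otimes> (u \<otimes> u \<oplus> (d \<oplus> d \<oplus> d) \<otimes> (v \<otimes> v)) \<oplus> a2 \<otimes> (u \<otimes> u \<oplus> d \<otimes> (v \<otimes> v)) \<oplus> a4 \<otimes> u \<and>
     r \<otimes> s \<oplus> r \<otimes> s = v \<otimes> (u \<otimes> u \<oplus> u \<otimes> u \<oplus> u \<otimes> u \<oplus> d \<otimes> (v \<otimes> v) \<oplus> (a2 \<otimes> u \<oplus> a2 \<otimes> u) \<oplus> a4)"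
proof -
  have "Some ((u, v), (r, s)) \<in> E_K \<longleftrightarrow> {u, v, r, s} \<subseteq> carrier R \<and>
      (r, s) \<otimes>\<^bsub>K\<^esub> (r, s) = (u, v) \<otimes>\<^bsub>K\<^esub> ((u, v) \<otimes>\<^bsub>K\<^esub> (u, v)) \<oplus>\<^bsub>K\<^esub> (a2, \<zero>) \<otimes>\<^bsub>K\<^esub> ((u, v) \<otimes>\<^bsub>K\<^esub> (u, v)) \<oplus>\<^bsub>K\<^esub> (a4, \<zero>) \<otimes>\<^bsub>K\<^esub> (u, v)"
    by (auto simp: ec_points_def)
  then show ?thesis
    by (auto simp: class_transfer algebra_simps)
qed

lemma line_meets_conjugates_iff:
  assumes closed: "{l, n, u, v, x} \<subseteq> carrier R" and v: "v \<noteq> \<zero>"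
  shows "line_meets l n (u \<oplus> u) (norm_form u v) x \<longleftrightarrow>
    x = l \<otimes> l \<ominus> a2 \<ominus> u \<ominus> u \<and> Some ((u, v), (l \<otimes> u \<oplus> n, l \<otimes> v)) \<in> E_K"
proof (cases "x = l \<otimes> l \<ominus> a2 \<ominus> u \<ominus> u")
  case False
  then show ?thesis using closed by (auto simp: line_meets_def class_transfer algebra_simps)
next
  case True
  have x: "of_ring R x = of_ring R l * of_ring R l - of_ring R a2 - of_ring R u - of_ring R u"
    unfolding True using closed by (simp add: class_transfer)
  note vieta = vieta_conjugates[OF x, where n = "of_ring R n" and v = "of_ring R v" and d = "of_ring R d"
      and ?a4.0 = "of_ring R a4"]
  have "(l \<otimes> u \<oplus> n) \<otimes> (l \<otimes> v) \<oplus> (l \<otimes> u \<oplus> n) \<otimes> (l \<otimes> v)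
      = v \<otimes> (u \<otimes> u \<oplus> u \<otimes> u \<oplus> u \<otimes> u \<oplus> d \<otimes> (v \<otimes> v) \<oplus> (a2 \<otimes> u \<oplus> a2 \<otimes> u) \<oplus> a4) \<longleftrightarrow>
    v \<otimes> (norm_form u v \<oplus> (u \<oplus> u) \<otimes> x) = v \<otimes> (a4 \<ominus> (l \<otimes> n \<oplus> l \<otimes> n))"
    using closed vieta(1) by (simp add: class_transfer algebra_simps)
  also have "\<dots> \<longleftrightarrow> norm_form u v \<oplus> (u \<oplus> u) \<otimes> x = a4 \<ominus> (l \<otimes> n \<oplus> l \<otimes> n)"
    using m_lcancel[OF v] closed by simp
  finally have second: "(l \<otimes> u \<oplus> n) \<otimes> (l \<otimes> v) \<oplus> (l \<otimes> u \<oplus> n) \<otimes> (l \<otimes> v)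
      = v \<otimes> (u \<otimes> u \<oplus> u \<otimes> u \<oplus> u \<otimes> u \<oplus> d \<otimes> (v \<otimes> v) \<oplus> (a2 \<otimes> u \<oplus> a2 \<otimes> u) \<oplus> a4) \<longleftrightarrow>
    norm_form u v \<oplus> (u \<oplus> u) \<otimes> x = a4 \<ominus> (l \<otimes> n \<oplus> l \<otimes> n)" .
  have product: "(l \<otimes> u \<oplus> n) \<otimes> (l \<otimes> u \<oplus> n) \<oplus> d \<otimes> (l \<otimes> v \<otimes> (l \<otimes> v))
      = u \<otimes> (u \<otimes> u \<oplus> (d \<oplus> d \<oplus> d) \<otimes> (v \<otimes> v)) \<oplus> a2 \<otimes> (u \<otimes> u \<oplus> d \<otimes> (v \<otimes> v)) \<oplus> a4 \<otimes> u \<longleftrightarrow>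
    norm_form u v \<otimes> x = n \<otimes> n"
    if "norm_form u v \<oplus> (u \<oplus> u) \<otimes> x = a4 \<ominus> (l \<otimes> n \<oplus> l \<otimes> n)"
    using closed vieta(2) that by (simp add: class_transfer algebra_simps)
  have "u \<oplus> u \<oplus> x = l \<otimes> l \<ominus> a2"
    unfolding True using closed by (simp add: class_transfer algebra_simps)
  then show ?thesis
    using closed True second product unfolding line_meets_def Some_in_E_K_iff by auto
qed

lemma norm_pt_line_meets:
  assumes meets: "line_meets l n (u \<oplus> u) (norm_form u v) x"
    and closed: "u \<in> carrier R" "v \<in> carrier R" and v: "v \<noteq> \<zero>"
  shows "norm_pt (Some ((u, v), (l \<otimes> u \<oplus> n, l \<otimes> v))) = Some (x, \<ominus> (l \<otimes> x \<oplus> n))"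
proof -
  interpret K: weierstrass K "(a2, \<zero>)" "(a4, \<zero>)" by (rule weierstrass_K)
  have closed': "l \<in> carrier R" "n \<in> carrier R" "x \<in> carrier R"
    using meets by (auto simp: line_meets_def)
  have "K.plus_pt (Some ((u, v), (l \<otimes> u \<oplus> n, l \<otimes> v))) (Some ((u, \<ominus> v), (l \<otimes> u \<oplus> n, \<ominus> (l \<otimes> v))))
    = Some ((x, \<zero>), \<ominus>\<^bsub>K\<^esub> ((l, \<zero>) \<otimes>\<^bsub>K\<^esub> (x, \<zero>) \<oplus>\<^bsub>K\<^esub> (n, \<zero>)))"
  proof (rule K.ec_add_line_meets)
    have "(u, v) \<oplus>\<^bsub>K\<^esub> (u, \<ominus> v) = (u \<oplus> u, \<zero>)" "(u, v) \<otimes>\<^bsub>K\<^esub> (u, \<ominus> v) = (norm_form u v, \<zero>)"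
      using closed by (simp_all add: class_transfer)
    then show "K.line_meets (l, \<zero>) (n, \<zero>) ((u, v) \<oplus>\<^bsub>K\<^esub> (u, \<ominus> v)) ((u, v) \<otimes>\<^bsub>K\<^esub> (u, \<ominus> v)) (x, \<zero>)"
      using line_meets_K[OF meets] by simp
    show "\<not> ((u, v) = (u, \<ominus> v) \<and> (l \<otimes> u \<oplus> n, l \<otimes> v) = \<ominus>\<^bsub>K\<^esub> (l \<otimes> u \<oplus> n, \<ominus> (l \<otimes> v)))"
      using v closed eq_minus_self_iff[of v] by auto
  qed (use closed closed' in \<open>simp_all add: r_minus\<close>)
  then show ?thesis
    unfolding ec_norm_def using closed closed' by (simp add: quad_conj_def)
qed

lemma norm_pt_rational:
  assumes "Some (x, y) \<in> E"
  shows "norm_pt (Some ((x, \<zero>), (y, \<zero>))) = plus_pt (Some (x, y)) (Some (x, y))"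
proof -
  have closed: "x \<in> carrier R" "y \<in> carrier R" using assms by (auto simp: Some_in_E_iff)
  show ?thesis
  proof (cases "y = \<ominus> y")
    case True
    then have "y = \<zero>" using eq_minus_self_iff closed by blast
    then show ?thesis
      using closed unfolding ec_norm_def ec_add_def by (simp add: quad_conj_def)
  next
    case False
    interpret K: weierstrass K "(a2, \<zero>)" "(a4, \<zero>)" by (rule weierstrass_K)
    obtain l n x3 where meets: "line_meets l n (x \<oplus> x) (x \<otimes> x) x3" and y: "y = l \<otimes> x \<oplus> n"
      using line_through_points[OF assms assms] False by metis
    have closed': "l \<in> carrier R" "n \<in> carrier R" "x3 \<in> carrier R"
      using meets by (auto simp: line_meets_def)
    have "K.plus_pt (Some ((x, \<zero>), (y, \<zero>))) (Some ((x, \<zero>), (y, \<zero>)))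
      = Some ((x3, \<zero>), \<ominus>\<^bsub>K\<^esub> ((l, \<zero>) \<otimes>\<^bsub>K\<^esub> (x3, \<zero>) \<oplus>\<^bsub>K\<^esub> (n, \<zero>)))"
      by (rule K.ec_add_line_meets)
        (use False closed closed' line_meets_K[OF meets] in \<open>simp_all add: y\<close>)
    moreover have "plus_pt (Some (x, y)) (Some (x, y)) = Some (x3, \<ominus> (l \<otimes> x3 \<oplus> n))"
      by (rule ec_add_line_meets) (use False closed meets y in simp_all)
    ultimately show ?thesis
      unfolding ec_norm_def using closed closed' by (simp add: quad_conj_def)
  qed
qed

lemma line_through_conjugates:
  assumes "Some ((u, v), (r, s)) \<in> E_K" "v \<noteq> \<zero>"
  obtains l n x where "line_meets l n (u \<oplus> u) (norm_form u v) x" "r = l \<otimes> u \<oplus> n" "s = l \<otimes> v"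
proof -
  have closed: "u \<in> carrier R" "v \<in> carrier R" "r \<in> carrier R" "s \<in> carrier R"
    using assms unfolding Some_in_E_K_iff by auto
  define l n where "l = s \<otimes> inv v" and "n = r \<ominus> l \<otimes> u"
  have l: "l \<in> carrier R" "l \<otimes> v = s"
    using closed assms(2) mult_inv_eq_iff[of s v l] by (simp_all add: l_def)
  have n: "n \<in> carrier R" "r = l \<otimes> u \<oplus> n" using closed l by (simp_all add: n_def class_transfer)
  have "line_meets l n (u \<oplus> u) (norm_form u v) (l \<otimes> l \<ominus> a2 \<ominus> u \<ominus> u)"
    using assms closed l(1) n(1) unfolding n(2) l(2)[symmetric]
    by (subst line_meets_conjugates_iff) simp_all
  then show ?thesis using that n(2) l(2) by blast
qed

lemma norm_pt_cases:
  assumes "Q \<in> E_K"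
  obtains (trivial) "norm_pt Q = None"
    | (double) P where "P \<in> E" "norm_pt Q = plus_pt P P"
    | (line) l n u v x where "Q = Some ((u, v), (l \<otimes> u \<oplus> n, l \<otimes> v))" "u \<in> carrier R" "v \<in> carrier R" "v \<noteq> \<zero>"
        "line_meets l n (u \<oplus> u) (norm_form u v) x"
proof (cases Q)
  case None
  then show ?thesis using trivial by (simp add: ec_norm_def ec_add_def)
next
  case (Some z)
  then obtain u v r s where Q: "Q = Some ((u, v), (r, s))" by (metis surj_pair)
  have closed: "u \<in> carrier R" "v \<in> carrier R" "r \<in> carrier R" "s \<in> carrier R"
    using assms unfolding Q Some_in_E_K_iff by auto
  show ?thesis
  proof (cases "v = \<zero>")
    case False
    obtain l n x where "line_meets l n (u \<oplus> u) (norm_form u v) x" "r = l \<otimes> u \<oplus> n" "s = l \<otimes> v"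
      using line_through_conjugates[OF assms[unfolded Q] False] .
    then show ?thesis using line Q closed False by blast
  next
    case True
    then have "r \<otimes> s \<oplus> r \<otimes> s = \<zero>" using assms closed unfolding Q Some_in_E_K_iff by simp
    then have "r \<otimes> s = \<zero>" using closed add_self_eq_0_iff by simp
    then consider (rational) "s = \<zero>" | (twisted) "r = \<zero>" using closed integral by blast
    then show ?thesis
    proof cases
      case rational
      have "Some (u, r) \<in> E"
        using assms closed unfolding Q True rational Some_in_E_K_iff Some_in_E_iff
        by (simp add: class_transfer algebra_simps)
      then show ?thesis using double norm_pt_rational unfolding Q True rational by blast
    next
      case twisted
      then show ?thesis
        using trivial closed unfolding Q True twisted by (simp add: ec_norm_def ec_add_def quad_conj_def)
    qed
  qed
qed

end

section \<open>Square classes of abscissas\<close>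

text \<open>An injection of the group of square classes into some abelian group.\<close>
locale square_class_field = odd_char_field +
  fixes cl :: "'a \<Rightarrow> 'g::ab_group_add"
  assumes cl_mult: "\<lbrakk>x \<in> carrier R; y \<in> carrier R; x \<noteq> \<zero>; y \<noteq> \<zero>\<rbrakk> \<Longrightarrow> cl (x \<otimes> y) = cl x + cl y"
    and cl_eq_0_iff: "\<lbrakk>x \<in> carrier R; x \<noteq> \<zero>\<rbrakk> \<Longrightarrow> cl x = 0 \<longleftrightarrow> (\<exists>s\<in>carrier R. s \<otimes> s = x)"
begin

lemma cl_double: "x \<in> carrier R \<Longrightarrow> x \<noteq> \<zero> \<Longrightarrow> cl x + cl x = 0"
  using cl_mult[of x x] cl_eq_0_iff[of "x \<otimes> x"] mult_nonzero[of x x] by auto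

lemma cl_add_eq_0_iff: "x \<in> carrier R \<Longrightarrow> x \<noteq> \<zero> \<Longrightarrow> cl x + g = 0 \<longleftrightarrow> g = cl x"
  using cl_double[of x] by (metis add_left_cancel)

lemma cl_eq_iff:
  assumes "x \<in> carrier R" "y \<in> carrier R" "x \<noteq> \<zero>" "y \<noteq> \<zero>"
  shows "cl x = cl y \<longleftrightarrow> (\<exists>s\<in>carrier R. s \<otimes> s = x \<otimes> y)"
  using cl_eq_0_iff[of "x \<otimes> y"] cl_add_eq_0_iff[of x "cl y"] cl_mult[of x y] mult_nonzero[of x y] assms
  by auto

lemma cl_mult_square:
  assumes "s \<in> carrier R" "x \<in> carrier R" "s \<noteq> \<zero>" "x \<noteq> \<zero>"
  shows "cl (s \<otimes> s \<otimes> x) = cl x"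
  using cl_double[of s] cl_mult mult_nonzero assms by simp

lemma cl_product_of_three:
  assumes "x \<in> carrier R" "y \<in> carrier R" "x \<noteq> \<zero>" "y \<noteq> \<zero>"
  shows "cl (x \<otimes> y) + cl x + cl y = 0"
  using cl_mult[OF assms] cl_double[of "x \<otimes> y"] mult_nonzero assms by (simp add: add.assoc)

text \<open>At the root itself, w is the product of the differences to the other two roots.\<close>
definition root_class :: "'a \<Rightarrow> 'a \<Rightarrow> 'g" where
  "root_class w x = cl (if x = \<zero> then w else x)"

lemma root_class_double:
  assumes "x \<in> carrier R" "w \<in> carrier R" "w \<noteq> \<zero>"
  shows "root_class w x + root_class w x = 0"
  using assms by (simp add: root_class_def cl_double)

lemma root_class_eq_0_imp_square:
  assumes "x \<in> carrier R" "root_class w x = 0"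
  obtains s where "s \<in> carrier R" "s \<otimes> s = x"
proof (cases "x = \<zero>")
  case True
  then show ?thesis using that[of \<zero>] by simp
next
  case False
  then show ?thesis using that cl_eq_0_iff[of x] assms by (auto simp: root_class_def)
qed

lemma square_multiple_of_class:
  assumes "x \<in> carrier R" "t \<in> carrier R" "x \<noteq> \<zero>" "t \<noteq> \<zero> \<Longrightarrow> cl x = cl t"
  obtains r where "r \<in> carrier R" "t = x \<otimes> (r \<otimes> r)"
proof (cases "t = \<zero>")
  case True
  then show ?thesis using that[of \<zero>] assms by simp
next
  case False
  then obtain z where z: "z \<in> carrier R" "z \<otimes> z = x \<otimes> t" using assms cl_eq_iff[of x t] by auto
  define i where "i = inv x"
  have i: "i \<in> carrier R" "x \<otimes> i = \<one>" using assms by (simp_all add: i_def)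
  have "x \<otimes> ((z \<otimes> i) \<otimes> (z \<otimes> i)) = (x \<otimes> i) \<otimes> ((z \<otimes> z) \<otimes> i)"
    using z(1) i(1) assms(1) by (simp add: class_transfer algebra_simps)
  also have "\<dots> = (x \<otimes> i) \<otimes> (x \<otimes> i) \<otimes> t"
    unfolding z(2) using i(1) assms(1,2) by (simp add: class_transfer algebra_simps)
  finally show ?thesis using that[of "z \<otimes> i"] z i assms by simp
qed

end

locale weierstrass_square_class = square_class_field + weierstrass +
  assumes a4_nonzero: "a4 \<noteq> \<zero>"
begin

lemma root_class_line_meets:
  assumes meets: "line_meets l n s c x" and "c \<noteq> \<zero>"
  shows "root_class a4 x = cl c"
proof -
  have closed: "c \<in> carrier R" "s \<in> carrier R" "n \<in> carrier R" "l \<in> carrier R" "x \<in> carrier R"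
    and vieta: "c \<oplus> s \<otimes> x = a4 \<ominus> (l \<otimes> n \<oplus> l \<otimes> n)" "c \<otimes> x = n \<otimes> n"
    using meets by (auto simp: line_meets_def)
  show ?thesis
  proof (cases "x = \<zero>")
    case True
    then have "n = \<zero>" using closed vieta(2) integral[of n n] by auto
    then have "c = a4" using True vieta(1) closed by simp
    then show ?thesis using True by (simp add: root_class_def)
  next
    case False
    then have "cl c = cl x" using vieta(2) cl_eq_iff[of c x] \<open>c \<noteq> \<zero>\<close> closed by metis
    then show ?thesis using False by (simp add: root_class_def)
  qed
qed

lemma root_class_collinear:
  assumes meets: "line_meets l n (x1 \<oplus> x2) (x1 \<otimes> x2) x3" and closed: "x1 \<in> carrier R" "x2 \<in> carrier R"
  shows "root_class a4 x3 = root_class a4 x1 + root_class a4 x2"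
proof (cases "x1 \<otimes> x2 = \<zero>")
  case False
  then have "x1 \<noteq> \<zero>" "x2 \<noteq> \<zero>" using closed by auto
  then show ?thesis
    using root_class_line_meets[OF meets False] cl_mult closed by (simp add: root_class_def)
next
  case True
  have closed': "x3 \<in> carrier R" "l \<in> carrier R" "n \<in> carrier R"
    and vieta: "x1 \<otimes> x2 \<oplus> (x1 \<oplus> x2) \<otimes> x3 = a4 \<ominus> (l \<otimes> n \<oplus> l \<otimes> n)" "x1 \<otimes> x2 \<otimes> x3 = n \<otimes> n"
    using meets by (auto simp: line_meets_def)
  have "n = \<zero>" using True vieta(2) closed' integral[of n n] by auto
  then have sum: "(x1 \<oplus> x2) \<otimes> x3 = a4" using vieta(1) True closed closed' by simp
  have zero_case: "root_class a4 x3 = root_class a4 \<zero> + root_class a4 x"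
    if x: "x \<in> carrier R" "x \<otimes> x3 = a4" for x
  proof -
    have nonzero: "x \<noteq> \<zero>" "x3 \<noteq> \<zero>" using x closed' a4_nonzero by auto
    then have "cl a4 + cl x = cl x3"
      using cl_mult[of x x3] cl_double[of x] x closed' by (simp add: add.assoc add.left_commute)
    then show ?thesis using nonzero by (simp add: root_class_def)
  qed
  have "x1 = \<zero> \<or> x2 = \<zero>" using True closed integral by blast
  then show ?thesis using sum closed zero_case[of x1] zero_case[of x2] by (auto simp: add.commute)
qed

end

section \<open>The Kummer map\<close>

locale elliptic_curve = square_class_field +
  fixes a b
  assumes ab_closed [simp]: "a \<in> carrier R" "b \<in> carrier R"
    and ab_nonzero: "a \<noteq> \<zero>" "b \<noteq> \<zero>" and a_neq_b: "a \<noteq> b"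
begin

lemma root_differences_nonzero [simp]:
  "a \<otimes> b \<noteq> \<zero>" "\<ominus> a \<otimes> (b \<ominus> a) \<noteq> \<zero>" "\<ominus> b \<otimes> (a \<ominus> b) \<noteq> \<zero>" "a \<ominus> b \<noteq> \<zero>" "b \<ominus> a \<noteq> \<zero>" "\<ominus> a \<noteq> \<zero>" "\<ominus> b \<noteq> \<zero>"
proof -
  show nonzero: "\<ominus> a \<noteq> \<zero>" "\<ominus> b \<noteq> \<zero>" "a \<ominus> b \<noteq> \<zero>" "b \<ominus> a \<noteq> \<zero>"
    using ab_nonzero a_neq_b eq_diff0 by (auto simp: add.inv_eq_1_iff)
  show "a \<otimes> b \<noteq> \<zero>" "\<ominus> a \<otimes> (b \<ominus> a) \<noteq> \<zero>" "\<ominus> b \<otimes> (a \<ominus> b) \<noteq> \<zero>"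
    by (rule mult_nonzero; use nonzero ab_nonzero in simp)+
qed

sublocale weierstrass_square_class R cl "a \<oplus> b" "a \<otimes> b"
  by unfold_locales simp_all

text \<open>The curve translated by a, so that the root - a becomes 0.\<close>
sublocale shifted: weierstrass_square_class R cl "\<ominus> a \<oplus> (b \<ominus> a)" "\<ominus> a \<otimes> (b \<ominus> a)"
  by unfold_locales (simp_all del: l_minus)

abbreviation \<kappa>\<^sub>0 :: "'a \<Rightarrow> 'b" where
  "\<kappa>\<^sub>0 x \<equiv> root_class (a \<otimes> b) x"

abbreviation \<kappa>\<^sub>a :: "'a \<Rightarrow> 'b" where
  "\<kappa>\<^sub>a x \<equiv> root_class (\<ominus> a \<otimes> (b \<ominus> a)) (x \<oplus> a)"

abbreviation \<kappa>\<^sub>b :: "'a \<Rightarrow> 'b" where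
  "\<kappa>\<^sub>b x \<equiv> root_class (\<ominus> b \<otimes> (a \<ominus> b)) (x \<oplus> b)"

definition kummer :: "('a \<times> 'a) option \<Rightarrow> 'b \<times> 'b" where
  "kummer P = (case P of None \<Rightarrow> (0, 0) | Some (x, y) \<Rightarrow> (\<kappa>\<^sub>0 x, \<kappa>\<^sub>a x))"

lemma kummer_None: "kummer None = 0"
  by (simp add: kummer_def zero_prod_def)

lemma cubic_factored: "x \<in> carrier R \<Longrightarrow> cubic x = x \<otimes> (x \<oplus> a) \<otimes> (x \<oplus> b)"
  by (simp add: class_transfer algebra_simps)

lemma at_root:
  assumes "x \<in> carrier R"
  shows "x \<oplus> a = \<zero> \<Longrightarrow> \<ominus> a = x" "x \<oplus> b = \<zero> \<Longrightarrow> \<ominus> b = x"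
    and "x \<oplus> a = \<zero> \<Longrightarrow> b \<ominus> a = x \<oplus> b" "x \<oplus> b = \<zero> \<Longrightarrow> a \<ominus> b = x \<oplus> a"
proof -
  show root: "x \<oplus> a = \<zero> \<Longrightarrow> \<ominus> a = x" "x \<oplus> b = \<zero> \<Longrightarrow> \<ominus> b = x"
    using assms by (auto intro: minus_equality)
  show "x \<oplus> a = \<zero> \<Longrightarrow> b \<ominus> a = x \<oplus> b" "x \<oplus> b = \<zero> \<Longrightarrow> a \<ominus> b = x \<oplus> a"
    using root assms by (auto simp: a_minus_def a_comm)
qed

lemma root_classes_sum:
  assumes P: "Some (x, y) \<in> E"
  shows "\<kappa>\<^sub>0 x + \<kappa>\<^sub>a x + \<kappa>\<^sub>b x = 0"
proof -
  have closed: "x \<in> carrier R" "y \<in> carrier R" and on_curve: "y \<otimes> y = x \<otimes> (x \<oplus> a) \<otimes> (x \<oplus> b)"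
    using P by (auto simp: Some_in_E_iff cubic_factored)
  consider (zero) "x = \<zero>" | (root_a) "x \<oplus> a = \<zero>" | (root_b) "x \<oplus> b = \<zero>" | (generic) "x \<noteq> \<zero>" "x \<oplus> a \<noteq> \<zero>" "x \<oplus> b \<noteq> \<zero>" by blast
  then show ?thesis
  proof cases
    case zero
    then show ?thesis using cl_product_of_three[of a b] ab_nonzero by (simp add: root_class_def)
  next
    case root_a
    note at_root = at_root(1,3)[OF closed(1) root_a]
    have "x \<noteq> \<zero>" "x \<oplus> b \<noteq> \<zero>"
      using root_differences_nonzero(5,6) by (simp_all only: at_root) auto
    then show ?thesis
      unfolding root_class_def at_root
      using cl_product_of_three[of x "x \<oplus> b"] root_a closed by (simp add: ac_simps)
  next
    case root_b
    note at_root = at_root(2,4)[OF closed(1) root_b]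
    have "x \<noteq> \<zero>" "x \<oplus> a \<noteq> \<zero>"
      using root_differences_nonzero(4,7) by (simp_all only: at_root) auto
    then show ?thesis
      unfolding root_class_def at_root
      using cl_product_of_three[of x "x \<oplus> a"] root_b closed by (simp add: ac_simps)
  next
    case generic
    have "cl (x \<otimes> (x \<oplus> a) \<otimes> (x \<oplus> b)) = 0"
      using cl_eq_0_iff[of "x \<otimes> (x \<oplus> a) \<otimes> (x \<oplus> b)"] on_curve closed generic mult_nonzero by auto
    then show ?thesis using generic closed mult_nonzero by (simp add: root_class_def cl_mult)
  qed
qed

lemma kummer_double: "P \<in> E \<Longrightarrow> kummer P + kummer P = 0"
  by (cases P) (auto simp: kummer_def Some_in_E_iff root_class_double zero_prod_def simp del: l_minus)

lemma kummer_neg_pt: "kummer (neg_pt P) = kummer P"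
  by (cases P) (auto simp: neg_pt_def kummer_def)

lemma line_meets_shifted:
  assumes meets: "line_meets l n s c x"
  shows "shifted.line_meets l (n \<ominus> l \<otimes> a) (s \<oplus> a \<oplus> a) (c \<oplus> a \<otimes> s \<oplus> a \<otimes> a) (x \<oplus> a)"
proof -
  have closed: "l \<in> carrier R" "n \<in> carrier R" "s \<in> carrier R" "c \<in> carrier R" "x \<in> carrier R"
    using meets by (auto simp: line_meets_def)
  define A B L N S C X where of_ring: "A = of_ring R a" "B = of_ring R b" "L = of_ring R l"
    "N = of_ring R n" "S = of_ring R s" "C = of_ring R c" "X = of_ring R x"
  have vieta: "S + X = L * L - (A + B)" "C + S * X = A * B - (L * N + L * N)" "C * X = N * N"
    using meets closed by (simp_all add: line_meets_def class_transfer of_ring)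
  have "(S + A + A) + (X + A) = L * L - (- A + (B - A))"
    using vieta(1) by (simp add: algebra_simps)
  moreover have "(C + A * S + A * A) + (S + A + A) * (X + A)
      = - A * (B - A) - (L * (N - L * A) + L * (N - L * A))"
  proof -
    have "(C + A * S + A * A) + (S + A + A) * (X + A) = (C + S * X) + 2 * A * (S + X) + 3 * A * A"
      by (simp add: algebra_simps)
    then show ?thesis unfolding vieta by (simp add: algebra_simps)
  qed
  moreover have "(C + A * S + A * A) * (X + A) = (N - L * A) * (N - L * A)"
  proof -
    have "(C + A * S + A * A) * (X + A) = C * X + A * (C + S * X) + A * A * (S + X) + A * A * A"
      by (simp add: algebra_simps)
    then show ?thesis unfolding vieta by (simp add: algebra_simps)
  qed
  ultimately show ?thesis
    unfolding shifted.line_meets_def using closed by (simp add: class_transfer of_ring del: l_minus)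
qed

lemma kummer_line_meets:
  assumes meets: "line_meets l n s c x" and "c \<noteq> \<zero>" "c \<oplus> a \<otimes> s \<oplus> a \<otimes> a \<noteq> \<zero>"
  shows "kummer (Some (x, y)) = (cl c, cl (c \<oplus> a \<otimes> s \<oplus> a \<otimes> a))"
  using root_class_line_meets[OF meets] shifted.root_class_line_meets[OF line_meets_shifted[OF meets]]
    assms by (simp add: kummer_def)

lemma kummer_collinear:
  assumes meets: "line_meets l n (x1 \<oplus> x2) (x1 \<otimes> x2) x3" and closed: "x1 \<in> carrier R" "x2 \<in> carrier R"
  shows "kummer (Some (x3, y3)) = kummer (Some (x1, y1)) + kummer (Some (x2, y2))"
proof -
  have "(x1 \<oplus> a) \<oplus> (x2 \<oplus> a) = (x1 \<oplus> x2) \<oplus> a \<oplus> a"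
      "(x1 \<oplus> a) \<otimes> (x2 \<oplus> a) = x1 \<otimes> x2 \<oplus> a \<otimes> (x1 \<oplus> x2) \<oplus> a \<otimes> a"
    using closed by (simp_all add: class_transfer algebra_simps)
  then have "shifted.line_meets l (n \<ominus> l \<otimes> a) ((x1 \<oplus> a) \<oplus> (x2 \<oplus> a)) ((x1 \<oplus> a) \<otimes> (x2 \<oplus> a)) (x3 \<oplus> a)"
    using line_meets_shifted[OF meets] by simp
  then have "\<kappa>\<^sub>a x3 = \<kappa>\<^sub>a x1 + \<kappa>\<^sub>a x2"
    by (rule shifted.root_class_collinear) (use closed in simp_all)
  moreover have "\<kappa>\<^sub>0 x3 = \<kappa>\<^sub>0 x1 + \<kappa>\<^sub>0 x2"
    by (rule root_class_collinear[OF meets closed])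
  ultimately show ?thesis by (simp add: kummer_def)
qed

lemma plus_pt_None: "plus_pt None P = P" "plus_pt P None = P"
  by (simp_all add: ec_add_def split: option.split)

lemma plus_pt_opposite: "plus_pt (Some (x, \<ominus> y)) (Some (x, y)) = None"
  by (simp add: ec_add_def)

lemma kummer_plus_pt:
  assumes P: "P \<in> E" and Q: "Q \<in> E"
  shows "plus_pt P Q \<in> E \<and> kummer (plus_pt P Q) = kummer P + kummer Q"
proof (cases "P = None \<or> Q = None")
  case True
  then show ?thesis using P Q by (auto simp: plus_pt_None kummer_None)
next
  case False
  then obtain x1 y1 x2 y2 where points: "P = Some (x1, y1)" "Q = Some (x2, y2)" by auto
  have closed: "x1 \<in> carrier R" "x2 \<in> carrier R"
    using P Q by (auto simp: points Some_in_E_iff)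
  show ?thesis
  proof (cases "x1 = x2 \<and> y1 = \<ominus> y2")
    case True
    then have "plus_pt P Q = None" "kummer P = kummer Q"
      by (simp_all add: points plus_pt_opposite kummer_def)
    then show ?thesis using kummer_double[OF Q] by (simp add: None_in_E kummer_None)
  next
    case False
    obtain l n x3 where line: "line_meets l n (x1 \<oplus> x2) (x1 \<otimes> x2) x3"
        "y1 = l \<otimes> x1 \<oplus> n" "y2 = l \<otimes> x2 \<oplus> n"
      using line_through_points[OF P[unfolded points] Q[unfolded points] False] .
    have "plus_pt P Q = Some (x3, \<ominus> (l \<otimes> x3 \<oplus> n))"
      unfolding points by (rule ec_add_line_meets[OF line(1) closed line(2,3) False])
    then show ?thesis
      using line_meets_on_curve(2)[OF line(1)] kummer_collinear[OF line(1) closed]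
      by (simp add: points)
  qed
qed

lemmas plus_pt_in_E = kummer_plus_pt[THEN conjunct1]
  and kummer_add = kummer_plus_pt[THEN conjunct2]

text \<open>A tangent at a point of order 2 would be vertical because the roots are distinct.\<close>
lemma line_meets_twice_nonzero:
  assumes meets: "line_meets l n (x \<oplus> x) (x \<otimes> x) x3" and x: "x \<in> carrier R"
  shows "l \<otimes> x \<oplus> n \<noteq> \<zero>"
proof
  assume zero: "l \<otimes> x \<oplus> n = \<zero>"
  have closed: "l \<in> carrier R" "n \<in> carrier R" "x3 \<in> carrier R"
    using meets by (auto simp: line_meets_def)
  then have on_curve: "Some (x, \<zero>) \<in> E"
    and derivative: "x \<otimes> x \<oplus> x \<otimes> x \<oplus> x \<otimes> x \<oplus> ((a \<oplus> b) \<otimes> x \<oplus> (a \<oplus> b) \<otimes> x) \<oplus> a \<otimes> b = \<zero>"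
    using meets x line_meets_twice_iff[of x l n x3] by (auto simp: zero)
  have "x \<otimes> (x \<oplus> a) \<otimes> (x \<oplus> b) = \<zero>" using on_curve cubic_factored by (simp add: Some_in_E_iff)
  then consider (zero) "x = \<zero>" | (root_a) "x \<oplus> a = \<zero>" | (root_b) "x \<oplus> b = \<zero>" using x integral by (metis m_closed a_closed ab_closed)
  then show False
  proof cases
    case zero
    then show False using derivative root_differences_nonzero(1) by simp
  next
    case root_a
    then have "\<ominus> a \<otimes> (b \<ominus> a) = \<zero>"
      using derivative at_root(1)[OF x root_a, symmetric] by (simp add: class_transfer algebra_simps del: root_differences_nonzero)
    then show False using root_differences_nonzero(2) by blast
  next
    case root_b
    then have "\<ominus> b \<otimes> (a \<ominus> b) = \<zero>"
      using derivative at_root(2)[OF x root_b, symmetric] by (simp add: class_transfer algebra_simps del: root_differences_nonzero)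
    then show False using root_differences_nonzero(3) by blast
  qed
qed

lemma double_line_meets:
  assumes meets: "line_meets l n (x \<oplus> x) (x \<otimes> x) x3" and x: "x \<in> carrier R"
  shows "Some (x, l \<otimes> x \<oplus> n) \<in> E"
    and "plus_pt (Some (x, l \<otimes> x \<oplus> n)) (Some (x, l \<otimes> x \<oplus> n)) = Some (x3, \<ominus> (l \<otimes> x3 \<oplus> n))"
proof -
  have closed: "l \<in> carrier R" "n \<in> carrier R" "x3 \<in> carrier R"
    using meets by (auto simp: line_meets_def)
  then show "Some (x, l \<otimes> x \<oplus> n) \<in> E" using meets x line_meets_twice_iff by auto
  show "plus_pt (Some (x, l \<otimes> x \<oplus> n)) (Some (x, l \<otimes> x \<oplus> n)) = Some (x3, \<ominus> (l \<otimes> x3 \<oplus> n))"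
    by (rule ec_add_line_meets[OF meets x x refl refl])
      (use line_meets_twice_nonzero[OF meets x] eq_minus_self_iff closed x in simp)
qed

lemma line_meets_reflected:
  assumes "line_meets l n (x1 \<oplus> x2) (x1 \<otimes> x2) x3" "x1 \<in> carrier R" "x2 \<in> carrier R"
  shows "line_meets (\<ominus> l) (\<ominus> n) (x1 \<oplus> x3) (x1 \<otimes> x3) x2"
  using assms unfolding line_meets_def by (auto simp: class_transfer algebra_simps)

lemma chord_neg_cancel:
  assumes P: "Some (x1, y1) \<in> E" and Q: "Some (x2, y2) \<in> E" and not_opposite: "\<not> (x1 = x2 \<and> \<ominus> y1 = \<ominus> y2)"
  shows "plus_pt (Some (x1, y1)) (plus_pt (Some (x1, \<ominus> y1)) (Some (x2, y2))) = Some (x2, y2)"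
proof -
  have closed: "x1 \<in> carrier R" "y1 \<in> carrier R" "x2 \<in> carrier R" "y2 \<in> carrier R"
    using P Q by (auto simp: Some_in_E_iff)
  have neg_P: "Some (x1, \<ominus> y1) \<in> E" using neg_pt_in_E[OF P] by (simp add: neg_pt_def)
  obtain l n x3 where meets: "line_meets l n (x1 \<oplus> x2) (x1 \<otimes> x2) x3"
      and y1: "\<ominus> y1 = l \<otimes> x1 \<oplus> n" and y2: "y2 = l \<otimes> x2 \<oplus> n"
    using line_through_points[OF neg_P Q not_opposite] .
  have closed': "l \<in> carrier R" "n \<in> carrier R" "x3 \<in> carrier R"
    using meets by (auto simp: line_meets_def)
  note reflected = line_meets_reflected[OF meets closed(1,3)]
  have y1': "y1 = \<ominus> l \<otimes> x1 \<oplus> \<ominus> n"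
    using arg_cong[OF y1, of "\<lambda>z. \<ominus> z"] closed closed' by (simp add: class_transfer)
  have third_not_opposite: "\<not> (x1 = x3 \<and> y1 = \<ominus> (\<ominus> (l \<otimes> x3 \<oplus> n)))"
  proof
    assume opposite: "x1 = x3 \<and> y1 = \<ominus> (\<ominus> (l \<otimes> x3 \<oplus> n))"
    then have "y1 = \<ominus> y1" using y1 closed closed' by simp
    then have "y1 = \<zero>" using eq_minus_self_iff closed by blast
    then show False using line_meets_twice_nonzero[of "\<ominus> l" "\<ominus> n" x1 x2] reflected y1' opposite closed by simp
  qed
  have "plus_pt (Some (x1, \<ominus> y1)) (Some (x2, y2)) = Some (x3, \<ominus> (l \<otimes> x3 \<oplus> n))"
    by (rule ec_add_line_meets[OF meets closed(1,3) y1 y2 not_opposite])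
  also have "plus_pt (Some (x1, y1)) (Some (x3, \<ominus> (l \<otimes> x3 \<oplus> n))) = Some (x2, \<ominus> (\<ominus> l \<otimes> x2 \<oplus> \<ominus> n))"
    by (rule ec_add_line_meets[OF reflected closed(1) closed'(3) y1' _ third_not_opposite])
      (use closed' in \<open>simp add: class_transfer\<close>)
  also have "\<ominus> (\<ominus> l \<otimes> x2 \<oplus> \<ominus> n) = y2"
    unfolding y2 using closed closed' by (simp add: class_transfer)
  finally show ?thesis .
qed

text \<open>The only instance of associativity that is needed.\<close>
lemma plus_pt_neg_cancel:
  assumes P: "P \<in> E" and Q: "Q \<in> E"
  shows "plus_pt P (plus_pt (neg_pt P) Q) = Q"
proof (cases "P = None \<or> Q = None")
  case True
  then show ?thesis
    using P by (auto simp: neg_pt_def plus_pt_None Some_in_E_iff ec_add_def split: option.splits)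
next
  case False
  then obtain x1 y1 x2 y2 where points: "P = Some (x1, y1)" "Q = Some (x2, y2)" by auto
  have closed: "x1 \<in> carrier R" "y1 \<in> carrier R" "x2 \<in> carrier R" "y2 \<in> carrier R"
    using P Q by (auto simp: points Some_in_E_iff)
  show ?thesis
  proof (cases "x1 = x2 \<and> \<ominus> y1 = \<ominus> y2")
    case True
    then have "P = Q" using closed by (simp add: points neg_equal_iff_equal)
    then show ?thesis using closed by (simp add: points neg_pt_def plus_pt_opposite plus_pt_None)
  next
    case False
    then show ?thesis using chord_neg_cancel P Q by (simp add: points neg_pt_def)
  qed
qed

definition half_pt :: "'a \<Rightarrow> 'a \<Rightarrow> 'a \<Rightarrow> ('a \<times> 'a) option" where
  "half_pt \<alpha> \<beta> \<gamma> = Some ((\<alpha> \<oplus> \<beta>) \<otimes> (\<alpha> \<oplus> \<gamma>), (\<alpha> \<oplus> \<beta>) \<otimes> (\<alpha> \<oplus> \<gamma>) \<otimes> (\<beta> \<oplus> \<gamma>))"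

text \<open>The tangent at the half has slope \<^term>\<open>\<alpha> \<oplus> \<beta> \<oplus> \<gamma>\<close>.\<close>
lemma double_half_pt:
  assumes closed: "\<alpha> \<in> carrier R" "\<beta> \<in> carrier R" "\<gamma> \<in> carrier R"
    and roots: "\<beta> \<otimes> \<beta> = \<alpha> \<otimes> \<alpha> \<oplus> a" "\<gamma> \<otimes> \<gamma> = \<alpha> \<otimes> \<alpha> \<oplus> b"
  shows "half_pt \<alpha> \<beta> \<gamma> \<in> E" "plus_pt (half_pt \<alpha> \<beta> \<gamma>) (half_pt \<alpha> \<beta> \<gamma>) = Some (\<alpha> \<otimes> \<alpha>, \<alpha> \<otimes> \<beta> \<otimes> \<gamma>)"
proof -
  define l where "l = \<alpha> \<oplus> \<beta> \<oplus> \<gamma>"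
  define u where "u = (\<alpha> \<oplus> \<beta>) \<otimes> (\<alpha> \<oplus> \<gamma>)"
  define n where "n = \<ominus> (\<alpha> \<otimes> \<beta> \<otimes> \<gamma>) \<ominus> l \<otimes> (\<alpha> \<otimes> \<alpha>)"
  have closed': "l \<in> carrier R" "u \<in> carrier R" "n \<in> carrier R"
    using closed by (simp_all add: l_def u_def n_def)
  have ab: "a = \<beta> \<otimes> \<beta> \<ominus> \<alpha> \<otimes> \<alpha>" "b = \<gamma> \<otimes> \<gamma> \<ominus> \<alpha> \<otimes> \<alpha>"
    unfolding roots using closed by (simp_all add: class_transfer)
  have w: "l \<otimes> u \<oplus> n = (\<alpha> \<oplus> \<beta>) \<otimes> (\<alpha> \<oplus> \<gamma>) \<otimes> (\<beta> \<oplus> \<gamma>)"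
    using closed closed' by (simp add: class_transfer l_def u_def n_def algebra_simps)
  have "line_meets l n (u \<oplus> u) (u \<otimes> u) (\<alpha> \<otimes> \<alpha>)"
    unfolding line_meets_def unfolding ab using closed closed'
    by (simp add: class_transfer l_def u_def n_def algebra_simps)
  note double = double_line_meets[OF this closed'(2), unfolded w]
  have half: "half_pt \<alpha> \<beta> \<gamma> = Some (u, (\<alpha> \<oplus> \<beta>) \<otimes> (\<alpha> \<oplus> \<gamma>) \<otimes> (\<beta> \<oplus> \<gamma>))"
    by (simp add: half_pt_def u_def)
  show "half_pt \<alpha> \<beta> \<gamma> \<in> E" using double(1) by (simp only: half)
  have "\<ominus> (l \<otimes> (\<alpha> \<otimes> \<alpha>) \<oplus> n) = \<alpha> \<otimes> \<beta> \<otimes> \<gamma>"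
    using closed closed' by (simp add: class_transfer n_def)
  then show "plus_pt (half_pt \<alpha> \<beta> \<gamma>) (half_pt \<alpha> \<beta> \<gamma>) = Some (\<alpha> \<otimes> \<alpha>, \<alpha> \<otimes> \<beta> \<otimes> \<gamma>)"
    using double(2) by (simp only: half)
qed

lemma kummer_eq_0_imp_roots:
  assumes P: "Some (x, y) \<in> E" and trivial: "kummer (Some (x, y)) = 0"
  obtains \<alpha> \<beta> \<gamma> where "\<alpha> \<in> carrier R" "\<beta> \<in> carrier R" "\<gamma> \<in> carrier R"
    "\<alpha> \<otimes> \<alpha> = x" "\<beta> \<otimes> \<beta> = x \<oplus> a" "\<gamma> \<otimes> \<gamma> = x \<oplus> b" "\<alpha> \<otimes> \<beta> \<otimes> \<gamma> = y"
proof -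
  have closed: "x \<in> carrier R" "y \<in> carrier R" and on_curve: "y \<otimes> y = x \<otimes> (x \<oplus> a) \<otimes> (x \<oplus> b)"
    using P by (auto simp: Some_in_E_iff cubic_factored)
  have "\<kappa>\<^sub>0 x = 0" "\<kappa>\<^sub>a x = 0" using trivial by (auto simp: kummer_def zero_prod_def)
  moreover from this have "\<kappa>\<^sub>b x = 0" using root_classes_sum[OF P] by simp
  ultimately obtain \<alpha> \<beta> \<gamma> where roots: "\<alpha> \<in> carrier R" "\<beta> \<in> carrier R" "\<gamma> \<in> carrier R"
      and squares: "\<alpha> \<otimes> \<alpha> = x" "\<beta> \<otimes> \<beta> = x \<oplus> a" "\<gamma> \<otimes> \<gamma> = x \<oplus> b"
    using root_class_eq_0_imp_square closed(1) by (metis a_closed ab_closed)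
  have "(\<alpha> \<otimes> \<beta> \<otimes> \<gamma>) \<otimes> (\<alpha> \<otimes> \<beta> \<otimes> \<gamma>) = (\<alpha> \<otimes> \<alpha>) \<otimes> (\<beta> \<otimes> \<beta>) \<otimes> (\<gamma> \<otimes> \<gamma>)"
    using roots by (simp add: class_transfer algebra_simps)
  then have "y \<otimes> y = (\<alpha> \<otimes> \<beta> \<otimes> \<gamma>) \<otimes> (\<alpha> \<otimes> \<beta> \<otimes> \<gamma>)" by (simp only: squares on_curve)
  then consider (same_sign) "y = \<alpha> \<otimes> \<beta> \<otimes> \<gamma>" | (opposite_sign) "y = \<ominus> (\<alpha> \<otimes> \<beta> \<otimes> \<gamma>)"
    using square_eq_iff[of y "\<alpha> \<otimes> \<beta> \<otimes> \<gamma>"] roots closed by auto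
  then show ?thesis
  proof cases
    case same_sign
    then show ?thesis using that roots squares by blast
  next
    case opposite_sign
    then show ?thesis using that[of "\<ominus> \<alpha>" \<beta> \<gamma>] roots squares closed by (simp add: l_minus r_minus)
  qed
qed

lemma kummer_eq_0_imp_double:
  assumes P: "P \<in> E" and trivial: "kummer P = 0"
  obtains Q where "Q \<in> E" "plus_pt Q Q = P"
proof (cases P)
  case None
  then show ?thesis using that[of None] None_in_E by (simp add: plus_pt_None)
next
  case (Some p)
  then obtain x y where "P = Some (x, y)" by (cases p) auto
  then show ?thesis
    using kummer_eq_0_imp_roots[of x y] that double_half_pt P trivial by metis
qed

end

section \<open>Kramer's criterion\<close>

text \<open>Let X_i = x - e_i for the roots e_i of the cubic and suppose that X_i r_i^2 - d X_i = k is
  independent of i. The line through a point of E(F(sqrt d)) with norm (x, y) and its conjugate has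
  slope l = y (r_1 r_2 + r_1 r_3 + r_2 r_3 + d) / k. Writing m for y r_1 keeps the formula valid at
  the torsion point with X_1 = 0.\<close>

lemma kramer_slope_identity:
  fixes k :: "'k::comm_ring_1"
  assumes k_l: "k * l = m * A + y * B" and k_W: "k * W = X2 * X3 + l * y"
    and A: "A = r2 + r3" and B: "B = r2 * r3 + d"
    and k2: "k = X2 * (r2 * r2 - d)" and k3: "k = X3 * (r3 * r3 - d)"
    and yy: "y * y = X1 * X2 * X3" and mm: "m * m = X2 * X3 * k + d * (y * y)"
  shows "k * k * (l * l) = k * k * (X2 + X3 - X1 + 2 * (B * W))"
proof -
  have "k * k * X1 = (X2 * (r2 * r2 - d)) * (X3 * (r3 * r3 - d)) * X1" using k2 k3 by metis
  also have "\<dots> = (y * y) * (B * B - d * A * A)" unfolding yy A B by (simp add: algebra_simps)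
  finally have BA: "(y * y) * (B * B - d * A * A) = k * k * X1" by simp
  have "X2 * X3 * (A * A) = X3 * (X2 * (r2 * r2 - d)) + X2 * (X3 * (r3 * r3 - d)) + 2 * B * X2 * X3"
    unfolding A B by (simp add: algebra_simps)
  also have "\<dots> = k * (X2 + X3) + 2 * B * X2 * X3"
    unfolding k2[symmetric] k3[symmetric] by (simp add: algebra_simps)
  finally have XA: "X2 * X3 * (A * A) = k * (X2 + X3) + 2 * B * X2 * X3" .
  have "k * k * (l * l) = (k * l) * (k * l)" by (simp add: algebra_simps)
  also have "\<dots> = (m * m) * (A * A) + 2 * B * y * (m * A + y * B) - (y * y) * (B * B)"
    unfolding k_l by (simp add: algebra_simps)
  also have "\<dots> = k * (X2 * X3 * (A * A)) - (y * y) * (B * B - d * A * A) + 2 * B * y * (m * A + y * B)"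
    unfolding mm by (simp add: algebra_simps)
  also have "\<dots> = k * (k * (X2 + X3) + 2 * B * X2 * X3) - k * k * X1 + 2 * B * y * (k * l)"
    unfolding XA BA k_l ..
  also have "\<dots> = k * k * (X2 + X3 - X1) + 2 * B * k * (X2 * X3 + l * y)" by (simp add: algebra_simps)
  also have "\<dots> = k * k * (X2 + X3 - X1 + 2 * (B * W))"
    unfolding k_W[symmetric] by (simp add: algebra_simps)
  finally show ?thesis .
qed

lemma kramer_norm_identity:
  fixes k :: "'k::comm_ring_1"
  assumes ll: "l * l = X2 + X3 - X1 + 2 * (B * W)" and k_W: "k * W = X2 * X3 + l * y"
    and A: "A = r2 + r3" and B: "B = r2 * r3 + d"
    and k2: "k = X2 * (r2 * r2 - d)" and k3: "k = X3 * (r3 * r3 - d)"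
    and yy: "y * y = X1 * X2 * X3"
  shows "X2 * X3 * ((B * W - X1) * (B * W - X1) - d * (A * W * (A * W)))
    = X2 * X3 * (X1 * X2 + X1 * X3 + X2 * X3 + 2 * (l * y))"
proof -
  have "X2 * X3 * (B * B - d * A * A) * (W * W) = (X2 * (r2 * r2 - d)) * (X3 * (r3 * r3 - d)) * (W * W)"
    unfolding A B by (simp add: algebra_simps)
  also have "\<dots> = (k * W) * (k * W)"
    unfolding k2[symmetric] k3[symmetric] by (simp add: algebra_simps)
  also have "\<dots> = X2 * X3 * (X2 * X3 + 2 * (l * y)) + (l * l) * (y * y)"
    unfolding k_W by (simp add: algebra_simps)
  also have "\<dots> = X2 * X3 * (X2 * X3 + 2 * (l * y) + X1 * (l * l))"
    unfolding yy by (simp add: algebra_simps)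
  finally have BA: "X2 * X3 * (B * B - d * A * A) * (W * W) = \<dots>" .
  have "X2 * X3 * ((B * W - X1) * (B * W - X1) - d * (A * W * (A * W)))
    = X2 * X3 * (B * B - d * A * A) * (W * W) + X2 * X3 * (X1 * X1 - X1 * (2 * (B * W)))"
    by (simp add: algebra_simps)
  also have "\<dots> = X2 * X3 * (X1 * X2 + X1 * X3 + X2 * X3 + 2 * (l * y))"
    unfolding BA ll by (simp add: algebra_simps)
  finally show ?thesis .
qed

lemma (in nonsquare) kramer_line:
  assumes closed: "y \<in> carrier R" "X1 \<in> carrier R" "X2 \<in> carrier R" "X3 \<in> carrier R" "k \<in> carrier R"
      "m \<in> carrier R" "r2 \<in> carrier R" "r3 \<in> carrier R"
    and nonzero: "X2 \<noteq> \<zero>" "X3 \<noteq> \<zero>" and yy: "y \<otimes> y = X1 \<otimes> X2 \<otimes> X3"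
    and mm: "m \<otimes> m = X2 \<otimes> X3 \<otimes> (k \<oplus> d \<otimes> X1)"
    and k2: "k = X2 \<otimes> (r2 \<otimes> r2 \<ominus> d)" and k3: "k = X3 \<otimes> (r3 \<otimes> r3 \<ominus> d)"
  obtains l h v where "l \<in> carrier R" "h \<in> carrier R" "v \<in> carrier R"
    "l \<otimes> l = X1 \<oplus> X2 \<oplus> X3 \<oplus> (h \<oplus> h)"
    "norm_form h v = X1 \<otimes> X2 \<oplus> X1 \<otimes> X3 \<oplus> X2 \<otimes> X3 \<oplus> (l \<otimes> y \<oplus> l \<otimes> y)"
proof -
  have "r2 \<otimes> r2 \<ominus> d \<noteq> \<zero>" using d_nonsquare[of r2] closed by (simp add: eq_diff0)
  then have k_nonzero: "k \<noteq> \<zero>" using k2 mult_nonzero[of X2 "r2 \<otimes> r2 \<ominus> d"] closed nonzero by auto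
  define A B where "A = r2 \<oplus> r3" and "B = r2 \<otimes> r3 \<oplus> d"
  define l where "l = (m \<otimes> A \<oplus> y \<otimes> B) \<otimes> inv k"
  define W where "W = (X2 \<otimes> X3 \<oplus> l \<otimes> y) \<otimes> inv k"
  have AB: "A \<in> carrier R" "B \<in> carrier R" using closed by (simp_all add: A_def B_def)
  have l: "l \<in> carrier R" "l \<otimes> k = m \<otimes> A \<oplus> y \<otimes> B"
    using mult_inv_eq_iff[of "m \<otimes> A \<oplus> y \<otimes> B" k l] AB closed k_nonzero by (simp_all add: l_def)
  have W: "W \<in> carrier R" "W \<otimes> k = X2 \<otimes> X3 \<oplus> l \<otimes> y"
    using mult_inv_eq_iff[of "X2 \<otimes> X3 \<oplus> l \<otimes> y" k W] l closed k_nonzero by (simp_all add: W_def)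
  have k_l: "of_ring R k * of_ring R l = of_ring R m * of_ring R A + of_ring R y * of_ring R B"
    using l closed AB by (simp add: class_transfer mult.commute)
  have k_W: "of_ring R k * of_ring R W = of_ring R X2 * of_ring R X3 + of_ring R l * of_ring R y"
    using l(1) W closed by (simp add: class_transfer mult.commute)
  have A: "of_ring R A = of_ring R r2 + of_ring R r3"
    and B: "of_ring R B = of_ring R r2 * of_ring R r3 + of_ring R d"
    using closed by (simp_all add: A_def B_def class_transfer)
  have k2': "of_ring R k = of_ring R X2 * (of_ring R r2 * of_ring R r2 - of_ring R d)"
    and k3': "of_ring R k = of_ring R X3 * (of_ring R r3 * of_ring R r3 - of_ring R d)"
    and yy': "of_ring R y * of_ring R y = of_ring R X1 * of_ring R X2 * of_ring R X3"
    using k2 k3 yy closed by (simp_all add: class_transfer)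
  have mm': "of_ring R m * of_ring R m
      = of_ring R X2 * of_ring R X3 * of_ring R k + of_ring R d * (of_ring R y * of_ring R y)"
    unfolding yy' using mm closed by (simp add: class_transfer algebra_simps)
  have "k \<otimes> k \<otimes> (l \<otimes> l) = k \<otimes> k \<otimes> (X2 \<oplus> X3 \<ominus> X1 \<oplus> (B \<otimes> W \<oplus> B \<otimes> W))"
    using kramer_slope_identity[OF k_l k_W A B k2' k3' yy' mm'] l(1) W(1) AB closed
    by (simp add: class_transfer)
  then have ll: "l \<otimes> l = X2 \<oplus> X3 \<ominus> X1 \<oplus> (B \<otimes> W \<oplus> B \<otimes> W)"
    using m_lcancel[of "k \<otimes> k"] mult_nonzero k_nonzero l(1) W(1) AB closed by simp
  then have ll': "of_ring R l * of_ring R l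
      = of_ring R X2 + of_ring R X3 - of_ring R X1 + 2 * (of_ring R B * of_ring R W)"
    using l(1) W(1) AB closed by (simp add: class_transfer)
  define h v where "h = B \<otimes> W \<ominus> X1" and "v = A \<otimes> W"
  have hv: "h \<in> carrier R" "v \<in> carrier R" using W(1) AB closed by (simp_all add: h_def v_def)
  have "X2 \<otimes> X3 \<otimes> norm_form h v = X2 \<otimes> X3 \<otimes> (X1 \<otimes> X2 \<oplus> X1 \<otimes> X3 \<oplus> X2 \<otimes> X3 \<oplus> (l \<otimes> y \<oplus> l \<otimes> y))"
    using kramer_norm_identity[OF ll' k_W A B k2' k3' yy'] l(1) W(1) AB closed
    by (simp add: class_transfer h_def v_def)
  then have "norm_form h v = X1 \<otimes> X2 \<oplus> X1 \<otimes> X3 \<oplus> X2 \<otimes> X3 \<oplus> (l \<otimes> y \<oplus> l \<otimes> y)"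
    using m_lcancel[of "X2 \<otimes> X3"] mult_nonzero nonzero l(1) hv closed by simp
  moreover have "l \<otimes> l = X1 \<oplus> X2 \<oplus> X3 \<oplus> (h \<oplus> h)"
    unfolding ll using W(1) AB closed by (simp add: h_def class_transfer)
  ultimately show ?thesis using that l(1) hv by blast
qed

locale curve_nonsquare = elliptic_curve + nonsquare
begin

sublocale weierstrass_nonsquare R "a \<oplus> b" "a \<otimes> b"
  by unfold_locales

abbreviation norms :: "('a \<times> 'a) option set" where
  "norms \<equiv> norm_pt ` E_K"

lemma double_in_norms:
  assumes "Q \<in> E"
  shows "plus_pt Q Q \<in> norms"
proof (cases Q)
  case None
  have "norm_pt None = None" by (simp add: ec_norm_def ec_add_def)
  moreover have "None \<in> E_K" by (simp add: ec_points_def)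
  ultimately show ?thesis unfolding None plus_pt_None by (metis imageI)
next
  case (Some q)
  then obtain x y where Q: "Q = Some (x, y)" by (cases q) auto
  then have "Some ((x, \<zero>), (y, \<zero>)) \<in> E_K"
    using assms by (auto simp: Some_in_E_K_iff Some_in_E_iff class_transfer algebra_simps)
  then show ?thesis using norm_pt_rational assms unfolding Q by (metis imageI)
qed

lemma norm_line_meets:
  assumes P: "Some (x, y) \<in> E" and closed: "l \<in> carrier R" "h \<in> carrier R" "v \<in> carrier R"
    and ll: "l \<otimes> l = x \<oplus> (x \<oplus> a) \<oplus> (x \<oplus> b) \<oplus> (h \<oplus> h)"
    and norm: "norm_form h v
      = x \<otimes> (x \<oplus> a) \<oplus> x \<otimes> (x \<oplus> b) \<oplus> (x \<oplus> a) \<otimes> (x \<oplus> b) \<oplus> (l \<otimes> y \<oplus> l \<otimes> y)"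
    and u: "u = x \<oplus> h" and n: "n = \<ominus> y \<ominus> l \<otimes> x"
  shows "line_meets l n (u \<oplus> u) (norm_form u v) x"
proof -
  have xy: "x \<in> carrier R" "y \<in> carrier R" and on_curve: "y \<otimes> y = cubic x"
    using P by (auto simp: Some_in_E_iff)
  define X Y L H A B N where of_ring: "X = of_ring R x" "Y = of_ring R y" "L = of_ring R l"
    "H = of_ring R h" "A = of_ring R a" "B = of_ring R b" "N = of_ring R (norm_form h v)"
  have LL: "L * L = 3 * X + (A + B) + 2 * H"
    using ll closed xy by (simp add: class_transfer of_ring)
  have N: "N = 3 * (X * X) + 2 * (A + B) * X + A * B + 2 * (L * Y)"
    unfolding norm of_ring using closed xy by (simp add: class_transfer algebra_simps)
  have YY: "Y * Y = X * (X * X) + (A + B) * (X * X) + A * B * X"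
    using on_curve xy by (simp add: class_transfer of_ring)
  have u_norm: "norm_form u v = x \<otimes> x \<oplus> (x \<otimes> h \<oplus> x \<otimes> h) \<oplus> norm_form h v"
    using closed xy by (simp add: u class_transfer algebra_simps)
  have "(- Y - L * X) * (- Y - L * X) = Y * Y + 2 * (L * Y) * X + (L * L) * X * X"
    by (simp add: algebra_simps)
  also have "\<dots> = (X * X + 2 * (X * H) + N) * X"
    unfolding N LL YY by (simp add: algebra_simps)
  finally have product: "norm_form u v \<otimes> x = n \<otimes> n"
    unfolding u_norm using closed xy by (simp add: n class_transfer of_ring algebra_simps)
  have "A * B - 2 * (L * (- Y - L * X)) = A * B + 2 * (L * Y) + 2 * (L * L) * X"
    by (simp add: algebra_simps)
  also have "\<dots> = X * X + 2 * (X * H) + N + (X + H + (X + H)) * X"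
    unfolding N LL by (simp add: algebra_simps)
  finally have second: "norm_form u v \<oplus> (u \<oplus> u) \<otimes> x = a \<otimes> b \<ominus> (l \<otimes> n \<oplus> l \<otimes> n)"
    unfolding u_norm using closed xy by (simp add: u n class_transfer of_ring algebra_simps)
  show ?thesis
    unfolding line_meets_def using second product closed xy ll
    by (simp add: u n class_transfer algebra_simps)
qed

lemma in_normsI:
  assumes P: "Some (x, y) \<in> E" and closed: "l \<in> carrier R" "h \<in> carrier R" "v \<in> carrier R"
    and ll: "l \<otimes> l = x \<oplus> (x \<oplus> a) \<oplus> (x \<oplus> b) \<oplus> (h \<oplus> h)"
    and norm: "norm_form h v
      = x \<otimes> (x \<oplus> a) \<oplus> x \<otimes> (x \<oplus> b) \<oplus> (x \<oplus> a) \<otimes> (x \<oplus> b) \<oplus> (l \<otimes> y \<oplus> l \<otimes> y)"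
  shows "Some (x, y) \<in> norms"
proof -
  have xy: "x \<in> carrier R" "y \<in> carrier R" using P by (auto simp: Some_in_E_iff)
  define u n where "u = x \<oplus> h" and "n = \<ominus> y \<ominus> l \<otimes> x"
  have un: "u \<in> carrier R" "n \<in> carrier R" using closed xy by (simp_all add: u_def n_def)
  have meets: "line_meets l n (u \<oplus> u) (norm_form u v) x"
    by (rule norm_line_meets[OF P closed ll norm u_def n_def])
  have y: "\<ominus> (l \<otimes> x \<oplus> n) = y" using closed xy by (simp add: n_def class_transfer)
  show ?thesis
  proof (cases "v = \<zero>")
    case True
    then have "line_meets l n (u \<oplus> u) (u \<otimes> u) x" using meets un by simp
    then have "Some (x, y) = plus_pt (Some (u, l \<otimes> u \<oplus> n)) (Some (u, l \<otimes> u \<oplus> n))"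
        "Some (u, l \<otimes> u \<oplus> n) \<in> E"
      using double_line_meets un y by simp_all
    then show ?thesis using double_in_norms by metis
  next
    case False
    then have "Some ((u, v), (l \<otimes> u \<oplus> n, l \<otimes> v)) \<in> E_K"
      using meets closed un xy line_meets_conjugates_iff[of l n u v x] by simp
    then show ?thesis
      using norm_pt_line_meets[OF meets un(1) closed(3) False] y by (metis imageI)
  qed
qed

lemma kummer_norm_line:
  assumes meets: "line_meets l n (u \<oplus> u) (norm_form u v) x"
    and closed: "u \<in> carrier R" "v \<in> carrier R" and v: "v \<noteq> \<zero>"
  shows "kummer (Some (x, y)) = (cl (norm_form u v), cl (norm_form (u \<oplus> a) v))"
proof -
  have "norm_form u v \<oplus> a \<otimes> (u \<oplus> u) \<oplus> a \<otimes> a = norm_form (u \<oplus> a) v"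
    using closed by (simp add: class_transfer algebra_simps)
  then show ?thesis
    using kummer_line_meets[OF meets] norm_form_nonzero closed v by simp
qed

lemma norm_line_of_classes:
  assumes closed: "y \<in> carrier R" "X1 \<in> carrier R" "X2 \<in> carrier R" "X3 \<in> carrier R" "k \<in> carrier R"
    and nonzero: "X2 \<noteq> \<zero>" "X3 \<noteq> \<zero>" and yy: "y \<otimes> y = X1 \<otimes> X2 \<otimes> X3"
    and class1: "k \<oplus> d \<otimes> X1 \<noteq> \<zero> \<Longrightarrow> root_class (X2 \<otimes> X3) X1 = cl (k \<oplus> d \<otimes> X1)"
    and class2: "k \<oplus> d \<otimes> X2 \<noteq> \<zero> \<Longrightarrow> cl X2 = cl (k \<oplus> d \<otimes> X2)"
    and class3: "k \<oplus> d \<otimes> X3 \<noteq> \<zero> \<Longrightarrow> cl X3 = cl (k \<oplus> d \<otimes> X3)"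
  obtains l h v where "l \<in> carrier R" "h \<in> carrier R" "v \<in> carrier R"
    "l \<otimes> l = X1 \<oplus> X2 \<oplus> X3 \<oplus> (h \<oplus> h)"
    "norm_form h v = X1 \<otimes> X2 \<oplus> X1 \<otimes> X3 \<oplus> X2 \<otimes> X3 \<oplus> (l \<otimes> y \<oplus> l \<otimes> y)"
proof -
  obtain r2 where r2: "r2 \<in> carrier R" "k \<oplus> d \<otimes> X2 = X2 \<otimes> (r2 \<otimes> r2)"
    using square_multiple_of_class[of X2 "k \<oplus> d \<otimes> X2"] closed nonzero class2
    by (metis a_closed m_closed d_closed)
  obtain r3 where r3: "r3 \<in> carrier R" "k \<oplus> d \<otimes> X3 = X3 \<otimes> (r3 \<otimes> r3)"
    using square_multiple_of_class[of X3 "k \<oplus> d \<otimes> X3"] closed nonzero class3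
    by (metis a_closed m_closed d_closed)
  have k: "k = X2 \<otimes> (r2 \<otimes> r2 \<ominus> d)" "k = X3 \<otimes> (r3 \<otimes> r3 \<ominus> d)"
    using r2 r3 closed by (simp_all add: class_transfer algebra_simps flip: eq_diff_eq)
  obtain m where m: "m \<in> carrier R" "m \<otimes> m = X2 \<otimes> X3 \<otimes> (k \<oplus> d \<otimes> X1)"
  proof (cases "X1 = \<zero>")
    case True
    obtain r where "r \<in> carrier R" "k \<oplus> d \<otimes> X1 = X2 \<otimes> X3 \<otimes> (r \<otimes> r)"
      using square_multiple_of_class[of "X2 \<otimes> X3" "k \<oplus> d \<otimes> X1"] class1 True closed nonzero mult_nonzero
      by (auto simp: root_class_def)
    then show ?thesis using that[of "X2 \<otimes> X3 \<otimes> r"] closed by (simp add: m_ac)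
  next
    case False
    obtain r where r: "r \<in> carrier R" "k \<oplus> d \<otimes> X1 = X1 \<otimes> (r \<otimes> r)"
      using square_multiple_of_class[of X1 "k \<oplus> d \<otimes> X1"] class1 False closed
      by (auto simp: root_class_def)
    have "(y \<otimes> r) \<otimes> (y \<otimes> r) = (y \<otimes> y) \<otimes> (r \<otimes> r)"
      using r(1) closed by (simp add: class_transfer algebra_simps)
    also have "\<dots> = X2 \<otimes> X3 \<otimes> (k \<oplus> d \<otimes> X1)"
      unfolding yy r(2) using r(1) closed by (simp add: class_transfer algebra_simps)
    finally show ?thesis using that[of "y \<otimes> r"] r closed by simp
  qed
  show ?thesis using kramer_line[OF closed m(1) r2(1) r3(1) nonzero yy m(2) k] that by metis
qed

lemma norm_of_permuted_classes:
  assumes P: "Some (x, y) \<in> E"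
    and closed: "X1 \<in> carrier R" "X2 \<in> carrier R" "X3 \<in> carrier R" "k \<in> carrier R"
    and nonzero: "X2 \<noteq> \<zero>" "X3 \<noteq> \<zero>"
    and sum: "X1 \<oplus> X2 \<oplus> X3 = x \<oplus> (x \<oplus> a) \<oplus> (x \<oplus> b)"
    and pairs: "X1 \<otimes> X2 \<oplus> X1 \<otimes> X3 \<oplus> X2 \<otimes> X3 = x \<otimes> (x \<oplus> a) \<oplus> x \<otimes> (x \<oplus> b) \<oplus> (x \<oplus> a) \<otimes> (x \<oplus> b)"
    and product: "X1 \<otimes> X2 \<otimes> X3 = x \<otimes> (x \<oplus> a) \<otimes> (x \<oplus> b)"
    and classes: "k \<oplus> d \<otimes> X1 \<noteq> \<zero> \<Longrightarrow> root_class (X2 \<otimes> X3) X1 = cl (k \<oplus> d \<otimes> X1)"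
      "k \<oplus> d \<otimes> X2 \<noteq> \<zero> \<Longrightarrow> cl X2 = cl (k \<oplus> d \<otimes> X2)" "k \<oplus> d \<otimes> X3 \<noteq> \<zero> \<Longrightarrow> cl X3 = cl (k \<oplus> d \<otimes> X3)"
  shows "Some (x, y) \<in> norms"
proof -
  have y: "y \<in> carrier R" and yy: "y \<otimes> y = X1 \<otimes> X2 \<otimes> X3"
    using P product by (auto simp: Some_in_E_iff cubic_factored)
  obtain l h v where lhv: "l \<in> carrier R" "h \<in> carrier R" "v \<in> carrier R"
    "l \<otimes> l = X1 \<oplus> X2 \<oplus> X3 \<oplus> (h \<oplus> h)"
    "norm_form h v = X1 \<otimes> X2 \<oplus> X1 \<otimes> X3 \<oplus> X2 \<otimes> X3 \<oplus> (l \<otimes> y \<oplus> l \<otimes> y)"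
    using norm_line_of_classes[OF y closed nonzero yy classes] by blast
  show ?thesis using in_normsI[OF P lhv(1-3)] lhv(4,5) unfolding sum pairs by blast
qed

lemma norm_of_matching_classes:
  assumes P: "Some (x, y) \<in> E" and k: "k \<in> carrier R"
    and class0: "k \<oplus> d \<otimes> x \<noteq> \<zero> \<Longrightarrow> \<kappa>\<^sub>0 x = cl (k \<oplus> d \<otimes> x)"
    and classa: "k \<oplus> d \<otimes> (x \<oplus> a) \<noteq> \<zero> \<Longrightarrow> \<kappa>\<^sub>a x = cl (k \<oplus> d \<otimes> (x \<oplus> a))"
    and classb: "k \<oplus> d \<otimes> (x \<oplus> b) \<noteq> \<zero> \<Longrightarrow> \<kappa>\<^sub>b x = cl (k \<oplus> d \<otimes> (x \<oplus> b))"
  shows "Some (x, y) \<in> norms"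
proof -
  have x: "x \<in> carrier R" using P by (auto simp: Some_in_E_iff)
  consider (root_a) "x \<oplus> a = \<zero>" | (root_b) "x \<oplus> b = \<zero>" | (other) "x \<oplus> a \<noteq> \<zero>" "x \<oplus> b \<noteq> \<zero>" by blast
  then show ?thesis
  proof cases
    case root_a
    note at_root = at_root(1,3)[OF x root_a]
    have nonzero: "x \<noteq> \<zero>" "x \<oplus> b \<noteq> \<zero>"
      using root_differences_nonzero(5,6) by (simp_all only: at_root) auto
    show ?thesis
    proof (rule norm_of_permuted_classes[OF P, of "x \<oplus> a" x "x \<oplus> b" k])
      show "root_class (x \<otimes> (x \<oplus> b)) (x \<oplus> a) = cl (k \<oplus> d \<otimes> (x \<oplus> a))" if "k \<oplus> d \<otimes> (x \<oplus> a) \<noteq> \<zero>"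
        using classa[OF that] by (simp only: at_root)
    qed (use x k nonzero class0 classb in \<open>simp_all add: root_class_def class_transfer algebra_simps\<close>)
  next
    case root_b
    note at_root = at_root(2,4)[OF x root_b]
    have nonzero: "x \<noteq> \<zero>" "x \<oplus> a \<noteq> \<zero>"
      using root_differences_nonzero(4,7) by (simp_all only: at_root) auto
    show ?thesis
    proof (rule norm_of_permuted_classes[OF P, of "x \<oplus> b" x "x \<oplus> a" k])
      show "root_class (x \<otimes> (x \<oplus> a)) (x \<oplus> b) = cl (k \<oplus> d \<otimes> (x \<oplus> b))" if "k \<oplus> d \<otimes> (x \<oplus> b) \<noteq> \<zero>"
        using classb[OF that] by (simp only: at_root)
    qed (use x k nonzero class0 classa in \<open>simp_all add: root_class_def class_transfer algebra_simps\<close>)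
  next
    case other
    show ?thesis
    proof (rule norm_of_permuted_classes[OF P, of x "x \<oplus> a" "x \<oplus> b" k])
      show "root_class ((x \<oplus> a) \<otimes> (x \<oplus> b)) x = cl (k \<oplus> d \<otimes> x)" if "k \<oplus> d \<otimes> x \<noteq> \<zero>"
        using class0[OF that] k by (cases "x = \<zero>") (simp_all add: root_class_def)
    qed (use x k other classa classb in \<open>simp_all add: root_class_def\<close>)
  qed
qed

end

locale quadratic_twist = curve_nonsquare
begin

sublocale tw: curve_nonsquare R cl "d \<otimes> a" "d \<otimes> b" d
  using mult_nonzero d_nonzero ab_nonzero a_neq_b m_lcancel[OF d_nonzero]
  by unfold_locales simp_all

lemma same_kummer_class_imp_norm:
  assumes P: "P \<in> E" and T: "T \<in> tw.E" and same_class: "kummer P = tw.kummer T"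
  shows "P \<in> norms"
proof (cases "kummer P = 0")
  case True
  then show ?thesis using kummer_eq_0_imp_double[OF P] double_in_norms by metis
next
  case False
  then have "P \<noteq> None" "T \<noteq> None" using same_class kummer_None tw.kummer_None by metis+
  then obtain x y t s where points: "P = Some (x, y)" "T = Some (t, s)" by auto
  have closed: "x \<in> carrier R" "t \<in> carrier R"
    using P T by (auto simp: points Some_in_E_iff tw.Some_in_E_iff)
  have classes: "\<kappa>\<^sub>0 x = tw.\<kappa>\<^sub>0 t" "\<kappa>\<^sub>a x = tw.\<kappa>\<^sub>a t"
    using same_class by (auto simp: points kummer_def tw.kummer_def)
  moreover have "\<kappa>\<^sub>b x = tw.\<kappa>\<^sub>b t"
    using root_classes_sum tw.root_classes_sum P T classes unfolding points by (metis add_left_cancel)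
  ultimately have classes': "t \<noteq> \<zero> \<Longrightarrow> \<kappa>\<^sub>0 x = cl t"
      "t \<oplus> d \<otimes> a \<noteq> \<zero> \<Longrightarrow> \<kappa>\<^sub>a x = cl (t \<oplus> d \<otimes> a)" "t \<oplus> d \<otimes> b \<noteq> \<zero> \<Longrightarrow> \<kappa>\<^sub>b x = cl (t \<oplus> d \<otimes> b)"
    by (simp_all add: root_class_def del: l_minus)
  define k where "k = t \<ominus> d \<otimes> x"
  have k: "k \<in> carrier R" "k \<oplus> d \<otimes> x = t" "k \<oplus> d \<otimes> (x \<oplus> a) = t \<oplus> d \<otimes> a" "k \<oplus> d \<otimes> (x \<oplus> b) = t \<oplus> d \<otimes> b"
    using closed by (simp_all add: k_def class_transfer algebra_simps)
  show ?thesis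
    unfolding points(1)
    by (rule norm_of_matching_classes[OF P[unfolded points(1)] k(1)]) (simp only: k(2-4), erule classes')+
qed

lemma twist_conjugate_point:
  assumes "Some ((u, v), (r, s)) \<in> E_K"
  shows "Some ((d \<otimes> u, d \<otimes> v), (d \<otimes> (d \<otimes> s), d \<otimes> r)) \<in> tw.E_K"
proof -
  have closed: "u \<in> carrier R" "v \<in> carrier R" "r \<in> carrier R" "s \<in> carrier R"
    and re: "r \<otimes> r \<oplus> d \<otimes> (s \<otimes> s)
      = u \<otimes> (u \<otimes> u \<oplus> (d \<oplus> d \<oplus> d) \<otimes> (v \<otimes> v)) \<oplus> (a \<oplus> b) \<otimes> (u \<otimes> u \<oplus> d \<otimes> (v \<otimes> v)) \<oplus> a \<otimes> b \<otimes> u"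
    and im: "r \<otimes> s \<oplus> r \<otimes> s
      = v \<otimes> (u \<otimes> u \<oplus> u \<otimes> u \<oplus> u \<otimes> u \<oplus> d \<otimes> (v \<otimes> v) \<oplus> ((a \<oplus> b) \<otimes> u \<oplus> (a \<oplus> b) \<otimes> u) \<oplus> a \<otimes> b)"
    using assms unfolding Some_in_E_K_iff by auto
  have "d \<otimes> (d \<otimes> s) \<otimes> (d \<otimes> (d \<otimes> s)) \<oplus> d \<otimes> (d \<otimes> r \<otimes> (d \<otimes> r)) = d \<otimes> d \<otimes> d \<otimes> (r \<otimes> r \<oplus> d \<otimes> (s \<otimes> s))"
    using closed by (simp add: class_transfer algebra_simps)
  moreover have "d \<otimes> (d \<otimes> s) \<otimes> (d \<otimes> r) \<oplus> d \<otimes> (d \<otimes> s) \<otimes> (d \<otimes> r) = d \<otimes> d \<otimes> d \<otimes> (r \<otimes> s \<oplus> r \<otimes> s)"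
    using closed by (simp add: class_transfer algebra_simps)
  ultimately show ?thesis
    using closed unfolding tw.Some_in_E_K_iff re im by (simp add: class_transfer algebra_simps)
qed

lemma norm_imp_same_kummer_class:
  assumes P: "P \<in> norms"
  shows "P \<in> E \<and> kummer P \<in> tw.kummer ` tw.E"
proof -
  have trivial_class: "0 \<in> tw.kummer ` tw.E"
    using tw.kummer_None tw.None_in_E by (metis image_eqI)
  obtain Q where Q: "Q \<in> E_K" "P = norm_pt Q" using P by blast
  from Q(1) show ?thesis
  proof (cases rule: norm_pt_cases)
    case trivial
    then show ?thesis using Q(2) trivial_class None_in_E by (simp add: kummer_None)
  next
    case (double P')
    then show ?thesis using Q(2) trivial_class kummer_plus_pt kummer_double by simp
  next
    case (line l n u v x)
    have closed: "l \<in> carrier R" "n \<in> carrier R"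
      using line by (auto simp: line_meets_def)
    have P: "P = Some (x, \<ominus> (l \<otimes> x \<oplus> n))" using norm_pt_line_meets Q(2) line by simp
    have "d \<otimes> v \<noteq> \<zero>" using mult_nonzero d_nonzero line by simp
    then obtain l' n' x' where
      meets': "tw.line_meets l' n' (d \<otimes> u \<oplus> d \<otimes> u) (norm_form (d \<otimes> u) (d \<otimes> v)) x'"
      using tw.line_through_conjugates[OF twist_conjugate_point] Q(1) line(1) by metis
    have "norm_form (d \<otimes> u) (d \<otimes> v) = d \<otimes> d \<otimes> norm_form u v"
        "norm_form (d \<otimes> u \<oplus> d \<otimes> a) (d \<otimes> v) = d \<otimes> d \<otimes> norm_form (u \<oplus> a) v"
      using line by (simp_all add: class_transfer algebra_simps)
    then have "tw.kummer (Some (x', \<ominus> (l' \<otimes> x' \<oplus> n'))) = kummer P"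
      using tw.kummer_norm_line[OF meets'] kummer_norm_line[OF line(5)] line \<open>d \<otimes> v \<noteq> \<zero>\<close>
        cl_mult_square norm_form_nonzero d_nonzero by (simp add: P)
    then show ?thesis
      using tw.line_meets_on_curve(2)[OF meets'] line_meets_on_curve(2)[OF line(5)] P by (metis imageI)
  qed
qed

lemma in_norms_iff: "P \<in> norms \<longleftrightarrow> P \<in> E \<and> kummer P \<in> tw.kummer ` tw.E"
  using norm_imp_same_kummer_class same_kummer_class_imp_norm by blast

end

section \<open>The norm index as an index of Kummer images\<close>

definition elementary_2_subgroup :: "'g::ab_group_add set \<Rightarrow> bool" where
  "elementary_2_subgroup J \<longleftrightarrow> 0 \<in> J \<and> (\<forall>g\<in>J. g + g = 0) \<and> (\<forall>g\<in>J. \<forall>h\<in>J. g + h \<in> J)"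

definition coset_count :: "'g::ab_group_add set \<Rightarrow> 'g set \<Rightarrow> nat" where
  "coset_count A J = card ((\<lambda>g. (+) g ` J) ` A)"

lemma mem_coset_iff:
  fixes g h :: "'g::ab_group_add"
  assumes "g + g = 0"
  shows "h \<in> (+) g ` J \<longleftrightarrow> g + h \<in> J"
proof
  assume "g + h \<in> J"
  moreover have "h = g + (g + h)" using assms by (simp flip: add.assoc)
  ultimately show "h \<in> (+) g ` J" by blast
qed (use assms in \<open>auto simp flip: add.assoc\<close>)

lemma coset_eq_iff:
  assumes J: "elementary_2_subgroup J" and "g + g = 0" "h + h = 0"
  shows "(+) g ` J = (+) h ` J \<longleftrightarrow> g + h \<in> J"
proof
  assume "(+) g ` J = (+) h ` J"
  moreover have "h \<in> (+) h ` J" using J assms mem_coset_iff[of h] by (simp add: elementary_2_subgroup_def)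
  ultimately show "g + h \<in> J" using mem_coset_iff assms by blast
next
  have sub: "(+) g ` J \<subseteq> (+) h ` J" if "g + g = 0" "h + h = 0" "g + h \<in> J" for g h
  proof
    fix z assume "z \<in> (+) g ` J"
    then have "(g + h) + (g + z) \<in> J"
      using that J mem_coset_iff[of g z] by (simp add: elementary_2_subgroup_def)
    moreover have "(g + h) + (g + z) = h + z"
      using that(1) by (metis add.assoc add.commute add.left_neutral)
    ultimately show "z \<in> (+) h ` J" using that mem_coset_iff[of h z] by simp
  qed
  assume "g + h \<in> J"
  then show "(+) g ` J = (+) h ` J"
    using sub[of g h] sub[of h g] assms by (auto simp: add.commute)
qed

lemma coset_count_times_card_Int:
  assumes A: "elementary_2_subgroup A" "finite A" and J: "elementary_2_subgroup J"
  shows "coset_count A J * card (A \<inter> J) = card A"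
proof -
  have fibre: "{h \<in> A. (+) h ` J = (+) g ` J} = (+) g ` (A \<inter> J)" if g: "g \<in> A" for g
  proof (intro equalityI subsetI)
    fix h assume h: "h \<in> {h \<in> A. (+) h ` J = (+) g ` J}"
    then have "h + g \<in> J" using coset_eq_iff[OF J, of h g] A g by (simp add: elementary_2_subgroup_def)
    then have "g + h \<in> A \<inter> J" using A g h by (simp add: elementary_2_subgroup_def add.commute)
    then show "h \<in> (+) g ` (A \<inter> J)" using mem_coset_iff A g by (metis elementary_2_subgroup_def)
  next
    fix h assume h: "h \<in> (+) g ` (A \<inter> J)"
    then have "g + h \<in> A \<inter> J" using mem_coset_iff A g by (metis elementary_2_subgroup_def)
    moreover have "h \<in> A" using h A g by (auto simp: elementary_2_subgroup_def)
    ultimately show "h \<in> {h \<in> A. (+) h ` J = (+) g ` J}"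
      using coset_eq_iff[OF J, of h g] A g by (simp add: elementary_2_subgroup_def add.commute)
  qed
  have "card A = (\<Sum>C\<in>(\<lambda>g. (+) g ` J) ` A. card {h \<in> A. (+) h ` J = C})"
    using sum.image_gen[OF A(2), of "\<lambda>_. 1::nat" "\<lambda>g. (+) g ` J"] by simp
  also have "\<dots> = (\<Sum>C\<in>(\<lambda>g. (+) g ` J) ` A. card (A \<inter> J))"
    by (rule sum.cong) (auto simp: fibre card_image)
  finally show ?thesis by (simp add: coset_count_def)
qed

lemma (in elliptic_curve) elementary_2_subgroup_kummer: "elementary_2_subgroup (kummer ` E)"
  unfolding elementary_2_subgroup_def
proof (intro conjI ballI)
  show "0 \<in> kummer ` E" using kummer_None None_in_E by (metis image_eqI)
next
  fix g assume "g \<in> kummer ` E"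
  then show "g + g = 0" using kummer_double by (auto elim!: imageE)
next
  fix g h assume "g \<in> kummer ` E" "h \<in> kummer ` E"
  then obtain P Q where "P \<in> E" "Q \<in> E" "g = kummer P" "h = kummer Q" by (auto elim!: imageE)
  then show "g + h \<in> kummer ` E" using plus_pt_in_E kummer_add by (metis imageI)
qed

context quadratic_twist
begin

lemma norm_coset:
  assumes P: "P \<in> E"
  shows "plus_pt P ` norms = {Q \<in> E. kummer Q \<in> (+) (kummer P) ` (tw.kummer ` tw.E)}"
proof (intro equalityI subsetI)
  fix Q assume "Q \<in> plus_pt P ` norms"
  then obtain M where "M \<in> E" "kummer M \<in> tw.kummer ` tw.E" "Q = plus_pt P M"
    using in_norms_iff by blast
  then show "Q \<in> {Q \<in> E. kummer Q \<in> (+) (kummer P) ` (tw.kummer ` tw.E)}"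
    using P plus_pt_in_E kummer_add by simp
next
  fix Q assume Q: "Q \<in> {Q \<in> E. kummer Q \<in> (+) (kummer P) ` (tw.kummer ` tw.E)}"
  then have "kummer P + kummer Q \<in> tw.kummer ` tw.E"
    using mem_coset_iff[OF kummer_double[OF P]] by blast
  then have "plus_pt (neg_pt P) Q \<in> norms"
    using P Q neg_pt_in_E plus_pt_in_E kummer_add by (simp add: in_norms_iff kummer_neg_pt)
  moreover have "Q = plus_pt P (plus_pt (neg_pt P) Q)" using plus_pt_neg_cancel[OF P] Q by simp
  ultimately show "Q \<in> plus_pt P ` norms" by blast
qed

theorem norm_index_eq_coset_count:
  "norm_index R d (a \<oplus> b) (a \<otimes> b) = coset_count (kummer ` E) (tw.kummer ` tw.E)"
proof -
  define J where "J = tw.kummer ` tw.E"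
  have J: "elementary_2_subgroup J" unfolding J_def by (rule tw.elementary_2_subgroup_kummer)
  define preimage where "preimage C = {Q \<in> E. kummer Q \<in> C}" for C
  have "(\<lambda>P. plus_pt P ` norms) ` E = preimage ` (\<lambda>g. (+) g ` J) ` (kummer ` E)"
    using norm_coset by (auto simp: image_image preimage_def J_def)
  moreover have "inj_on preimage ((\<lambda>g. (+) g ` J) ` (kummer ` E))"
  proof (rule inj_onI)
    fix C C' assume "C \<in> (\<lambda>g. (+) g ` J) ` (kummer ` E)" "C' \<in> (\<lambda>g. (+) g ` J) ` (kummer ` E)"
      and same: "preimage C = preimage C'"
    then obtain P P' where P: "P \<in> E" "C = (+) (kummer P) ` J" and P': "P' \<in> E" "C' = (+) (kummer P') ` J"
      by blast
    have "P \<in> preimage C"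
      using P J mem_coset_iff kummer_double by (simp add: preimage_def elementary_2_subgroup_def)
    then have "P \<in> preimage C'" by (simp only: same)
    then have "kummer P \<in> (+) (kummer P') ` J" by (simp add: preimage_def P'(2))
    then have "kummer P' + kummer P \<in> J" using mem_coset_iff kummer_double[OF P'(1)] by blast
    then show "C = C'"
      using coset_eq_iff[OF J kummer_double[OF P'(1)] kummer_double[OF P(1)]] P(2) P'(2) by blast
  qed
  ultimately show ?thesis
    by (simp add: norm_index_def Let_def coset_count_def card_image J_def)
qed

end

section \<open>Counting over finite fields\<close>

context elliptic_curve
begin

lemma half_pt_inject:
  assumes closed: "\<alpha> \<in> carrier R" "\<beta> \<in> carrier R" "\<gamma> \<in> carrier R"
      "\<alpha>' \<in> carrier R" "\<beta>' \<in> carrier R" "\<gamma>' \<in> carrier R"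
    and roots: "\<beta> \<otimes> \<beta> = \<alpha> \<otimes> \<alpha> \<oplus> a" "\<gamma> \<otimes> \<gamma> = \<alpha> \<otimes> \<alpha> \<oplus> b" "\<beta>' \<otimes> \<beta>' = \<alpha>' \<otimes> \<alpha>' \<oplus> a" "\<gamma>' \<otimes> \<gamma>' = \<alpha>' \<otimes> \<alpha>' \<oplus> b"
    and same: "half_pt \<alpha> \<beta> \<gamma> = half_pt \<alpha>' \<beta>' \<gamma>'"
  shows "\<alpha> = \<alpha>' \<and> \<beta> = \<beta>' \<and> \<gamma> = \<gamma>'"
proof -
  define s t r s' t' r' where sums: "s = \<alpha> \<oplus> \<beta>" "t = \<alpha> \<oplus> \<gamma>" "r = \<beta> \<oplus> \<gamma>"
    "s' = \<alpha>' \<oplus> \<beta>'" "t' = \<alpha>' \<oplus> \<gamma>'" "r' = \<beta>' \<oplus> \<gamma>'"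
  have sums_closed: "s \<in> carrier R" "t \<in> carrier R" "r \<in> carrier R"
      "s' \<in> carrier R" "t' \<in> carrier R" "r' \<in> carrier R"
    using closed by (simp_all add: sums)
  have factors: "s \<otimes> (\<beta> \<ominus> \<alpha>) = a" "t \<otimes> (\<gamma> \<ominus> \<alpha>) = b" "r \<otimes> (\<gamma> \<ominus> \<beta>) = b \<ominus> a"
    using roots closed by (simp_all add: sums class_transfer algebra_simps)
  have nonzero: "s \<noteq> \<zero>" "t \<noteq> \<zero>" "r \<noteq> \<zero>"
    using factors ab_nonzero root_differences_nonzero(5) closed by (metis l_null minus_closed)+
  have u: "s \<otimes> t = s' \<otimes> t'" and w: "s \<otimes> t \<otimes> r = s' \<otimes> t' \<otimes> r'"
    using same unfolding half_pt_def option.inject prod.inject sums by blast+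
  have r: "r = r'" using w m_lcancel[of "s \<otimes> t" r r'] mult_nonzero nonzero sums_closed by (simp flip: u)
  have "s \<otimes> r = s \<otimes> t \<oplus> a" "t \<otimes> r = s \<otimes> t \<oplus> b" "s' \<otimes> r' = s' \<otimes> t' \<oplus> a" "t' \<otimes> r' = s' \<otimes> t' \<oplus> b"
    using roots closed by (simp_all add: sums class_transfer algebra_simps)
  then have "s \<otimes> r = s' \<otimes> r" "t \<otimes> r = t' \<otimes> r" using r u by simp_all
  then have "s = s'" "t = t'" using m_rcancel nonzero sums_closed by metis+
  moreover have "\<alpha> \<oplus> \<alpha> = s \<oplus> t \<ominus> r" "\<beta> \<oplus> \<beta> = s \<oplus> r \<ominus> t" "\<gamma> \<oplus> \<gamma> = t \<oplus> r \<ominus> s"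
      "\<alpha>' \<oplus> \<alpha>' = s' \<oplus> t' \<ominus> r'" "\<beta>' \<oplus> \<beta>' = s' \<oplus> r' \<ominus> t'" "\<gamma>' \<oplus> \<gamma>' = t' \<oplus> r' \<ominus> s'"
    using closed by (simp_all add: sums class_transfer algebra_simps)
  ultimately have doubles: "\<alpha> \<oplus> \<alpha> = \<alpha>' \<oplus> \<alpha>'" "\<beta> \<oplus> \<beta> = \<beta>' \<oplus> \<beta>'" "\<gamma> \<oplus> \<gamma> = \<gamma>' \<oplus> \<gamma>'" using r by simp_all
  have "z = z'" if "z \<in> carrier R" "z' \<in> carrier R" "z \<oplus> z = z' \<oplus> z'" for z z'
  proof -
    have "(z \<ominus> z') \<oplus> (z \<ominus> z') = (z \<oplus> z) \<ominus> (z' \<oplus> z')"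
      using that(1,2) by (simp add: class_transfer algebra_simps)
    then show ?thesis using that add_self_eq_0_iff[of "z \<ominus> z'"] by (simp add: eq_diff0)
  qed
  then show ?thesis using doubles closed by blast
qed

lemma card_sign_changes:
  assumes "\<alpha> \<in> carrier R" "\<beta> \<in> carrier R" "\<gamma> \<in> carrier R"
    and "\<alpha> \<otimes> \<alpha> \<noteq> \<beta> \<otimes> \<beta>" "\<alpha> \<otimes> \<alpha> \<noteq> \<gamma> \<otimes> \<gamma>" "\<beta> \<otimes> \<beta> \<noteq> \<gamma> \<otimes> \<gamma>"
  shows "card {(\<alpha>, \<beta>, \<gamma>), (\<alpha>, \<ominus> \<beta>, \<ominus> \<gamma>), (\<ominus> \<alpha>, \<beta>, \<ominus> \<gamma>), (\<ominus> \<alpha>, \<ominus> \<beta>, \<gamma>)} = 4"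
proof -
  have "x = \<ominus> x \<longleftrightarrow> x = \<zero>" "\<ominus> x = x \<longleftrightarrow> x = \<zero>" if "x \<in> carrier R" for x
    using eq_minus_self_iff[OF that] by auto
  then show ?thesis using assms by (auto simp: card_insert_if)
qed

lemma card_two_torsion_ge_4:
  assumes fin: "finite (carrier R)"
  shows "4 \<le> card {Q \<in> E. plus_pt Q Q = None}"
proof -
  define T where "T = {None, Some (\<zero>, \<zero>), Some (\<ominus> a, \<zero>), Some (\<ominus> b, \<zero>)}"
  have "cubic (\<ominus> a) = \<zero>" "cubic (\<ominus> b) = \<zero>"
    by (simp_all only: cubic_factored a_inv_closed ab_closed) (simp_all add: l_neg)
  then have "T \<subseteq> {Q \<in> E. plus_pt Q Q = None}"
    by (auto simp: T_def Some_in_E_iff None_in_E ec_add_def)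
  then have "card T \<le> card {Q \<in> E. plus_pt Q Q = None}"
    by (rule card_mono[rotated]) (simp add: finite_E[OF fin])
  moreover have "\<ominus> a \<noteq> \<ominus> b" using a_neq_b by (simp add: neg_equal_iff_equal)
  then have "card T = 4"
    using root_differences_nonzero(6,7) by (simp add: T_def eq_commute[of \<zero>] card_insert_if)
  ultimately show ?thesis by simp
qed

text \<open>The halves belong to the choices of signs of the square roots with product y.\<close>
lemma card_halves_ge_4:
  assumes P: "Some (x, y) \<in> E" "kummer (Some (x, y)) = 0" and fin: "finite (carrier R)"
  shows "4 \<le> card {Q \<in> E. plus_pt Q Q = Some (x, y)}"
proof -
  obtain \<alpha> \<beta> \<gamma> where closed: "\<alpha> \<in> carrier R" "\<beta> \<in> carrier R" "\<gamma> \<in> carrier R"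
    and squares: "\<alpha> \<otimes> \<alpha> = x" "\<beta> \<otimes> \<beta> = x \<oplus> a" "\<gamma> \<otimes> \<gamma> = x \<oplus> b" and y: "\<alpha> \<otimes> \<beta> \<otimes> \<gamma> = y"
    using kummer_eq_0_imp_roots P by metis
  define T where "T = {(\<alpha>, \<beta>, \<gamma>), (\<alpha>, \<ominus> \<beta>, \<ominus> \<gamma>), (\<ominus> \<alpha>, \<beta>, \<ominus> \<gamma>), (\<ominus> \<alpha>, \<ominus> \<beta>, \<gamma>)}"
  have T: "\<alpha>' \<in> carrier R \<and> \<beta>' \<in> carrier R \<and> \<gamma>' \<in> carrier R \<and> \<alpha>' \<otimes> \<alpha>' = x \<and>
      \<beta>' \<otimes> \<beta>' = \<alpha>' \<otimes> \<alpha>' \<oplus> a \<and> \<gamma>' \<otimes> \<gamma>' = \<alpha>' \<otimes> \<alpha>' \<oplus> b \<and> \<alpha>' \<otimes> \<beta>' \<otimes> \<gamma>' = y"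
    if "(\<alpha>', \<beta>', \<gamma>') \<in> T" for \<alpha>' \<beta>' \<gamma>'
    using that closed squares y by (auto simp: T_def l_minus r_minus)
  have halves: "(\<lambda>(\<alpha>, \<beta>, \<gamma>). half_pt \<alpha> \<beta> \<gamma>) ` T \<subseteq> {Q \<in> E. plus_pt Q Q = Some (x, y)}"
    using T double_half_pt by auto
  have inj: "inj_on (\<lambda>(\<alpha>, \<beta>, \<gamma>). half_pt \<alpha> \<beta> \<gamma>) T"
  proof (rule inj_onI)
    fix z z' assume z: "z \<in> T" "z' \<in> T"
      and same: "(\<lambda>(\<alpha>, \<beta>, \<gamma>). half_pt \<alpha> \<beta> \<gamma>) z = (\<lambda>(\<alpha>, \<beta>, \<gamma>). half_pt \<alpha> \<beta> \<gamma>) z'"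
    obtain \<alpha>\<^sub>1 \<beta>\<^sub>1 \<gamma>\<^sub>1 \<alpha>\<^sub>2 \<beta>\<^sub>2 \<gamma>\<^sub>2 where "z = (\<alpha>\<^sub>1, \<beta>\<^sub>1, \<gamma>\<^sub>1)" "z' = (\<alpha>\<^sub>2, \<beta>\<^sub>2, \<gamma>\<^sub>2)"
      by (metis surj_pair)
    then show "z = z'" using half_pt_inject[of \<alpha>\<^sub>1 \<beta>\<^sub>1 \<gamma>\<^sub>1 \<alpha>\<^sub>2 \<beta>\<^sub>2 \<gamma>\<^sub>2] T z same by simp
  qed
  have "card T = 4"
    unfolding T_def
  proof (rule card_sign_changes[OF closed])
    have x: "x \<in> carrier R" using closed squares by auto
    show "\<alpha> \<otimes> \<alpha> \<noteq> \<beta> \<otimes> \<beta>" "\<alpha> \<otimes> \<alpha> \<noteq> \<gamma> \<otimes> \<gamma>" "\<beta> \<otimes> \<beta> \<noteq> \<gamma> \<otimes> \<gamma>"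
      unfolding squares using x ab_nonzero a_neq_b by (simp_all add: class_transfer)
  qed
  moreover have "finite {Q \<in> E. plus_pt Q Q = Some (x, y)}" using finite_E[OF fin] by simp
  ultimately show ?thesis using card_inj_on_le[OF inj halves] by simp
qed

lemma four_halves:
  assumes "P \<in> E" "kummer P = 0" "finite (carrier R)"
  shows "4 \<le> card {Q \<in> E. plus_pt Q Q = P}"
proof (cases P)
  case None
  then show ?thesis using card_two_torsion_ge_4 assms by simp
next
  case (Some p)
  then show ?thesis using card_halves_ge_4 assms by (cases p) simp
qed

lemma kummer_fibre:
  assumes P: "P \<in> E"
  shows "{Q \<in> E. kummer Q = kummer P} = plus_pt P ` {Q \<in> E. kummer Q = 0}"
proof (intro equalityI subsetI)
  fix Q assume Q: "Q \<in> {Q \<in> E. kummer Q = kummer P}"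
  then have "plus_pt (neg_pt P) Q \<in> {Q \<in> E. kummer Q = 0}"
    using P kummer_plus_pt[OF neg_pt_in_E[OF P]] by (simp add: kummer_neg_pt kummer_double)
  moreover have "Q = plus_pt P (plus_pt (neg_pt P) Q)" using plus_pt_neg_cancel[OF P] Q by simp
  ultimately show "Q \<in> plus_pt P ` {Q \<in> E. kummer Q = 0}" by blast
qed (use P kummer_plus_pt in auto)

lemma inj_plus_pt:
  assumes P: "P \<in> E"
  shows "inj_on (plus_pt P) E"
  using plus_pt_neg_cancel[OF neg_pt_in_E[OF P]] neg_neg_pt[OF P]
  by (intro inj_on_inverseI[of _ "plus_pt (neg_pt P)"]) simp

lemma card_E_eq:
  assumes fin: "finite (carrier R)"
  shows "card E = card (kummer ` E) * card {Q \<in> E. kummer Q = 0}"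
proof -
  have fibre: "card {Q \<in> E. kummer Q = kummer P} = card {Q \<in> E. kummer Q = 0}" if P: "P \<in> E" for P
    unfolding kummer_fibre[OF P] by (intro card_image inj_on_subset[OF inj_plus_pt[OF P]]) auto
  have "card E = (\<Sum>g\<in>kummer ` E. card {Q \<in> E. kummer Q = g})"
    using sum.image_gen[OF finite_E[OF fin], of "\<lambda>_. 1::nat" kummer] by simp
  also have "\<dots> = (\<Sum>g\<in>kummer ` E. card {Q \<in> E. kummer Q = 0})"
    by (rule sum.cong) (use fibre in auto)
  finally show ?thesis by simp
qed

theorem card_kummer_image_ge_4:
  assumes fin: "finite (carrier R)"
  shows "4 \<le> card (kummer ` E)"
proof -
  define Z where "Z = {Q \<in> E. kummer Q = 0}"
  have Z: "finite Z" "None \<in> Z" using finite_E[OF fin] by (simp_all add: Z_def None_in_E kummer_None)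
  have "4 * card Z = (\<Sum>P\<in>Z. 4)" by simp
  also have "\<dots> \<le> (\<Sum>P\<in>Z. card {Q \<in> E. plus_pt Q Q = P})"
    by (rule sum_mono) (use four_halves fin in \<open>auto simp: Z_def\<close>)
  also have "\<dots> = card (\<Union>P\<in>Z. {Q \<in> E. plus_pt Q Q = P})"
    by (rule card_UN_disjoint[symmetric]) (use finite_E[OF fin] Z in auto)
  also have "\<dots> \<le> card E" by (rule card_mono) (use finite_E[OF fin] in auto)
  finally have "4 * card Z \<le> card (kummer ` E) * card Z" using card_E_eq[OF fin] by (simp add: Z_def)
  moreover have "0 < card Z" using Z by (auto simp: card_gt_0_iff)
  ultimately show ?thesis by simp
qed

end

section \<open>Places and rational square classes\<close>

text \<open>The image of the Kummer map, computed with rational abscissas; the torsion points come first.\<close>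
definition kummer_image :: "(rat \<Rightarrow> 'g::ab_group_add) \<Rightarrow> rat \<Rightarrow> rat \<Rightarrow> ('g \<times> 'g) set" where
  "kummer_image c a b =
     {(0, 0), (c (a * b), c a), (c (- a), c (- a * (b - a))), (c (- b), c (a - b))} \<union>
     {(c x, c (x + a)) | x. x \<noteq> 0 \<and> x + a \<noteq> 0 \<and> x + b \<noteq> 0 \<and> c x + c (x + a) + c (x + b) = 0}"

lemma kummer_image_cases [consumes 1, case_names infinity zero root_a root_b generic]:
  assumes "g \<in> kummer_image c a b"
  obtains "g = (0, 0)" | "g = (c (a * b), c a)" | "g = (c (- a), c (- a * (b - a)))"
    | "g = (c (- b), c (a - b))"
    | x where "x \<noteq> 0" "x + a \<noteq> 0" "x + b \<noteq> 0" "c x + c (x + a) + c (x + b) = 0" "g = (c x, c (x + a))"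
  using assms unfolding kummer_image_def by blast

lemma torsion_in_kummer_image:
  "(0, 0) \<in> kummer_image c a b" "(c (a * b), c a) \<in> kummer_image c a b"
  "(c (- a), c (- a * (b - a))) \<in> kummer_image c a b" "(c (- b), c (a - b)) \<in> kummer_image c a b"
  unfolding kummer_image_def by blast+

lemma generic_in_kummer_image:
  assumes "x \<noteq> 0" "x + a \<noteq> 0" "x + b \<noteq> 0" "c x + c (x + a) + c (x + b) = 0"
  shows "(c x, c (x + a)) \<in> kummer_image c a b"
  using assms unfolding kummer_image_def by blast

text \<open>A completion of the rationals. The last assumption says that translates of an element by finitely
  many rationals can be approximated within their square classes by a single rational.\<close>
locale place = odd_char_field +
  fixes \<iota> :: "rat \<Rightarrow> 'a" and rat_class :: "rat \<Rightarrow> 'g::ab_group_add"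
  assumes \<iota>_closed [simp]: "\<iota> x \<in> carrier R"
    and \<iota>_add: "\<iota> (x + y) = \<iota> x \<oplus> \<iota> y"
    and \<iota>_mult: "\<iota> (x * y) = \<iota> x \<otimes> \<iota> y"
    and \<iota>_eq_0_imp: "\<iota> x = \<zero> \<Longrightarrow> x = 0"
    and rat_class_mult: "x \<noteq> 0 \<Longrightarrow> y \<noteq> 0 \<Longrightarrow> rat_class (x * y) = rat_class x + rat_class y"
    and rat_class_eq_0_iff: "x \<noteq> 0 \<Longrightarrow> rat_class x = 0 \<longleftrightarrow> (\<exists>s\<in>carrier R. s \<otimes> s = \<iota> x)"
    and approximation: "z \<in> carrier R \<Longrightarrow> finite C \<Longrightarrow> (\<And>c. c \<in> C \<Longrightarrow> z \<oplus> \<iota> c \<noteq> \<zero>) \<Longrightarrow>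
      \<exists>x. \<forall>c\<in>C. x + c \<noteq> 0 \<and> (\<exists>s\<in>carrier R. s \<otimes> s = (z \<oplus> \<iota> c) \<otimes> \<iota> (x + c))"
begin

lemma \<iota>_0 [simp]: "\<iota> 0 = \<zero>"
  using \<iota>_add[of 0 0] by (metis \<iota>_closed add.r_cancel_one add_0)

lemma \<iota>_minus: "\<iota> (- x) = \<ominus> \<iota> x"
proof -
  have "\<iota> (- x) \<oplus> \<iota> x = \<zero>" using \<iota>_add[of "- x" x] by simp
  then show ?thesis using minus_equality[of "\<iota> (- x)" "\<iota> x"] by simp
qed

lemma \<iota>_diff: "\<iota> (x - y) = \<iota> x \<ominus> \<iota> y"
  using \<iota>_add[of x "- y"] by (simp add: \<iota>_minus a_minus_def)

lemma \<iota>_nonzero: "x \<noteq> 0 \<Longrightarrow> \<iota> x \<noteq> \<zero>"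
  using \<iota>_eq_0_imp by blast

lemma rat_class_double: "x \<noteq> 0 \<Longrightarrow> rat_class x + rat_class x = 0"
  using rat_class_mult[of x x] rat_class_eq_0_iff[of "x * x"] by (auto simp: \<iota>_mult)

lemma square_of_square_multiple:
  assumes "z \<in> carrier R" "w \<in> carrier R" "w \<noteq> \<zero>" "s \<in> carrier R" "s \<otimes> s = z \<otimes> (w \<otimes> w)"
  shows "\<exists>t\<in>carrier R. t \<otimes> t = z"
proof -
  define i where "i = inv w"
  have i: "i \<in> carrier R" "w \<otimes> i = \<one>" using assms by (simp_all add: i_def)
  have "(s \<otimes> i) \<otimes> (s \<otimes> i) = (s \<otimes> s) \<otimes> (i \<otimes> i)"
    using assms(4) i(1) by (simp add: class_transfer algebra_simps)
  also have "\<dots> = z \<otimes> ((w \<otimes> i) \<otimes> (w \<otimes> i))"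
    unfolding assms(5) using assms(1,2) i(1) by (simp add: class_transfer algebra_simps)
  also have "\<dots> = z" using i assms(1) by simp
  finally show ?thesis using i assms(4) by (intro bexI[of _ "s \<otimes> i"]) simp_all
qed

definition represents :: "rat \<Rightarrow> 'a \<Rightarrow> bool" where
  "represents x z \<longleftrightarrow> x \<noteq> 0 \<and> (\<exists>s\<in>carrier R. s \<otimes> s = z \<otimes> \<iota> x)"

definition cl :: "'a \<Rightarrow> 'g" where
  "cl z = rat_class (SOME x. represents x z)"

lemma represents_mult:
  assumes "z \<in> carrier R" "w \<in> carrier R" "represents x z" "represents y w"
  shows "represents (x * y) (z \<otimes> w)"
proof -
  obtain s t where st: "s \<in> carrier R" "t \<in> carrier R" "s \<otimes> s = z \<otimes> \<iota> x" "t \<otimes> t = w \<otimes> \<iota> y"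
    using assms by (auto simp: represents_def)
  have "(s \<otimes> t) \<otimes> (s \<otimes> t) = (s \<otimes> s) \<otimes> (t \<otimes> t)" using st(1,2) by (simp add: m_ac)
  also have "\<dots> = z \<otimes> w \<otimes> \<iota> (x * y)" unfolding st(3,4) using assms by (simp add: \<iota>_mult m_ac)
  finally show ?thesis using assms st(1,2) by (auto simp: represents_def intro!: bexI[of _ "s \<otimes> t"])
qed

lemma represents_unique:
  assumes z: "z \<in> carrier R" "z \<noteq> \<zero>" and x: "represents x z" and y: "represents y z"
  shows "rat_class x = rat_class y"
proof -
  have nonzero: "x \<noteq> 0" "y \<noteq> 0" using x y by (auto simp: represents_def)
  have "represents (x * y) (z \<otimes> z)" using represents_mult x y z by blast
  then obtain s where "s \<in> carrier R" "s \<otimes> s = \<iota> (x * y) \<otimes> (z \<otimes> z)"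
    using z by (auto simp: represents_def m_ac)
  then have "rat_class (x * y) = 0"
    using square_of_square_multiple z nonzero by (simp add: rat_class_eq_0_iff)
  then have "rat_class x + rat_class y = 0" using rat_class_mult nonzero by simp
  then show ?thesis using rat_class_double[OF nonzero(1)] by (metis add_left_cancel)
qed

lemma cl_eq_rat_class: "z \<in> carrier R \<Longrightarrow> z \<noteq> \<zero> \<Longrightarrow> represents x z \<Longrightarrow> cl z = rat_class x"
  unfolding cl_def by (rule represents_unique[of z]) (auto intro: someI)

lemma ex_represents: "z \<in> carrier R \<Longrightarrow> z \<noteq> \<zero> \<Longrightarrow> \<exists>x. represents x z"
  using approximation[of z "{0}"] by (auto simp: represents_def)

lemma cl_\<iota>: "x \<noteq> 0 \<Longrightarrow> cl (\<iota> x) = rat_class x"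
  by (rule cl_eq_rat_class) (auto simp: represents_def \<iota>_nonzero intro!: bexI[of _ "\<iota> x"])

sublocale square_class_field R cl
proof
  fix x y assume xy: "x \<in> carrier R" "y \<in> carrier R" "x \<noteq> \<zero>" "y \<noteq> \<zero>"
  obtain u v where uv: "represents u x" "represents v y" using ex_represents xy by blast
  then have "cl (x \<otimes> y) = rat_class (u * v)"
    using cl_eq_rat_class represents_mult xy mult_nonzero by simp
  then show "cl (x \<otimes> y) = cl x + cl y"
    using rat_class_mult uv cl_eq_rat_class xy by (auto simp: represents_def)
next
  fix x assume x: "x \<in> carrier R" "x \<noteq> \<zero>"
  obtain u where u: "represents u x" using ex_represents x by blast
  then obtain s where s: "s \<in> carrier R" "s \<otimes> s = x \<otimes> \<iota> u" and "u \<noteq> 0" by (auto simp: represents_def)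
  have "cl x = 0 \<longleftrightarrow> (\<exists>t\<in>carrier R. t \<otimes> t = \<iota> u)"
    using cl_eq_rat_class[OF x u] rat_class_eq_0_iff \<open>u \<noteq> 0\<close> by simp
  also have "\<dots> \<longleftrightarrow> (\<exists>t\<in>carrier R. t \<otimes> t = x)"
  proof
    assume "\<exists>t\<in>carrier R. t \<otimes> t = \<iota> u"
    then obtain t where t: "t \<in> carrier R" "t \<otimes> t = \<iota> u" by blast
    then have "t \<noteq> \<zero>" using \<iota>_nonzero[OF \<open>u \<noteq> 0\<close>] by auto
    then show "\<exists>t\<in>carrier R. t \<otimes> t = x" using square_of_square_multiple[of x t s] s t x by simp
  next
    assume "\<exists>t\<in>carrier R. t \<otimes> t = x"
    then obtain t where t: "t \<in> carrier R" "t \<otimes> t = x" by blast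
    then have "t \<noteq> \<zero>" using x by auto
    then show "\<exists>t\<in>carrier R. t \<otimes> t = \<iota> u"
      using square_of_square_multiple[of "\<iota> u" t s] s t x by (simp add: m_comm)
  qed
  finally show "cl x = 0 \<longleftrightarrow> (\<exists>s\<in>carrier R. s \<otimes> s = x)" .
qed

end

locale place_curve = place +
  fixes a b :: rat
  assumes nonzero: "a \<noteq> 0" "b \<noteq> 0" "a \<noteq> b"
begin

sublocale elliptic_curve R cl "\<iota> a" "\<iota> b"
proof unfold_locales
  have "\<iota> (a - b) \<noteq> \<zero>" using \<iota>_nonzero nonzero by simp
  then show "\<iota> a \<noteq> \<iota> b" by (auto simp: \<iota>_diff)
qed (use nonzero \<iota>_nonzero in auto)

lemma kummer_\<iota>:
  "kummer (Some (\<iota> x, y)) = (if x = 0 then rat_class (a * b) else rat_class x,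
     if x + a = 0 then rat_class (- a * (b - a)) else rat_class (x + a))"
proof -
  have "root_class w (\<iota> x) = (if x = 0 then cl w else rat_class x)" for w x
    by (simp add: root_class_def cl_\<iota> \<iota>_nonzero)
  moreover have "cl (\<iota> a \<otimes> \<iota> b) = rat_class (a * b)"
      "cl (\<ominus> \<iota> a \<otimes> (\<iota> b \<ominus> \<iota> a)) = rat_class (- a * (b - a))"
    using nonzero by (simp_all flip: \<iota>_mult \<iota>_diff \<iota>_minus add: cl_\<iota>)
  ultimately show ?thesis by (simp add: kummer_def del: l_minus flip: \<iota>_add)
qed

lemma Some_\<iota>_in_E_iff:
  "Some (\<iota> x, y) \<in> E \<longleftrightarrow> y \<in> carrier R \<and> y \<otimes> y = \<iota> (x * (x + a) * (x + b))"
  by (simp add: Some_in_E_iff cubic_factored \<iota>_add \<iota>_mult)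

lemma generic_kummer_in_kummer_image:
  assumes P: "Some (z, y) \<in> E" and nonzero: "z \<noteq> \<zero>" "z \<oplus> \<iota> a \<noteq> \<zero>" "z \<oplus> \<iota> b \<noteq> \<zero>"
  shows "kummer (Some (z, y)) \<in> kummer_image rat_class a b"
proof -
  have z: "z \<in> carrier R" using P by (simp add: Some_in_E_iff)
  have "z \<oplus> \<iota> c \<noteq> \<zero>" if "c \<in> {0, a, b}" for c using that nonzero z by auto
  then obtain x where x: "\<forall>c\<in>{0, a, b}. x + c \<noteq> 0 \<and> (\<exists>s\<in>carrier R. s \<otimes> s = (z \<oplus> \<iota> c) \<otimes> \<iota> (x + c))"
    using approximation[OF z, of "{0, a, b}"] by blast
  then have "represents x z" "represents (x + a) (z \<oplus> \<iota> a)" "represents (x + b) (z \<oplus> \<iota> b)"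
    using z by (auto simp: represents_def)
  then have classes: "cl z = rat_class x" "cl (z \<oplus> \<iota> a) = rat_class (x + a)"
      "cl (z \<oplus> \<iota> b) = rat_class (x + b)"
    using cl_eq_rat_class nonzero z by auto
  have "rat_class x + rat_class (x + a) + rat_class (x + b) = 0"
    using root_classes_sum[OF P] nonzero by (simp add: root_class_def classes)
  moreover have "kummer (Some (z, y)) = (rat_class x, rat_class (x + a))"
    using nonzero by (simp add: kummer_def root_class_def classes)
  ultimately show ?thesis using generic_in_kummer_image[of x a b rat_class] x by simp
qed

lemma kummer_in_kummer_image:
  assumes P: "P \<in> E"
  shows "kummer P \<in> kummer_image rat_class a b"
proof (cases P)
  case None
  then show ?thesis using torsion_in_kummer_image(1) by (simp add: kummer_def)
next
  case (Some p)
  then obtain z y where P': "P = Some (z, y)" by (cases p) auto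
  have z: "z \<in> carrier R" using P P' by (simp add: Some_in_E_iff)
  consider (zero) "z = \<iota> 0" | (root_a) "z = \<iota> (- a)" | (root_b) "z = \<iota> (- b)"
    | (generic) "z \<noteq> \<zero>" "z \<oplus> \<iota> a \<noteq> \<zero>" "z \<oplus> \<iota> b \<noteq> \<zero>"
    using at_root(1,2)[OF z] by (force simp: \<iota>_minus)
  then show ?thesis
  proof cases
    case zero
    then show ?thesis
      using kummer_\<iota>[of 0 y] torsion_in_kummer_image(2)[of rat_class a b] nonzero unfolding P' by simp
  next
    case root_a
    then show ?thesis
      using kummer_\<iota>[of "- a" y] torsion_in_kummer_image(3) nonzero unfolding P' by simp
  next
    case root_b
    then show ?thesis
      using kummer_\<iota>[of "- b" y] torsion_in_kummer_image(4) nonzero unfolding P' by simp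
  next
    case generic
    then show ?thesis using generic_kummer_in_kummer_image P unfolding P' by blast
  qed
qed

lemma kummer_image_subset: "kummer_image rat_class a b \<subseteq> kummer ` E"
proof
  fix g assume "g \<in> kummer_image rat_class a b"
  then show "g \<in> kummer ` E"
  proof (cases rule: kummer_image_cases)
    case infinity
    then show ?thesis using None_in_E by (intro image_eqI[of _ _ None]) (simp_all add: kummer_def)
  next
    case zero
    then show ?thesis
      using nonzero by (intro image_eqI[of _ _ "Some (\<iota> 0, \<zero>)"]) (simp_all only: kummer_\<iota> Some_\<iota>_in_E_iff, simp_all)
  next
    case root_a
    then show ?thesis
      using nonzero by (intro image_eqI[of _ _ "Some (\<iota> (- a), \<zero>)"]) (simp_all only: kummer_\<iota> Some_\<iota>_in_E_iff, simp_all)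
  next
    case root_b
    then show ?thesis
      using nonzero by (intro image_eqI[of _ _ "Some (\<iota> (- b), \<zero>)"]) (simp_all only: kummer_\<iota> Some_\<iota>_in_E_iff, simp_all)
  next
    case (generic x)
    then have "rat_class (x * (x + a) * (x + b)) = 0" by (simp add: rat_class_mult)
    then obtain s where "s \<in> carrier R" "s \<otimes> s = \<iota> (x * (x + a) * (x + b))"
      using rat_class_eq_0_iff[of "x * (x + a) * (x + b)"] generic by auto
    then show ?thesis
      using generic by (intro image_eqI[of _ _ "Some (\<iota> x, s)"]) (simp_all only: kummer_\<iota> Some_\<iota>_in_E_iff, simp_all)
  qed
qed

theorem kummer_image_eq: "kummer ` E = kummer_image rat_class a b"
  using kummer_in_kummer_image kummer_image_subset by blast

lemma elementary_2_subgroup_kummer_image: "elementary_2_subgroup (kummer_image rat_class a b)"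
  using elementary_2_subgroup_kummer by (simp add: kummer_image_eq)

end

context place
begin

lemma place_curve: "a \<noteq> 0 \<Longrightarrow> b \<noteq> 0 \<Longrightarrow> a \<noteq> b \<Longrightarrow> place_curve R \<iota> rat_class a b"
  by unfold_locales

theorem local_delta_eq:
  fixes a b d :: int
  assumes ab: "a \<noteq> 0" "b \<noteq> 0" "a \<noteq> b" and d: "d \<noteq> 0"
    and emb: "\<And>k. emb k = \<iota> (of_int k)"
  shows "local_delta R emb (a + b) (a * b) d = (if rat_class (of_int d) = 0 then 0
    else log 2 (coset_count (kummer_image rat_class (of_int a) (of_int b))
      (kummer_image rat_class (of_int (d * a)) (of_int (d * b)))))"
proof -
  have square_iff: "(\<exists>s\<in>carrier R. s \<otimes> s = emb d) \<longleftrightarrow> rat_class (of_int d) = 0"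
    using rat_class_eq_0_iff[of "of_int d"] d by (simp add: emb)
  have "norm_index R (emb d) (emb (a + b)) (emb (a * b))
      = coset_count (kummer_image rat_class (of_int a) (of_int b))
          (kummer_image rat_class (of_int (d * a)) (of_int (d * b)))"
    if nonsquare: "rat_class (of_int d) \<noteq> 0"
  proof -
    interpret C: place_curve R \<iota> rat_class "of_int a" "of_int b" by (rule place_curve) (use ab in auto)
    interpret C: quadratic_twist R cl "\<iota> (of_int a)" "\<iota> (of_int b)" "\<iota> (of_int d)"
      by unfold_locales (use square_iff nonsquare emb in auto)
    interpret T: place_curve R \<iota> rat_class "of_int (d * a)" "of_int (d * b)"
      by (rule place_curve) (use ab d in auto)
    have "C.tw.kummer ` C.tw.E = kummer_image rat_class (of_int (d * a)) (of_int (d * b))"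
      using T.kummer_image_eq by (simp add: \<iota>_mult)
    then show ?thesis
      using C.norm_index_eq_coset_count C.kummer_image_eq by (simp add: emb \<iota>_add \<iota>_mult)
  qed
  then show ?thesis by (simp add: local_delta_def square_iff)
qed

end

section \<open>The p-adic valuation\<close>

definition unit_form :: "nat \<Rightarrow> rat \<Rightarrow> int \<Rightarrow> int \<Rightarrow> int \<Rightarrow> bool" where
  "unit_form l x N m n \<longleftrightarrow> \<not> int l dvd m \<and> \<not> int l dvd n \<and> x * of_int n = of_nat l powi N * of_int m"

definition val_ge :: "nat \<Rightarrow> int \<Rightarrow> rat \<Rightarrow> bool" where
  "val_ge l N x \<longleftrightarrow> x = 0 \<or> N \<le> padic_val_rat l x"

locale prime_place =
  fixes l :: nat
  assumes l_prime: "prime l"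
begin

lemma l_nonzero [simp]: "0 < l" "l \<noteq> 0" "(of_nat l :: rat) \<noteq> 0"
  using prime_gt_0_nat[OF l_prime] by auto

lemma int_l_prime: "prime (int l)"
  using l_prime by simp

lemma dvd_mult_iff: "int l dvd m * n \<longleftrightarrow> int l dvd m \<or> int l dvd n"
  using int_l_prime prime_dvd_mult_iff by blast

lemma not_dvd_1: "\<not> int l dvd 1"
  using int_l_prime not_prime_unit by blast

lemma unit_form_nonzero: "unit_form l x N m n \<Longrightarrow> x \<noteq> 0 \<and> m \<noteq> 0 \<and> n \<noteq> 0"
  unfolding unit_form_def by (auto simp: power_int_eq_0_iff)

lemma split_multiplicity:
  assumes "a \<noteq> (0::int)"
  obtains u where "a = int l ^ multiplicity (int l) a * u" "\<not> int l dvd u"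
    "(of_int a :: rat) = of_nat l ^ multiplicity (int l) a * of_int u"
proof -
  have "\<not> is_unit (int l)" using int_l_prime not_prime_unit by blast
  then obtain u where u: "a = int l ^ multiplicity (int l) a * u" "\<not> int l dvd u"
    using multiplicity_decompose'[of a "int l"] assms by metis
  define j where "j = multiplicity (int l) a"
  have "(of_int a :: rat) = of_nat l ^ j * of_int u"
    using arg_cong[OF u(1), of "of_int :: int \<Rightarrow> rat"] by (simp add: j_def)
  then show ?thesis using that u by (simp add: j_def)
qed

lemma unit_form_exists:
  assumes "x \<noteq> 0"
  obtains m n where "unit_form l x (padic_val_rat l x) m n"
proof -
  obtain a b where ab: "quotient_of x = (a, b)" by force
  have x: "x = of_int a / of_int b" and b: "b > 0"
    using quotient_of_div[OF ab] quotient_of_denom_pos[OF ab] by auto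
  define i j where "i = multiplicity (int l) a" and "j = multiplicity (int l) b"
  have "a \<noteq> 0" using x assms by auto
  then obtain u where u: "(of_int a :: rat) = of_nat l ^ i * of_int u" "\<not> int l dvd u"
    unfolding i_def by (rule split_multiplicity)
  obtain v where v: "(of_int b :: rat) = of_nat l ^ j * of_int v" "\<not> int l dvd v"
    using split_multiplicity[of b] b unfolding j_def by auto
  have "v \<noteq> 0" using v(2) by auto
  then have "x * of_int v = of_nat l powi (int i - int j) * of_int u"
    unfolding x u(1) v(1) by (simp add: power_int_diff)
  then have "unit_form l x (padic_val_rat l x) u v"
    using u v by (simp add: unit_form_def padic_val_rat_def ab i_def j_def)
  then show ?thesis using that by blast
qed

lemma powi_mult_units_eq:
  assumes "of_nat l powi M * (of_int m :: rat) = of_nat l powi M' * of_int m'"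
    and "\<not> int l dvd m" "\<not> int l dvd m'"
  shows "M = M' \<and> m = m'"
proof -
  have exponents_eq: "N = N'"
    if eq: "of_nat l powi N * (of_int k :: rat) = of_nat l powi N' * of_int k'"
      and k: "\<not> int l dvd k" and "N \<le> N'" for N N' k k'
  proof (rule ccontr)
    assume "N \<noteq> N'"
    then obtain j where N': "N' = N + int (Suc j)" using \<open>N \<le> N'\<close> by (metis zle_iff_zadd add_0_right of_nat_0 not0_implies_Suc)
    have "of_nat l powi N * (of_int k :: rat) = of_nat l powi N * (of_nat l powi int (Suc j) * of_int k')"
      using eq unfolding N' by (simp add: power_int_add)
    then have "(of_int k :: rat) = of_nat l powi int (Suc j) * of_int k'" by simp
    then have "(of_int k :: rat) = of_int (int l ^ Suc j * k')"
      by (simp only: power_int_of_nat of_int_mult of_int_power of_int_of_nat_eq)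
    then have "k = int l ^ Suc j * k'" by (simp only: of_int_eq_iff)
    then show False using k by simp
  qed
  have "M = M'"
    using exponents_eq[OF assms(1,2)] exponents_eq[OF assms(1)[symmetric] assms(3)] by linarith
  then show ?thesis using assms(1) by simp
qed

lemma unit_form_unique:
  assumes "unit_form l x N m n" "unit_form l x N' m' n'"
  shows "N = N' \<and> m * n' = m' * n"
proof -
  have "x * of_int (n * n') = of_nat l powi N * of_int (m * n')"
      "x * of_int (n * n') = of_nat l powi N' * of_int (m' * n)"
    using assms by (simp_all add: unit_form_def algebra_simps)
  then have "of_nat l powi N * (of_int (m * n') :: rat) = of_nat l powi N' * of_int (m' * n)"
    by (simp only:)
  then show ?thesis
    using powi_mult_units_eq assms unfolding unit_form_def by (metis dvd_mult_iff)
qed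

lemma val_unit_form: "unit_form l x N m n \<Longrightarrow> padic_val_rat l x = N"
  using unit_form_exists[of x] unit_form_nonzero unit_form_unique by metis

lemma unit_form_mult:
  "unit_form l x N m n \<Longrightarrow> unit_form l y N' m' n' \<Longrightarrow> unit_form l (x * y) (N + N') (m * m') (n * n')"
  by (auto simp: unit_form_def dvd_mult_iff power_int_add algebra_simps)

lemma unit_form_inverse: "unit_form l x N m n \<Longrightarrow> unit_form l (inverse x) (- N) n m"
  using unit_form_nonzero[of x N m n] by (auto simp: unit_form_def power_int_minus field_simps)

lemma unit_form_of_int: "\<not> int l dvd m \<Longrightarrow> unit_form l (of_int m) 0 m 1"
  using not_dvd_1 by (simp add: unit_form_def)

lemma val_mult: "x \<noteq> 0 \<Longrightarrow> y \<noteq> 0 \<Longrightarrow> padic_val_rat l (x * y) = padic_val_rat l x + padic_val_rat l y"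
  using unit_form_exists[of x] unit_form_exists[of y] unit_form_mult val_unit_form by metis

lemma val_inverse: "x \<noteq> 0 \<Longrightarrow> padic_val_rat l (inverse x) = - padic_val_rat l x"
  using unit_form_exists[of x] unit_form_inverse val_unit_form by metis

lemma val_of_int_unit: "\<not> int l dvd m \<Longrightarrow> padic_val_rat l (of_int m) = 0"
  using unit_form_of_int val_unit_form by blast

lemma val_of_int_uniformizer: "\<not> int l dvd m \<Longrightarrow> padic_val_rat l (of_int (int l * m)) = 1"
  by (rule val_unit_form[of _ _ m 1]) (use not_dvd_1 in \<open>simp add: unit_form_def\<close>)

lemma val_ge_iff: "val_ge l N x \<longleftrightarrow> (\<exists>m n. \<not> int l dvd n \<and> x * of_int n = of_nat l powi N * of_int m)"
proof (cases "x = 0")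
  case True
  then show ?thesis using not_dvd_1 by (auto simp: val_ge_def intro!: exI[of _ 0] exI[of _ 1])
next
  case False
  show ?thesis
  proof
    assume "val_ge l N x"
    then obtain k where k: "padic_val_rat l x = N + int k" using False by (auto simp: val_ge_def zle_iff_zadd)
    obtain m n where mn: "unit_form l x (padic_val_rat l x) m n" using unit_form_exists[OF False] .
    then have "x * of_int n = of_nat l powi N * of_int (int l ^ k * m)"
      unfolding unit_form_def k by (simp add: power_int_add)
    then show "\<exists>m n. \<not> int l dvd n \<and> x * of_int n = of_nat l powi N * of_int m"
      using mn unit_form_def by blast
  next
    assume "\<exists>m n. \<not> int l dvd n \<and> x * of_int n = of_nat l powi N * of_int m"
    then obtain m n where mn: "\<not> int l dvd n" "x * of_int n = of_nat l powi N * of_int m" by blast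
    define j where "j = multiplicity (int l) m"
    have "m \<noteq> 0" using mn False by auto
    then obtain u where u: "(of_int m :: rat) = of_nat l ^ j * of_int u" "\<not> int l dvd u"
      unfolding j_def by (rule split_multiplicity)
    then have "unit_form l x (N + int j) u n" using mn unfolding unit_form_def by (simp add: power_int_add)
    then show "val_ge l N x" using val_unit_form by (simp add: val_ge_def)
  qed
qed

lemma val_ge_0 [simp]: "val_ge l N 0"
  by (simp add: val_ge_def)

lemma val_ge_mono: "val_ge l N x \<Longrightarrow> M \<le> N \<Longrightarrow> val_ge l M x"
  by (auto simp: val_ge_def)

lemma val_ge_add:
  assumes "val_ge l N x" "val_ge l N y"
  shows "val_ge l N (x + y)"
proof -
  obtain m n m' n' where mn: "\<not> int l dvd n" "x * of_int n = of_nat l powi N * of_int m"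
      "\<not> int l dvd n'" "y * of_int n' = of_nat l powi N * of_int m'"
    using assms by (auto simp: val_ge_iff)
  have "(x + y) * of_int (n * n') = (x * of_int n) * of_int n' + (y * of_int n') * of_int n"
    by (simp add: algebra_simps)
  then have "\<not> int l dvd n * n' \<and> (x + y) * of_int (n * n') = of_nat l powi N * of_int (m * n' + m' * n)"
    using mn by (simp add: dvd_mult_iff algebra_simps)
  then show ?thesis unfolding val_ge_iff by blast
qed

lemma val_ge_mult:
  assumes "val_ge l N x" "val_ge l M y"
  shows "val_ge l (N + M) (x * y)"
  using assms val_mult[of x y] by (cases "x = 0 \<or> y = 0") (auto simp: val_ge_def)

lemma val_ge_of_int: "val_ge l 0 (of_int k)"
proof -
  have "(of_int k :: rat) * of_int 1 = of_nat l powi 0 * of_int k" by simp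
  then show ?thesis unfolding val_ge_iff using not_dvd_1 by blast
qed

lemma val_ge_minus: "val_ge l N (- x) \<longleftrightarrow> val_ge l N x"
  using val_ge_mult[of N x 0 "- 1"] val_ge_mult[of N "- x" 0 "- 1"] val_ge_of_int[of "- 1"] by auto

lemma val_ge_diff: "val_ge l N x \<Longrightarrow> val_ge l N y \<Longrightarrow> val_ge l N (x - y)"
  using val_ge_add[of N x "- y"] by (simp add: val_ge_minus)

lemma val_ge_self: "val_ge l (padic_val_rat l x) x"
  by (simp add: val_ge_def)

lemma val_ge_all_imp_0: "(\<And>N. val_ge l N x) \<Longrightarrow> x = 0"
  using val_ge_def[of l "padic_val_rat l x + 1" x] by auto

lemma val_ge_inverse: "\<not> val_ge l N x \<Longrightarrow> val_ge l (- N) (inverse x)"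
  by (auto simp: val_ge_def val_inverse)

lemma val_ge_of_int_iff: "val_ge l (int c) (of_int k) \<longleftrightarrow> int l ^ c dvd k"
proof
  assume "val_ge l (int c) (of_int k)"
  then obtain m n where mn: "\<not> int l dvd n" "(of_int k :: rat) * of_int n = of_nat l powi (int c) * of_int m"
    by (auto simp: val_ge_iff)
  then have "of_int (k * n) = (of_int (int l ^ c * m) :: rat)" by simp
  then have "k * n = int l ^ c * m" by (simp only: of_int_eq_iff)
  moreover have "coprime (int l ^ c) n"
    using mn int_l_prime by (metis coprime_power_left_iff prime_imp_coprime)
  ultimately show "int l ^ c dvd k" by (metis coprime_dvd_mult_left_iff dvd_triv_left)
next
  assume "int l ^ c dvd k"
  then obtain m where "k = int l ^ c * m" by blast
  then have "(of_int k :: rat) * of_int 1 = of_nat l powi (int c) * of_int m" by simp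
  then show "val_ge l (int c) (of_int k)" unfolding val_ge_iff using not_dvd_1 by blast
qed

lemma val_add_larger:
  assumes "x \<noteq> 0" "val_ge l (padic_val_rat l x + 1) y"
  shows "x + y \<noteq> 0" "padic_val_rat l (x + y) = padic_val_rat l x"
proof -
  have "\<not> val_ge l (padic_val_rat l x + 1) (x + y)"
    using val_ge_diff[OF _ assms(2), of "x + y"] assms(1) by (auto simp: val_ge_def)
  moreover have "val_ge l (padic_val_rat l x) (x + y)"
    using val_ge_add[OF val_ge_self] val_ge_mono[OF assms(2)] by simp
  ultimately show "x + y \<noteq> 0" "padic_val_rat l (x + y) = padic_val_rat l x"
    by (auto simp: val_ge_def)
qed

lemma val_near_1:
  assumes "val_ge l 1 (x - 1)"
  shows "x \<noteq> 0" "padic_val_rat l x = 0"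
  using val_add_larger[of 1 "x - 1"] val_of_int_unit[OF not_dvd_1] assms by simp_all

section \<open>Cauchy sequences for the p-adic absolute value\<close>

lemma uniformly_small_iff:
  "(\<forall>e>0. \<exists>M. \<forall>i\<in>A M. padic_abs l (z i) < e) \<longleftrightarrow> (\<forall>N. \<exists>M. \<forall>i\<in>A M. val_ge l N (z i))"
proof (intro iffI allI impI)
  have l: "real l > 1" using prime_gt_1_nat[OF l_prime] by simp
  fix N :: int
  assume "\<forall>e>0. \<exists>M. \<forall>i\<in>A M. padic_abs l (z i) < e"
  then have "\<exists>M. \<forall>i\<in>A M. padic_abs l (z i) < real l powr (- real_of_int N)" by simp
  moreover have "val_ge l N x" if "padic_abs l x < real l powr (- real_of_int N)" for x
    using that l by (cases "x = 0") (simp_all add: padic_abs_def val_ge_def)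
  ultimately show "\<exists>M. \<forall>i\<in>A M. val_ge l N (z i)" by blast
next
  have l: "real l > 1" using prime_gt_1_nat[OF l_prime] by simp
  fix e :: real
  assume small: "\<forall>N. \<exists>M. \<forall>i\<in>A M. val_ge l N (z i)" and "e > 0"
  obtain N :: nat where "(1 / real l) ^ N < e"
    using real_arch_pow_inv[OF \<open>e > 0\<close>, of "1 / real l"] l by auto
  then have "real l powr (- real N) < e"
    using l by (simp add: powr_minus powr_realpow power_one_over inverse_eq_divide)
  moreover have "padic_abs l x < real l powr (- real N)" if "val_ge l (int N + 1) x" for x
    using that l by (cases "x = 0") (simp_all add: padic_abs_def val_ge_def)
  ultimately show "\<exists>M. \<forall>i\<in>A M. padic_abs l (z i) < e" using small by (meson less_trans)
qed

lemma null_iff: "padic_null l X \<longleftrightarrow> (\<forall>N. \<exists>M. \<forall>m\<ge>M. val_ge l N (X m))"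
  using uniformly_small_iff[of "\<lambda>M. {M..}" X] by (simp add: padic_null_def Ball_def)

lemma cauchy_iff: "padic_cauchy l X \<longleftrightarrow> (\<forall>N. \<exists>M. \<forall>m\<ge>M. \<forall>k\<ge>M. val_ge l N (X m - X k))"
  using uniformly_small_iff[of "\<lambda>M. {M..} \<times> {M..}" "\<lambda>(m, k). X m - X k"]
  by (simp add: padic_cauchy_def Ball_def imp_conjL)

lemma null_add: "padic_null l X \<Longrightarrow> padic_null l Y \<Longrightarrow> padic_null l (\<lambda>n. X n + Y n)"
  unfolding null_iff by (metis (no_types, opaque_lifting) max.boundedE val_ge_add)

lemma null_minus: "padic_null l X \<Longrightarrow> padic_null l (\<lambda>n. - X n)"
  unfolding null_iff by (simp add: val_ge_minus)

lemma null_zero [simp]: "padic_null l (\<lambda>_. 0)"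
  by (simp add: null_iff)

lemma null_sym: "padic_null l (\<lambda>n. X n - Y n) \<Longrightarrow> padic_null l (\<lambda>n. Y n - X n)"
  using null_minus[of "\<lambda>n. X n - Y n"] by simp

lemma null_trans:
  "padic_null l (\<lambda>n. X n - Y n) \<Longrightarrow> padic_null l (\<lambda>n. Y n - Z n) \<Longrightarrow> padic_null l (\<lambda>n. X n - Z n)"
  using null_add[of "\<lambda>n. X n - Y n" "\<lambda>n. Y n - Z n"] by simp

lemma cauchy_bounded:
  assumes "padic_cauchy l X"
  obtains B M where "\<And>m. m \<ge> M \<Longrightarrow> val_ge l B (X m)"
proof -
  obtain M where M: "\<forall>m\<ge>M. \<forall>k\<ge>M. val_ge l 0 (X m - X k)" using assms cauchy_iff by blast
  define B where "B = min 0 (padic_val_rat l (X M))"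
  have "val_ge l B (X m)" if "m \<ge> M" for m
  proof -
    have "val_ge l B (X m - X M)" "val_ge l B (X M)"
      using M that val_ge_mono val_ge_self unfolding B_def
      by (meson le_refl min.cobounded1 min.cobounded2)+
    then show ?thesis using val_ge_add by fastforce
  qed
  then show ?thesis using that by blast
qed

lemma null_mult:
  assumes "padic_null l X" "padic_cauchy l Y"
  shows "padic_null l (\<lambda>n. X n * Y n)"
  unfolding null_iff
proof
  fix N :: int
  obtain B M where B: "\<And>m. m \<ge> M \<Longrightarrow> val_ge l B (Y m)" using cauchy_bounded[OF assms(2)] by blast
  obtain M' where M': "\<forall>m\<ge>M'. val_ge l (N - B) (X m)" using assms(1) null_iff by blast
  have "val_ge l N (X m * Y m)" if "m \<ge> max M M'" for m
    using val_ge_mult[of "N - B" "X m" B "Y m"] M' B that by simp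
  then show "\<exists>M. \<forall>m\<ge>M. val_ge l N (X m * Y m)" by blast
qed

lemma cauchy_const [simp]: "padic_cauchy l (\<lambda>_. r)"
  by (simp add: cauchy_iff)

lemma cauchy_add:
  assumes "padic_cauchy l X" "padic_cauchy l Y"
  shows "padic_cauchy l (\<lambda>n. X n + Y n)"
  unfolding cauchy_iff
proof
  fix N :: int
  obtain M M' where "\<forall>m\<ge>M. \<forall>k\<ge>M. val_ge l N (X m - X k)" "\<forall>m\<ge>M'. \<forall>k\<ge>M'. val_ge l N (Y m - Y k)"
    using assms cauchy_iff by meson
  then have "val_ge l N ((X m + Y m) - (X k + Y k))" if "m \<ge> max M M'" "k \<ge> max M M'" for m k
    using val_ge_add[of N "X m - X k" "Y m - Y k"] that by (simp add: algebra_simps)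
  then show "\<exists>M. \<forall>m\<ge>M. \<forall>k\<ge>M. val_ge l N ((X m + Y m) - (X k + Y k))" by blast
qed

lemma cauchy_minus: "padic_cauchy l X \<Longrightarrow> padic_cauchy l (\<lambda>n. - X n)"
  unfolding cauchy_iff by (metis (no_types, lifting) minus_diff_minus val_ge_minus)

lemma cauchy_mult:
  assumes "padic_cauchy l X" "padic_cauchy l Y"
  shows "padic_cauchy l (\<lambda>n. X n * Y n)"
  unfolding cauchy_iff
proof
  fix N :: int
  obtain B M where B: "\<And>m. m \<ge> M \<Longrightarrow> val_ge l B (Y m)" using cauchy_bounded[OF assms(2)] by blast
  obtain B' M' where B': "\<And>m. m \<ge> M' \<Longrightarrow> val_ge l B' (X m)" using cauchy_bounded[OF assms(1)] by blast
  obtain M\<^sub>X where M\<^sub>X: "\<forall>m\<ge>M\<^sub>X. \<forall>k\<ge>M\<^sub>X. val_ge l (N - B) (X m - X k)" using assms(1) cauchy_iff by blast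
  obtain M\<^sub>Y where M\<^sub>Y: "\<forall>m\<ge>M\<^sub>Y. \<forall>k\<ge>M\<^sub>Y. val_ge l (N - B') (Y m - Y k)" using assms(2) cauchy_iff by blast
  have "val_ge l N (X m * Y m - X k * Y k)"
    if "m \<ge> max (max M M') (max M\<^sub>X M\<^sub>Y)" "k \<ge> max (max M M') (max M\<^sub>X M\<^sub>Y)" for m k
  proof -
    have "val_ge l N ((X m - X k) * Y m)" "val_ge l N ((Y m - Y k) * X k)"
      using val_ge_mult[of "N - B" "X m - X k" B "Y m"] val_ge_mult[of "N - B'" "Y m - Y k" B' "X k"]
        M\<^sub>X M\<^sub>Y B B' that by simp_all
    then have "val_ge l N ((X m - X k) * Y m + (Y m - Y k) * X k)" by (rule val_ge_add)
    then show ?thesis by (simp add: algebra_simps)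
  qed
  then show "\<exists>M. \<forall>m\<ge>M. \<forall>k\<ge>M. val_ge l N (X m * Y m - X k * Y k)" by blast
qed

lemma cauchy_nonnull:
  assumes "padic_cauchy l X" "\<not> padic_null l X"
  obtains N M where "\<And>m. m \<ge> M \<Longrightarrow> \<not> val_ge l N (X m)"
proof -
  obtain N where N: "\<And>M. \<exists>m\<ge>M. \<not> val_ge l N (X m)" using assms(2) null_iff by auto
  obtain M where M: "\<forall>m\<ge>M. \<forall>k\<ge>M. val_ge l N (X m - X k)" using assms(1) cauchy_iff by blast
  obtain k where k: "k \<ge> M" "\<not> val_ge l N (X k)" using N by blast
  have "\<not> val_ge l N (X m)" if "m \<ge> M" for m
  proof
    assume "val_ge l N (X m)"
    then have "val_ge l N (X m - (X m - X k))" using M that k val_ge_diff by blast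
    then show False using k by simp
  qed
  then show ?thesis using that by blast
qed

lemma cauchy_inverse:
  assumes "padic_cauchy l X" "\<not> padic_null l X"
  shows "padic_cauchy l (\<lambda>n. inverse (X n))"
  unfolding cauchy_iff
proof
  fix N :: int
  obtain B M where B: "\<And>m. m \<ge> M \<Longrightarrow> \<not> val_ge l B (X m)" using cauchy_nonnull[OF assms] by blast
  obtain M' where M': "\<forall>m\<ge>M'. \<forall>k\<ge>M'. val_ge l (N + B + B) (X m - X k)" using assms(1) cauchy_iff by blast
  have "val_ge l N (inverse (X m) - inverse (X k))" if "m \<ge> max M M'" "k \<ge> max M M'" for m k
  proof -
    have nonzero: "X m \<noteq> 0" "X k \<noteq> 0" using B[of m] B[of k] that by auto
    have "val_ge l (- B + - B) (inverse (X m) * inverse (X k))"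
      by (intro val_ge_mult val_ge_inverse B) (use that in auto)
    moreover have "val_ge l (N + B + B) (X k - X m)" using M' that by simp
    ultimately have "val_ge l ((N + B + B) + (- B + - B)) ((X k - X m) * (inverse (X m) * inverse (X k)))"
      by (rule val_ge_mult[rotated])
    moreover have "(X k - X m) * (inverse (X m) * inverse (X k)) = inverse (X m) - inverse (X k)"
      using nonzero by (simp add: field_simps)
    ultimately show ?thesis by simp
  qed
  then show "\<exists>M. \<forall>m\<ge>M. \<forall>k\<ge>M. val_ge l N (inverse (X m) - inverse (X k))" by blast
qed

end

section \<open>The field of p-adic numbers\<close>

context prime_place
begin

abbreviation cls :: "(nat \<Rightarrow> rat) \<Rightarrow> (nat \<Rightarrow> rat) set" where
  "cls \<equiv> padic_class l"

abbreviation \<iota> :: "rat \<Rightarrow> (nat \<Rightarrow> rat) set" where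
  "\<iota> r \<equiv> cls (\<lambda>_. r)"

lemma cls_eq_iff:
  assumes "padic_cauchy l X" "padic_cauchy l Y"
  shows "cls X = cls Y \<longleftrightarrow> padic_null l (\<lambda>n. X n - Y n)"
proof
  assume same: "cls X = cls Y"
  have "Y \<in> cls Y" using assms by (simp add: padic_class_def)
  then have "Y \<in> cls X" by (simp only: same)
  then show "padic_null l (\<lambda>n. X n - Y n)" by (simp add: padic_class_def)
next
  assume null: "padic_null l (\<lambda>n. X n - Y n)"
  show "cls X = cls Y"
    unfolding padic_class_def using null null_sym[OF null] by (auto intro: null_trans)
qed

lemma rep_cls:
  assumes "padic_cauchy l X"
  shows "padic_cauchy l (padic_rep (cls X))" "padic_null l (\<lambda>n. X n - padic_rep (cls X) n)"
proof -
  have "X \<in> cls X" using assms by (simp add: padic_class_def)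
  then have "padic_rep (cls X) \<in> cls X"
    unfolding padic_rep_def by (rule someI[of "\<lambda>Y. Y \<in> cls X"])
  then show "padic_cauchy l (padic_rep (cls X))" "padic_null l (\<lambda>n. X n - padic_rep (cls X) n)"
    by (auto simp: padic_class_def)
qed

lemma Qp_carrier: "carrier (Qp l) = cls ` {X. padic_cauchy l X}"
  by (simp add: Qp_def)

lemma Qp_one: "\<one>\<^bsub>Qp l\<^esub> = \<iota> 1" and Qp_zero: "\<zero>\<^bsub>Qp l\<^esub> = \<iota> 0"
  by (simp_all add: Qp_def)

lemma Qp_add:
  assumes "padic_cauchy l X" "padic_cauchy l Y"
  shows "cls X \<oplus>\<^bsub>Qp l\<^esub> cls Y = cls (\<lambda>n. X n + Y n)"
proof -
  note rep = rep_cls[OF assms(1)] rep_cls[OF assms(2)]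
  have "cls (\<lambda>n. X n + Y n) = cls (\<lambda>n. padic_rep (cls X) n + padic_rep (cls Y) n)"
    using null_add[OF rep(2,4)]
    by (subst cls_eq_iff) (auto intro: cauchy_add assms rep simp: algebra_simps)
  then show ?thesis by (simp add: Qp_def)
qed

lemma Qp_mult:
  assumes "padic_cauchy l X" "padic_cauchy l Y"
  shows "cls X \<otimes>\<^bsub>Qp l\<^esub> cls Y = cls (\<lambda>n. X n * Y n)"
proof -
  note rep = rep_cls[OF assms(1)] rep_cls[OF assms(2)]
  have "cls (\<lambda>n. X n * Y n) = cls (\<lambda>n. padic_rep (cls X) n * padic_rep (cls Y) n)"
  proof (subst cls_eq_iff)
    have "padic_null l (\<lambda>n. (X n - padic_rep (cls X) n) * Y n + (Y n - padic_rep (cls Y) n) * padic_rep (cls X) n)"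
      by (intro null_add null_mult rep assms)
    then show "padic_null l (\<lambda>n. X n * Y n - padic_rep (cls X) n * padic_rep (cls Y) n)"
      by (simp add: algebra_simps)
  qed (intro cauchy_mult assms rep)+
  then show ?thesis by (simp add: Qp_def)
qed

lemma Qp_cring: "cring (Qp l)"
proof (rule cringI)
  show "abelian_group (Qp l)"
  proof (rule abelian_groupI)
    fix x assume "x \<in> carrier (Qp l)"
    then obtain X where "padic_cauchy l X" "x = cls X" by (auto simp: Qp_carrier)
    then show "\<exists>y\<in>carrier (Qp l). y \<oplus>\<^bsub>Qp l\<^esub> x = \<zero>\<^bsub>Qp l\<^esub>"
      using cauchy_minus by (intro bexI[of _ "cls (\<lambda>n. - X n)"]) (auto simp: Qp_add Qp_zero Qp_carrier)
  qed (auto simp: Qp_carrier Qp_add Qp_zero cauchy_add ac_simps)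
  show "comm_monoid (Qp l)"
    by (rule comm_monoidI) (auto simp: Qp_carrier Qp_mult Qp_one cauchy_mult ac_simps)
  fix x y z assume "x \<in> carrier (Qp l)" "y \<in> carrier (Qp l)" "z \<in> carrier (Qp l)"
  then show "(x \<oplus>\<^bsub>Qp l\<^esub> y) \<otimes>\<^bsub>Qp l\<^esub> z = x \<otimes>\<^bsub>Qp l\<^esub> z \<oplus>\<^bsub>Qp l\<^esub> y \<otimes>\<^bsub>Qp l\<^esub> z"
    by (auto simp: Qp_carrier Qp_mult Qp_add cauchy_mult cauchy_add algebra_simps)
qed

lemma \<iota>_eq_iff: "\<iota> r = \<iota> s \<longleftrightarrow> r = s"
proof -
  have "padic_null l (\<lambda>_. r - s) \<longleftrightarrow> r = s" using val_ge_all_imp_0[of "r - s"] by (auto simp: null_iff)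
  then show ?thesis by (simp add: cls_eq_iff)
qed

lemma nonzero_class_not_null: "padic_cauchy l X \<Longrightarrow> cls X \<noteq> \<zero>\<^bsub>Qp l\<^esub> \<Longrightarrow> \<not> padic_null l X"
  using cls_eq_iff[of X "\<lambda>_. 0"] by (simp add: Qp_zero)

lemma Qp_field: "field (Qp l)"
proof (rule cring.cring_fieldI2[OF Qp_cring])
  show "\<zero>\<^bsub>Qp l\<^esub> \<noteq> \<one>\<^bsub>Qp l\<^esub>" by (simp add: Qp_one Qp_zero \<iota>_eq_iff)
  fix x assume x: "x \<in> carrier (Qp l)" "x \<noteq> \<zero>\<^bsub>Qp l\<^esub>"
  then obtain X where X: "padic_cauchy l X" "x = cls X" by (auto simp: Qp_carrier)
  have nonnull: "\<not> padic_null l X" using x X nonzero_class_not_null by simp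
  note inverse = cauchy_inverse[OF X(1) nonnull]
  obtain N M where M: "\<And>m. m \<ge> M \<Longrightarrow> \<not> val_ge l N (X m)" using cauchy_nonnull[OF X(1) nonnull] by blast
  have "X m * inverse (X m) - 1 = 0" if "m \<ge> M" for m
    using M[OF that] val_ge_0[of N] by (cases "X m = 0") simp_all
  then have "padic_null l (\<lambda>n. X n * inverse (X n) - 1)" unfolding null_iff by (metis val_ge_0)
  then have "x \<otimes>\<^bsub>Qp l\<^esub> cls (\<lambda>n. inverse (X n)) = \<one>\<^bsub>Qp l\<^esub>"
    using X inverse cauchy_mult[OF X(1) inverse] by (simp add: Qp_mult Qp_one cls_eq_iff)
  then show "\<exists>y\<in>carrier (Qp l). x \<otimes>\<^bsub>Qp l\<^esub> y = \<one>\<^bsub>Qp l\<^esub>" using inverse by (auto simp: Qp_carrier)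
qed

abbreviation is_square :: "(nat \<Rightarrow> rat) set \<Rightarrow> bool" where
  "is_square z \<equiv> \<exists>s\<in>carrier (Qp l). s \<otimes>\<^bsub>Qp l\<^esub> s = z"

lemma is_square_mult_square:
  assumes "is_square (cls X)" "padic_cauchy l X"
  shows "is_square (cls (\<lambda>n. X n * (r * r)))"
proof -
  interpret field "Qp l" by (rule Qp_field)
  obtain s where s: "s \<in> carrier (Qp l)" "s \<otimes>\<^bsub>Qp l\<^esub> s = cls X" using assms by blast
  have r: "\<iota> r \<in> carrier (Qp l)" by (simp add: Qp_carrier)
  have "(s \<otimes>\<^bsub>Qp l\<^esub> \<iota> r) \<otimes>\<^bsub>Qp l\<^esub> (s \<otimes>\<^bsub>Qp l\<^esub> \<iota> r) = (s \<otimes>\<^bsub>Qp l\<^esub> s) \<otimes>\<^bsub>Qp l\<^esub> (\<iota> r \<otimes>\<^bsub>Qp l\<^esub> \<iota> r)"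
    using s(1) r by (simp add: m_ac)
  also have "\<dots> = cls (\<lambda>n. X n * (r * r))" unfolding s(2) using assms(2) by (simp add: Qp_mult)
  finally show ?thesis using s(1) r by (intro bexI[of _ "s \<otimes>\<^bsub>Qp l\<^esub> \<iota> r"]) auto
qed

end

section \<open>Square classes of p-adic numbers\<close>

lemma of_int_bit_eq_0_iff: "(of_int N :: bit) = 0 \<longleftrightarrow> even N"
  by (cases "even N") (auto elim!: evenE oddE)

text \<open>Units congruent to 1 modulo l^c are squares by Hensel's lemma, and chi is an injection of the
  square classes of units into some abelian group.\<close>
locale hensel_place = prime_place +
  fixes c :: nat and chi :: "int \<Rightarrow> 'h::ab_group_add"
  assumes c: "(l = 2 \<and> c = 3) \<or> (odd l \<and> c = 1)"
    and chi_mult: "\<not> int l dvd m \<Longrightarrow> \<not> int l dvd n \<Longrightarrow> chi (m * n) = chi m + chi n"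
    and chi_double: "\<not> int l dvd m \<Longrightarrow> chi m + chi m = 0"
    and chi_cong: "\<not> int l dvd m \<Longrightarrow> int l ^ c dvd m - n \<Longrightarrow> chi m = chi n"
    and chi_eq_0_imp: "\<not> int l dvd m \<Longrightarrow> chi m = 0 \<Longrightarrow> \<exists>s. int l ^ c dvd m - s * s"
begin

definition val_two :: int where
  "val_two = (if l = 2 then 1 else 0)"

lemma c_eq: "int c = 2 * val_two + 1" "val_two \<ge> 0" "c > 0"
  using c by (auto simp: val_two_def)

lemma val_of_2: "padic_val_rat l 2 = val_two"
proof (cases "l = 2")
  case True
  then have "padic_val_rat l 2 = 1" using val_of_int_uniformizer[of 1] not_dvd_1 by simp
  then show ?thesis unfolding val_two_def using True by simp
next
  case False
  then have "\<not> int l dvd 2"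
    using l_prime primes_dvd_imp_eq[of l 2] of_nat_dvd_iff[of l 2, where 'a = int] by auto
  then show ?thesis using val_of_int_unit[of 2] False by (simp add: val_two_def)
qed

lemma newton_step:
  assumes s: "val_ge l (int c + int k) (s * s - x)" "val_ge l (val_two + 1) (s - 1)"
  shows "\<exists>s'. val_ge l (int c + int (Suc k)) (s' * s' - x) \<and> val_ge l (val_two + 1) (s' - 1)"
proof -
  have unit: "s \<noteq> 0" "padic_val_rat l s = 0"
    using val_near_1[of s] val_ge_mono[OF s(2), of 1] c_eq by auto
  define e where "e = (x - s * s) * inverse (2 * s)"
  have "padic_val_rat l (inverse (2 * s)) = - val_two"
    using val_inverse[of "2 * s"] val_mult[of 2 s] unit val_of_2 by simp
  then have "val_ge l (- val_two) (inverse (2 * s))" by (simp add: val_ge_def)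
  moreover have "val_ge l (int c + int k) (x - s * s)" using s(1) val_ge_minus[of _ "s * s - x"] by simp
  ultimately have e: "val_ge l ((int c + int k) + - val_two) e" unfolding e_def by (intro val_ge_mult)
  have "2 * s * e = x - s * s" unfolding e_def using unit by (simp add: field_simps)
  then have "(s + e) * (s + e) - x = e * e" by (simp add: algebra_simps)
  then have "val_ge l (int c + int (Suc k)) ((s + e) * (s + e) - x)"
    using val_ge_mono[OF val_ge_mult[OF e e]] c_eq by simp
  moreover have "val_ge l (val_two + 1) (s - 1 + e)"
    using val_ge_add[OF s(2)] val_ge_mono[OF e, of "val_two + 1"] c_eq by simp
  ultimately show ?thesis by (intro exI[of _ "s + e"]) (simp add: algebra_simps)
qed

lemma approximate_root:
  assumes "val_ge l (int c) (x - 1)"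
  shows "\<exists>s. val_ge l (int c + int k) (s * s - x) \<and> val_ge l (val_two + 1) (s - 1)"
proof (induction k)
  case 0
  have "val_ge l (int c) (1 - x)" using assms val_ge_minus[of "int c" "x - 1"] by simp
  then show ?case by (intro exI[of _ 1]) simp
next
  case (Suc k)
  then show ?case using newton_step by blast
qed

lemma inverse_sum_near_1:
  assumes "val_ge l (val_two + 1) (s - 1)" "val_ge l (val_two + 1) (t - 1)"
  shows "s + t \<noteq> 0" "val_ge l (- (val_two + 1)) (inverse (s + t))"
proof -
  have "val_ge l (padic_val_rat l 2 + 1) ((s - 1) + (t - 1))" using val_ge_add[OF assms] by (simp add: val_of_2)
  then have "s + t \<noteq> 0" "padic_val_rat l (s + t) = val_two"
    using val_add_larger[of 2 "(s - 1) + (t - 1)"] val_of_2 by (simp_all add: algebra_simps)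
  then show "s + t \<noteq> 0" "val_ge l (- (val_two + 1)) (inverse (s + t))"
    by (simp_all add: val_ge_def val_inverse)
qed

lemma cauchy_root:
  assumes X: "padic_cauchy l X" and null: "padic_null l (\<lambda>m. S m * S m - X m)"
    and near_1: "\<And>m. m \<ge> M \<Longrightarrow> val_ge l (val_two + 1) (S m - 1)"
  shows "padic_cauchy l S"
  unfolding cauchy_iff
proof
  fix N :: int
  obtain M\<^sub>X where M\<^sub>X: "\<forall>m\<ge>M\<^sub>X. \<forall>k\<ge>M\<^sub>X. val_ge l (N + (val_two + 1)) (X m - X k)" using X cauchy_iff by blast
  obtain M\<^sub>S where M\<^sub>S: "\<forall>m\<ge>M\<^sub>S. val_ge l (N + (val_two + 1)) (S m * S m - X m)"
    using null[unfolded null_iff] by blast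
  have "val_ge l N (S m - S k)" if m: "m \<ge> max M (max M\<^sub>X M\<^sub>S)" and k: "k \<ge> max M (max M\<^sub>X M\<^sub>S)" for m k
  proof -
    have sum: "S m + S k \<noteq> 0" "val_ge l (- (val_two + 1)) (inverse (S m + S k))"
      using inverse_sum_near_1[of "S m" "S k"] near_1 m k by simp_all
    have "val_ge l (N + (val_two + 1)) ((S m * S m - X m) - (S k * S k - X k) + (X m - X k))"
      by (rule val_ge_add[OF val_ge_diff]) (use M\<^sub>X M\<^sub>S m k in simp_all)
    then have "val_ge l (N + (val_two + 1) + - (val_two + 1))
        ((S m * S m - X m - (S k * S k - X k) + (X m - X k)) * inverse (S m + S k))"
      using sum(2) by (rule val_ge_mult)
    moreover have "(S m * S m - X m - (S k * S k - X k) + (X m - X k)) * inverse (S m + S k) = S m - S k"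
      using sum(1) by (simp add: field_simps)
    ultimately show ?thesis by simp
  qed
  then show "\<exists>M. \<forall>m\<ge>M. \<forall>k\<ge>M. val_ge l N (S m - S k)" by blast
qed

theorem hensel_square:
  assumes X: "padic_cauchy l X" and M: "\<And>m. m \<ge> M \<Longrightarrow> val_ge l (int c) (X m - 1)"
  shows "is_square (cls X)"
proof -
  have "\<exists>s. m \<ge> M \<longrightarrow> val_ge l (int c + int m) (s * s - X m) \<and> val_ge l (val_two + 1) (s - 1)" for m
    using approximate_root[OF M, of m m] by blast
  then obtain S where S: "\<And>m. m \<ge> M \<Longrightarrow> val_ge l (int c + int m) (S m * S m - X m) \<and> val_ge l (val_two + 1) (S m - 1)"
    by metis
  have null: "padic_null l (\<lambda>n. S n * S n - X n)"
    unfolding null_iff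
  proof
    fix N :: int
    have "val_ge l N (S m * S m - X m)" if "m \<ge> max M (nat N)" for m
      using S[of m] that by (auto intro: val_ge_mono)
    then show "\<exists>M. \<forall>m\<ge>M. val_ge l N (S m * S m - X m)" by blast
  qed
  have cauchy: "padic_cauchy l S" using cauchy_root[OF X null] S by blast
  then have "cls S \<otimes>\<^bsub>Qp l\<^esub> cls S = cls X"
    using null X cauchy_mult[OF cauchy cauchy] by (simp add: Qp_mult cls_eq_iff)
  then show ?thesis using cauchy by (auto simp: Qp_carrier)
qed

definition rat_class :: "rat \<Rightarrow> bit \<times> 'h" where
  "rat_class x = (SOME g. \<exists>N m n. unit_form l x N m n \<and> g = (of_int N, chi m + chi n))"

lemma rat_class_unit_form:
  assumes "unit_form l x N m n"
  shows "rat_class x = (of_int N, chi m + chi n)"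
proof -
  have "\<exists>N m n. unit_form l x N m n \<and> rat_class x = (of_int N, chi m + chi n)"
    unfolding rat_class_def by (rule someI_ex) (use assms in blast)
  then obtain N' m' n' where form': "unit_form l x N' m' n'" "rat_class x = (of_int N', chi m' + chi n')"
    by blast
  have same: "N = N'" "m * n' = m' * n" using unit_form_unique[OF assms form'(1)] by auto
  have units: "\<not> int l dvd m" "\<not> int l dvd n" "\<not> int l dvd m'" "\<not> int l dvd n'"
    using assms form' by (auto simp: unit_form_def)
  have "chi m + chi n' = chi m' + chi n" using arg_cong[OF same(2), of chi] units by (simp add: chi_mult)
  then have "(chi m + chi n') + (chi n + chi n') = (chi m' + chi n) + (chi n + chi n')" by simp
  then have "chi m + chi n + (chi n' + chi n') = chi m' + chi n' + (chi n + chi n)" by (simp add: ac_simps)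
  then have "chi m + chi n = chi m' + chi n'" using units by (simp add: chi_double)
  then show ?thesis using form' same by simp
qed

lemma rat_class_mult:
  assumes "x \<noteq> 0" "y \<noteq> 0"
  shows "rat_class (x * y) = rat_class x + rat_class y"
proof -
  obtain N m n where x: "unit_form l x N m n" using unit_form_exists[OF assms(1)] by blast
  obtain N' m' n' where y: "unit_form l y N' m' n'" using unit_form_exists[OF assms(2)] by blast
  have units: "\<not> int l dvd m" "\<not> int l dvd n" "\<not> int l dvd m'" "\<not> int l dvd n'"
    using x y by (auto simp: unit_form_def)
  show ?thesis
    unfolding rat_class_unit_form[OF x] rat_class_unit_form[OF y] rat_class_unit_form[OF unit_form_mult[OF x y]]
    using units by (simp add: chi_mult ac_simps)
qed

lemma rat_class_double:
  assumes "x \<noteq> 0"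
  shows "rat_class x + rat_class x = 0"
proof -
  obtain N m n where x: "unit_form l x N m n" using unit_form_exists[OF assms] by blast
  then have "chi m + chi m = 0" "chi n + chi n = 0" using chi_double by (auto simp: unit_form_def)
  moreover have "chi m + chi n + (chi m + chi n) = (chi m + chi m) + (chi n + chi n)" by (simp add: ac_simps)
  ultimately show ?thesis unfolding rat_class_unit_form[OF x] by (simp add: zero_prod_def)
qed

lemma rat_class_add_eq_0_iff: "x \<noteq> 0 \<Longrightarrow> rat_class x + g = 0 \<longleftrightarrow> g = rat_class x"
  using rat_class_double[of x] by (metis add_left_cancel)

lemma rat_class_triple: "x \<noteq> 0 \<Longrightarrow> rat_class x + rat_class x + rat_class x = 0 \<Longrightarrow> rat_class x = 0"
  using rat_class_double[of x] by simp

lemma chi_1: "chi 1 = 0"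
  using chi_mult[of 1 1] not_dvd_1 by simp

lemma rat_class_unit: "\<not> int l dvd m \<Longrightarrow> rat_class (of_int m) = (0, chi m)"
  using rat_class_unit_form[OF unit_form_of_int] chi_1 by simp

lemma fst_rat_class: "x \<noteq> 0 \<Longrightarrow> fst (rat_class x) = of_int (padic_val_rat l x)"
  using unit_form_exists[of x] rat_class_unit_form by (metis fst_conv)

lemma fst_rat_class_eq_0_iff: "x \<noteq> 0 \<Longrightarrow> fst (rat_class x) = 0 \<longleftrightarrow> even (padic_val_rat l x)"
  using of_int_bit_eq_0_iff by (simp add: fst_rat_class)

lemma rat_class_near_1:
  assumes "val_ge l (int c) (y - 1)"
  shows "y \<noteq> 0" "rat_class y = 0"
proof -
  have y: "y \<noteq> 0" "padic_val_rat l y = 0" using val_near_1[of y] val_ge_mono[OF assms, of 1] c_eq by auto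
  then obtain m n where form: "unit_form l y 0 m n" using unit_form_exists[of y] by metis
  have "val_ge l (int c + 0) ((y - 1) * of_int n)" by (intro val_ge_mult assms val_ge_of_int)
  moreover have "(y - 1) * of_int n = of_int (m - n)" using form by (simp add: unit_form_def algebra_simps)
  ultimately have "int l ^ c dvd m - n" using val_ge_of_int_iff[of c "m - n"] by simp
  then have "chi m = chi n" using chi_cong form by (auto simp: unit_form_def)
  then show "rat_class y = 0"
    unfolding rat_class_unit_form[OF form] using form chi_double by (simp add: unit_form_def zero_prod_def)
  show "y \<noteq> 0" by (rule y(1))
qed

lemma rat_class_add_small:
  assumes "x \<noteq> 0" "val_ge l (padic_val_rat l x + int c) y"
  shows "x + y \<noteq> 0" "rat_class (x + y) = rat_class x"
proof -
  have "val_ge l (- padic_val_rat l x) (inverse x)" using assms val_inverse by (simp add: val_ge_def)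
  then have "val_ge l (padic_val_rat l x + int c + - padic_val_rat l x) (y * inverse x)"
    using assms by (intro val_ge_mult)
  moreover have "y * inverse x = (x + y) * inverse x - 1" using assms by (simp add: field_simps)
  ultimately have near_1: "val_ge l (int c) ((x + y) * inverse x - 1)" by simp
  have quotient: "x + y = x * ((x + y) * inverse x)" using assms by (simp add: field_simps)
  then show "x + y \<noteq> 0" using rat_class_near_1(1)[OF near_1] by auto
  then have "rat_class (x * ((x + y) * inverse x)) = rat_class x + rat_class ((x + y) * inverse x)"
    using assms by (intro rat_class_mult) auto
  then show "rat_class (x + y) = rat_class x" using rat_class_near_1(2)[OF near_1] quotient by simp
qed

lemma rat_class_eq_0_imp_square:
  assumes x: "x \<noteq> 0" and trivial: "rat_class x = 0"
  shows "is_square (\<iota> x)"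
proof -
  obtain N m n where form: "unit_form l x N m n" using unit_form_exists[OF x] by blast
  then have units: "\<not> int l dvd m" "\<not> int l dvd n" by (auto simp: unit_form_def)
  have "even N" "chi (m * n) = 0"
    using trivial units unfolding rat_class_unit_form[OF form]
    by (auto simp: zero_prod_def chi_mult of_int_bit_eq_0_iff)
  then obtain j s where N: "N = 2 * j" and s: "int l ^ c dvd m * n - s * s"
    using chi_eq_0_imp[of "m * n"] units by (auto simp: dvd_mult_iff elim!: evenE)
  have "int l dvd m * n - s * s" using s c_eq(3) by (meson dvd_power dvd_trans)
  then have "\<not> int l dvd s"
    using units dvd_mult_iff by (metis dvd_add dvd_mult diff_add_cancel)
  then have unit: "s \<noteq> 0" "padic_val_rat l (of_int (s * s)) = 0"
    using val_of_int_unit[of "s * s"] dvd_mult_iff by (auto simp del: of_int_mult)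
  define w where "w = of_int (m * n) / (of_int (s * s) :: rat)"
  have "val_ge l 0 (inverse (of_int (s * s)))" using unit val_inverse[of "of_int (s * s)"] by (simp add: val_ge_def)
  then have "val_ge l (int c + 0) (of_int (m * n - s * s) * inverse (of_int (s * s)))"
    using s val_ge_of_int_iff by (intro val_ge_mult) blast+
  moreover have "of_int (m * n - s * s) * inverse (of_int (s * s)) = w - 1"
    unfolding w_def using unit(1) by (simp add: field_simps)
  ultimately have w: "is_square (\<iota> w)" using hensel_square[of "\<lambda>_. w"] by simp
  have "x = w * ((of_nat l powi j * of_int s / of_int n) * (of_nat l powi j * of_int s / of_int n))"
  proof -
    have n: "n \<noteq> 0" using units by auto
    have "x = of_nat l powi N * of_int m / of_int n" using form n by (simp add: unit_form_def field_simps)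
    also have "of_nat l powi N = (of_nat l powi j * of_nat l powi j :: rat)"
      unfolding N by (simp flip: power_int_add)
    finally show ?thesis using n unit(1) by (simp add: w_def field_simps)
  qed
  then show ?thesis using is_square_mult_square[OF w, of "of_nat l powi j * of_int s / of_int n"] by simp
qed

lemma square_imp_rat_class_eq_0:
  assumes x: "x \<noteq> 0" and square: "is_square (\<iota> x)"
  shows "rat_class x = 0"
proof -
  obtain S where S: "padic_cauchy l S" "cls S \<otimes>\<^bsub>Qp l\<^esub> cls S = \<iota> x" using square by (auto simp: Qp_carrier)
  then have "padic_null l (\<lambda>n. S n * S n - x)"
    using cauchy_mult[OF S(1) S(1)] by (simp add: Qp_mult cls_eq_iff)
  then obtain m where "val_ge l (padic_val_rat l x + int c) (S m * S m - x)"
    unfolding null_iff by (metis le_refl)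
  then have close: "S m * S m \<noteq> 0" "rat_class (S m * S m) = rat_class x"
    using rat_class_add_small[OF x, of "S m * S m - x"] by simp_all
  then show ?thesis using rat_class_double[of "S m"] rat_class_mult[of "S m" "S m"] by simp
qed

lemma approximation_within_class:
  assumes X: "padic_cauchy l X" and nonnull: "\<not> padic_null l X"
  shows "\<forall>\<^sub>F m in sequentially. X m \<noteq> 0 \<and> is_square (cls X \<otimes>\<^bsub>Qp l\<^esub> \<iota> (X m))"
proof -
  obtain B M where B: "\<And>m. m \<ge> M \<Longrightarrow> \<not> val_ge l B (X m)" using cauchy_nonnull[OF X nonnull] by blast
  obtain M' where M': "\<forall>m\<ge>M'. \<forall>k\<ge>M'. val_ge l (int c + B) (X m - X k)" using X cauchy_iff by blast
  have "X m \<noteq> 0 \<and> is_square (cls X \<otimes>\<^bsub>Qp l\<^esub> \<iota> (X m))" if m: "m \<ge> max M M'" for m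
  proof -
    have nonzero: "X m \<noteq> 0" using B[of m] m by auto
    have quotient: "padic_cauchy l (\<lambda>k. X k * inverse (X m))" using cauchy_mult[OF X] by simp
    have "val_ge l (int c) (X k * inverse (X m) - 1)" if k: "k \<ge> max M M'" for k
    proof -
      have "val_ge l ((int c + B) + - B) ((X k - X m) * inverse (X m))"
        using M' k m B[of m] by (intro val_ge_mult val_ge_inverse) auto
      moreover have "(X k - X m) * inverse (X m) = X k * inverse (X m) - 1"
        using nonzero by (simp add: field_simps)
      ultimately show ?thesis by simp
    qed
    then have "is_square (cls (\<lambda>k. X k * inverse (X m)))" using hensel_square[OF quotient] by blast
    then have "is_square (cls (\<lambda>k. X k * inverse (X m) * (X m * X m)))"
      using quotient by (rule is_square_mult_square)
    moreover have "X k * inverse (X m) * (X m * X m) = X k * X m" for k using nonzero by simp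
    ultimately show ?thesis using nonzero X by (simp only: Qp_mult cauchy_const) simp
  qed
  then show ?thesis unfolding eventually_sequentially by blast
qed

theorem place_Qp: "place (Qp l) \<iota> rat_class"
proof -
  interpret field "Qp l" by (rule Qp_field)
  show ?thesis
  proof
    show "\<one>\<^bsub>Qp l\<^esub> \<oplus>\<^bsub>Qp l\<^esub> \<one>\<^bsub>Qp l\<^esub> \<noteq> \<zero>\<^bsub>Qp l\<^esub>" by (simp add: Qp_one Qp_zero Qp_add \<iota>_eq_iff)
    show "\<iota> x \<in> carrier (Qp l)" for x by (simp add: Qp_carrier)
    show "\<iota> (x + y) = \<iota> x \<oplus>\<^bsub>Qp l\<^esub> \<iota> y" "\<iota> (x * y) = \<iota> x \<otimes>\<^bsub>Qp l\<^esub> \<iota> y" for x y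
      by (simp_all add: Qp_add Qp_mult)
    show "\<iota> x = \<zero>\<^bsub>Qp l\<^esub> \<Longrightarrow> x = 0" for x by (simp add: Qp_zero \<iota>_eq_iff)
    show "x \<noteq> 0 \<Longrightarrow> y \<noteq> 0 \<Longrightarrow> rat_class (x * y) = rat_class x + rat_class y" for x y
      by (rule rat_class_mult)
    show "x \<noteq> 0 \<Longrightarrow> rat_class x = 0 \<longleftrightarrow> is_square (\<iota> x)" for x
      using rat_class_eq_0_imp_square square_imp_rat_class_eq_0 by blast
    fix z C
    assume z: "z \<in> carrier (Qp l)" and C: "finite C" and nonzero: "\<And>r. r \<in> C \<Longrightarrow> z \<oplus>\<^bsub>Qp l\<^esub> \<iota> r \<noteq> \<zero>\<^bsub>Qp l\<^esub>"
    obtain X where X: "padic_cauchy l X" "z = cls X" using z by (auto simp: Qp_carrier)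
    have shift: "padic_cauchy l (\<lambda>n. X n + r)" "z \<oplus>\<^bsub>Qp l\<^esub> \<iota> r = cls (\<lambda>n. X n + r)" for r
      using cauchy_add[OF X(1)] X by (simp_all add: Qp_add)
    have "\<forall>\<^sub>F m in sequentially. X m + r \<noteq> 0 \<and> is_square ((z \<oplus>\<^bsub>Qp l\<^esub> \<iota> r) \<otimes>\<^bsub>Qp l\<^esub> \<iota> (X m + r))"
      if r: "r \<in> C" for r
      unfolding shift(2)
      by (rule approximation_within_class[OF shift(1)])
        (rule nonzero_class_not_null[OF shift(1) nonzero[OF r, unfolded shift(2)]])
    then have "\<forall>\<^sub>F m in sequentially. \<forall>r\<in>C. X m + r \<noteq> 0 \<and> is_square ((z \<oplus>\<^bsub>Qp l\<^esub> \<iota> r) \<otimes>\<^bsub>Qp l\<^esub> \<iota> (X m + r))"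
      using C by (intro eventually_ball_finite) auto
    then show "\<exists>x. \<forall>r\<in>C. x + r \<noteq> 0 \<and> is_square ((z \<oplus>\<^bsub>Qp l\<^esub> \<iota> r) \<otimes>\<^bsub>Qp l\<^esub> \<iota> (x + r))"
      unfolding eventually_sequentially by blast
  qed
qed

theorem local_delta_Qp:
  assumes "a \<noteq> 0" "b \<noteq> 0" "a \<noteq> b" "d \<noteq> 0"
  shows "local_delta (Qp l) (Qp_of_int l) (a + b) (a * b) d = (if rat_class (of_int d) = 0 then 0
    else log 2 (coset_count (kummer_image rat_class (of_int a) (of_int b))
      (kummer_image rat_class (of_int (d * a)) (of_int (d * b)))))"
  by (rule place.local_delta_eq[OF place_Qp]) (use assms in \<open>auto simp: Qp_of_int_def\<close>)

lemma elementary_2_subgroup_kummer_image: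
  assumes "a \<noteq> 0" "b \<noteq> 0" "a \<noteq> b"
  shows "elementary_2_subgroup (kummer_image rat_class a b)"
  using place_curve.elementary_2_subgroup_kummer_image[OF place.place_curve[OF place_Qp assms]] .

end

section \<open>Odd primes\<close>

lemma card_UNIV_bit: "finite (UNIV :: bit set)" "card (UNIV :: bit set) = 2"
proof -
  have UNIV: "(UNIV :: bit set) = {0, 1}" using bit_not_zero_iff by blast
  show "finite (UNIV :: bit set)" "card (UNIV :: bit set) = 2" unfolding UNIV by simp_all
qed

definition residue_class :: "nat \<Rightarrow> int \<Rightarrow> bit" where
  "residue_class l m = (if Legendre m (int l) = 1 then 0 else 1)"

lemma Legendre_mult:
  assumes "prime l" "odd l"
  shows "Legendre (m * n) (int l) = Legendre m (int l) * Legendre n (int l)"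
proof -
  have l: "2 < l" using assms prime_ge_2_nat[of l] by (metis le_neq_implies_less even_numeral)
  note euler = euler_criterion[OF assms(1) l]
  have "[Legendre (m * n) (int l) = m ^ ((l - 1) div 2) * n ^ ((l - 1) div 2)] (mod int l)"
    using euler[of "m * n"] by (simp add: power_mult_distrib)
  also have "[m ^ ((l - 1) div 2) * n ^ ((l - 1) div 2) = Legendre m (int l) * Legendre n (int l)] (mod int l)"
    by (intro cong_mult; rule cong_sym; rule euler)
  finally have "int l dvd Legendre (m * n) (int l) - Legendre m (int l) * Legendre n (int l)"
    by (simp add: cong_iff_dvd_diff)
  moreover have "\<bar>Legendre (m * n) (int l) - Legendre m (int l) * Legendre n (int l)\<bar> \<le> 2"
    by (auto simp: Legendre_def)
  ultimately show ?thesis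
    using l zdvd_imp_le[of "int l" "\<bar>Legendre (m * n) (int l) - Legendre m (int l) * Legendre n (int l)\<bar>"]
    by auto
qed

lemma residue_class_cong:
  assumes "int l dvd m - n"
  shows "residue_class l m = residue_class l n"
proof -
  have "[m = n] (mod int l)" using assms by (simp add: cong_iff_dvd_diff)
  then have "[m = 0] (mod int l) \<longleftrightarrow> [n = 0] (mod int l)"
      "\<And>y. [y\<^sup>2 = m] (mod int l) \<longleftrightarrow> [y\<^sup>2 = n] (mod int l)"
    using cong_trans cong_sym by blast+
  then show ?thesis by (simp add: residue_class_def Legendre_def QuadRes_def)
qed

lemma residue_class_eq_0_iff:
  assumes "\<not> int l dvd m"
  shows "residue_class l m = 0 \<longleftrightarrow> (\<exists>s. int l dvd m - s * s)"
proof -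
  have "(\<exists>s. int l dvd m - s * s) \<longleftrightarrow> QuadRes (int l) m"
    unfolding QuadRes_def by (simp add: cong_iff_dvd_diff power2_eq_square dvd_diff_commute)
  moreover have "\<not> [m = 0] (mod int l)" using assms by (simp add: cong_0_iff)
  ultimately show ?thesis by (simp add: residue_class_def Legendre_def)
qed

definition unramified_classes :: "((bit \<times> bit) \<times> (bit \<times> bit)) set" where
  "unramified_classes = ({0} \<times> UNIV) \<times> ({0} \<times> UNIV)"

lemma in_unramified_iff: "g \<in> unramified_classes \<longleftrightarrow> fst (fst g) = 0 \<and> fst (snd g) = 0"
  by (cases g) (auto simp: unramified_classes_def)

lemma card_unramified: "finite unramified_classes" "card unramified_classes = 4"
  using card_UNIV_bit by (simp_all add: unramified_classes_def)

text \<open>The Kummer image at a prime of multiplicative reduction; h is the class of the unit b.\<close>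
definition multiplicative_image :: "bit \<Rightarrow> ((bit \<times> bit) \<times> (bit \<times> bit)) set" where
  "multiplicative_image h = {((0, 0), (0, 0)), ((0, 1), (0, 1)), ((1, h), (1, 0)), ((1, h + 1), (1, 1))}"

lemma card_multiplicative_image:
  "finite (multiplicative_image h)" "card (multiplicative_image h) = 4"
  by (simp_all add: multiplicative_image_def)

lemma card_multiplicative_image_Int:
  "card (multiplicative_image h \<inter> multiplicative_image (h + 1)) = 2"
proof -
  have "multiplicative_image h \<inter> multiplicative_image (h + 1) = {((0, 0), (0, 0)), ((0, 1), (0, 1))}"
    by (cases h) (auto simp: multiplicative_image_def)
  then show ?thesis by simp
qed

lemma in_multiplicative_image_unramified: "fst x = 0 \<Longrightarrow> (x, x) \<in> multiplicative_image h"
  by (cases x; cases "snd x") (auto simp: multiplicative_image_def)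

lemma in_multiplicative_image_ramified: "fst x = 1 \<Longrightarrow> (x, x + (0, h)) \<in> multiplicative_image h"
  by (cases x; cases "snd x"; cases h) (auto simp: multiplicative_image_def)

lemma multiplicative_image_subset:
  assumes "elementary_2_subgroup J" "((0, 1), (0, 1)) \<in> J" "((1, t + h), (1, t)) \<in> J"
  shows "multiplicative_image h \<subseteq> J"
proof -
  have "((1, t + h), (1, t)) + ((0, 1), (0, 1)) \<in> J" using assms by (simp only: elementary_2_subgroup_def)
  then have "((1, t + h + 1), (1, t + 1)) \<in> J" by simp
  then show ?thesis
    using assms by (cases t; cases h) (auto simp: elementary_2_subgroup_def multiplicative_image_def zero_prod_def)
qed

locale odd_place = prime_place +
  assumes l_odd: "odd l"
begin

lemma residue_class_mult:
  "\<not> int l dvd m \<Longrightarrow> \<not> int l dvd n \<Longrightarrow> residue_class l (m * n) = residue_class l m + residue_class l n"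
  using Legendre_mult[OF l_prime l_odd, of m n] by (auto simp: residue_class_def Legendre_def cong_0_iff)

sublocale hensel_place l 1 "residue_class l"
  by unfold_locales
    (use l_odd residue_class_mult residue_class_eq_0_iff in \<open>auto intro: residue_class_cong\<close>)

lemma val_ge_1_of_int_iff: "val_ge l 1 (of_int k) \<longleftrightarrow> int l dvd k"
  using val_ge_of_int_iff[of 1 k] by simp

abbreviation residue_field :: "int ring" where
  "residue_field \<equiv> residue_ring (int l)"

sublocale residue: residues_prime l residue_field
  by unfold_locales (rule l_prime)

lemma residue_class_mod [simp]: "residue_class l (x mod int l) = residue_class l x"
  by (rule residue_class_cong) (simp add: mod_eq_dvd_iff[symmetric])

lemma in_residue_field_iff: "x \<in> carrier residue_field \<longleftrightarrow> x = x mod int l"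
proof
  assume reduced: "x = x mod int l"
  have "0 \<le> x" "x < int l" by (subst reduced, simp)+
  then show "x \<in> carrier residue_field" by (simp add: residue.res_carrier_eq)
qed (simp add: residue.res_carrier_eq)

lemma square_class_field_residue: "square_class_field residue_field (residue_class l)"
proof -
  have l: "2 < int l" using l_odd prime_ge_2_nat[OF l_prime] by (cases "l = 2") auto
  have unit: "\<not> int l dvd x" if "x \<in> carrier residue_field" "x \<noteq> \<zero>\<^bsub>residue_field\<^esub>" for x
    using that zdvd_not_zless[of x "int l"] by (auto simp: residue.res_carrier_eq residue.res_zero_eq)
  interpret residue_field: field residue_field by (rule residue.is_field)
  show ?thesis
  proof
    show "\<one>\<^bsub>residue_field\<^esub> \<oplus>\<^bsub>residue_field\<^esub> \<one>\<^bsub>residue_field\<^esub> \<noteq> \<zero>\<^bsub>residue_field\<^esub>"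
      using l by (simp add: residue.res_add_eq residue.res_one_eq residue.res_zero_eq)
    show "residue_class l (x \<otimes>\<^bsub>residue_field\<^esub> y) = residue_class l x + residue_class l y"
      if "x \<in> carrier residue_field" "y \<in> carrier residue_field" "x \<noteq> \<zero>\<^bsub>residue_field\<^esub>" "y \<noteq> \<zero>\<^bsub>residue_field\<^esub>" for x y
      using that unit residue_class_mult by (simp add: residue.res_mult_eq)
    show "residue_class l x = 0 \<longleftrightarrow> (\<exists>s\<in>carrier residue_field. s \<otimes>\<^bsub>residue_field\<^esub> s = x)"
      if x: "x \<in> carrier residue_field" "x \<noteq> \<zero>\<^bsub>residue_field\<^esub>" for x
    proof -
      have "residue_class l x = 0 \<longleftrightarrow> (\<exists>s. int l dvd x - s * s)"
        using unit[OF x] by (rule residue_class_eq_0_iff)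
      also have "\<dots> \<longleftrightarrow> (\<exists>s\<in>carrier residue_field. s \<otimes>\<^bsub>residue_field\<^esub> s = x)"
      proof
        assume "\<exists>s. int l dvd x - s * s"
        then obtain s where "x mod int l = (s * s) mod int l" by (auto simp: mod_eq_dvd_iff)
        then have "(s mod int l) \<otimes>\<^bsub>residue_field\<^esub> (s mod int l) = x"
          using x in_residue_field_iff by (simp add: residue.mult_cong)
        then show "\<exists>s\<in>carrier residue_field. s \<otimes>\<^bsub>residue_field\<^esub> s = x" by blast
      next
        assume "\<exists>s\<in>carrier residue_field. s \<otimes>\<^bsub>residue_field\<^esub> s = x"
        then obtain s where "(s * s) mod int l = x" by (auto simp: residue.res_mult_eq)
        then show "\<exists>s. int l dvd x - s * s" by (metis mod_eq_dvd_iff mod_mod_trivial)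
      qed
      finally show ?thesis .
    qed
  qed
qed

end

locale good_reduction = odd_place +
  fixes a b :: int
  assumes good: "\<not> int l dvd a" "\<not> int l dvd b" "\<not> int l dvd a - b"
begin

sublocale reduced: elliptic_curve residue_field "residue_class l" "a mod int l" "b mod int l"
proof -
  interpret square_class_field residue_field "residue_class l" by (rule square_class_field_residue)
  show "elliptic_curve residue_field (residue_class l) (a mod int l) (b mod int l)"
    by unfold_locales (use good in \<open>auto simp: residue.res_zero_eq mod_eq_dvd_iff mod_eq_0_iff_dvd\<close>)
qed

lemma nonzero: "a \<noteq> 0" "b \<noteq> 0" "a \<noteq> b"
  using good by auto

lemma not_dvd_diff: "\<not> int l dvd b - a"
  using good(3) by (simp add: dvd_diff_commute)

lemma reduced_root_class:
  "reduced.root_class (w mod int l) (x mod int l) = residue_class l (if int l dvd x then w else x)"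
  by (simp add: reduced.root_class_def residue.res_zero_eq mod_eq_0_iff_dvd)

lemma reduced_kummer:
  assumes "x \<in> carrier residue_field"
  shows "reduced.kummer (Some (x, y)) =
    (residue_class l (if int l dvd x then a * b else x),
     residue_class l (if int l dvd x + a then - a * (b - a) else x + a))"
proof -
  have x: "x mod int l = x" using assms in_residue_field_iff by simp
  have "a mod int l \<otimes>\<^bsub>residue_field\<^esub> (b mod int l) = (a * b) mod int l"
    by (rule residue.mult_cong)
  moreover have "\<ominus>\<^bsub>residue_field\<^esub> (a mod int l) \<otimes>\<^bsub>residue_field\<^esub> (b mod int l \<ominus>\<^bsub>residue_field\<^esub> a mod int l)
      = (- a * (b - a)) mod int l"
    unfolding a_minus_def residue.neg_cong residue.add_cong residue.mult_cong by simp
  moreover have "x \<oplus>\<^bsub>residue_field\<^esub> (a mod int l) = (x + a) mod int l"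
    using residue.add_cong[of x a] x by simp
  ultimately show ?thesis
    unfolding reduced.kummer_def using reduced_root_class[of "a * b" x] reduced_root_class x
    by (simp del: residue.l_minus)
qed

lemma reduced_kummer_surjective: "reduced.kummer ` reduced.E = UNIV"
proof -
  have "4 \<le> card (reduced.kummer ` reduced.E)" by (rule reduced.card_kummer_image_ge_4) simp
  moreover have UNIV: "finite (UNIV :: (bit \<times> bit) set)" "card (UNIV :: (bit \<times> bit) set) = 4"
    using card_UNIV_bit by (simp_all flip: UNIV_Times_UNIV add: card_cartesian_product)
  ultimately show ?thesis using card_seteq[OF UNIV(1), of "reduced.kummer ` reduced.E"] by simp
qed

lemma reduced_generic_class_in_kummer_image:
  assumes P: "Some (x, y) \<in> reduced.E"
    and generic: "\<not> int l dvd x" "\<not> int l dvd x + a" "\<not> int l dvd x + b"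
  shows "((0, residue_class l x), (0, residue_class l (x + a))) \<in> kummer_image rat_class (of_int a) (of_int b)"
proof -
  note unit = generic[THEN rat_class_unit]
  have x: "x \<in> carrier residue_field" using P by (simp add: reduced.Some_in_E_iff)
  have "x \<oplus>\<^bsub>residue_field\<^esub> (a mod int l) = (x + a) mod int l" "x \<oplus>\<^bsub>residue_field\<^esub> (b mod int l) = (x + b) mod int l"
    using residue.add_cong[of x a] residue.add_cong[of x b] x in_residue_field_iff by metis+
  moreover have "x \<noteq> 0" using generic by auto
  ultimately have "residue_class l x + residue_class l (x + a) + residue_class l (x + b) = 0"
    using reduced.root_classes_sum[OF P] generic x in_residue_field_iff reduced_root_class
    by (simp add: reduced.root_class_def residue.res_zero_eq mod_eq_0_iff_dvd)
  then have "rat_class (of_int x) + rat_class (of_int (x + a)) + rat_class (of_int (x + b)) = 0"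
    using unit by (simp add: zero_prod_def)
  moreover have "(of_int x :: rat) \<noteq> 0" "(of_int (x + a) :: rat) \<noteq> 0" "(of_int (x + b) :: rat) \<noteq> 0"
    using generic by (metis dvd_0_right of_int_eq_0_iff)+
  ultimately have "(rat_class (of_int x), rat_class (of_int (x + a))) \<in> kummer_image rat_class (of_int a) (of_int b)"
    using generic_in_kummer_image[of "of_int x" "of_int a" "of_int b" rat_class] by simp
  then show ?thesis by (simp only: unit)
qed

lemma reduced_class_in_kummer_image:
  assumes P: "Some (x, y) \<in> reduced.E" and rs: "reduced.kummer (Some (x, y)) = (r, s)"
  shows "((0, r), (0, s)) \<in> kummer_image rat_class (of_int a) (of_int b)"
proof -
  have x: "x \<in> carrier residue_field" using P by (simp add: reduced.Some_in_E_iff)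
  note unit = rat_class_unit
  consider (zero) "int l dvd x" | (root_a) "int l dvd x + a" | (root_b) "int l dvd x + b"
    | (generic) "\<not> int l dvd x" "\<not> int l dvd x + a" "\<not> int l dvd x + b" by blast
  then show ?thesis
  proof cases
    case zero
    then have "\<not> int l dvd x + a" using good(1) by (simp add: dvd_add_right_iff)
    moreover have "residue_class l (x + a) = residue_class l a" using zero by (intro residue_class_cong) simp
    ultimately have "r = residue_class l (a * b)" "s = residue_class l a"
      using zero rs reduced_kummer[OF x] by simp_all
    then show ?thesis
      using torsion_in_kummer_image(2)[of rat_class "of_int a" "of_int b"] unit[of "a * b"] unit[of a]
        good dvd_mult_iff by simp
  next
    case root_a
    then have "\<not> int l dvd x" using good(1) by (metis dvd_add_right_iff)
    moreover have "residue_class l x = residue_class l (- a)" using root_a by (intro residue_class_cong) simp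
    ultimately have "r = residue_class l (- a)" "s = residue_class l (- a * (b - a))"
      using root_a rs reduced_kummer[OF x] by simp_all
    then show ?thesis
      using torsion_in_kummer_image(3)[of rat_class "of_int a" "of_int b"] unit[of "- a"] unit[of "- a * (b - a)"]
        good not_dvd_diff dvd_mult_iff[of "- a" "b - a"] by simp
  next
    case root_b
    then have "\<not> int l dvd x" using good(2) by (metis dvd_add_right_iff)
    moreover have close: "int l dvd (x + a) - (a - b)" using root_b by simp
    then have "\<not> int l dvd x + a" using good(3) by (metis dvd_diff_right_iff dvd_diff_commute)
    moreover have "residue_class l x = residue_class l (- b)" using root_b by (intro residue_class_cong) simp
    ultimately have "r = residue_class l (- b)" "s = residue_class l (a - b)"
      using rs reduced_kummer[OF x] residue_class_cong[OF close] by simp_all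
    then show ?thesis
      using torsion_in_kummer_image(4)[of rat_class "of_int b" "of_int a"] unit[of "- b"] unit[of "a - b"] good
      by simp
  next
    case generic
    then show ?thesis
      using reduced_generic_class_in_kummer_image[OF P] rs reduced_kummer[OF x] by simp
  qed
qed

lemma unramified_subset_kummer_image: "unramified_classes \<subseteq> kummer_image rat_class (of_int a) (of_int b)"
proof
  fix g assume "g \<in> unramified_classes"
  then obtain r s where g: "g = ((0, r), (0, s))" by (auto simp: unramified_classes_def)
  have "(r, s) \<in> reduced.kummer ` reduced.E" using reduced_kummer_surjective by simp
  then obtain P where P: "P \<in> reduced.E" "reduced.kummer P = (r, s)" by auto
  show "g \<in> kummer_image rat_class (of_int a) (of_int b)"
  proof (cases P)
    case None
    then have "g = (0, 0)" using P by (simp add: g reduced.kummer_def zero_prod_def)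
    then show ?thesis using torsion_in_kummer_image(1) by simp
  next
    case (Some p)
    then show ?thesis using reduced_class_in_kummer_image P unfolding g by (cases p) auto
  qed
qed

end

lemma log_2_4: "log 2 (4 :: real) = 2"
  using log_pow_cancel[of 2 2] by simp

context odd_place
begin

lemma rat_class_add_integer:
  assumes "x \<noteq> 0" "padic_val_rat l x < 0"
  shows "rat_class (x + of_int k) = rat_class x"
  by (rule rat_class_add_small) (use assms val_ge_mono[OF val_ge_of_int] in auto)

lemma fst_rat_class_integral:
  assumes "val_ge l 0 x" "\<not> val_ge l 1 x"
  shows "fst (rat_class x) = 0"
proof -
  have "x \<noteq> 0" "padic_val_rat l x = 0" using assms by (auto simp: val_ge_def)
  then show ?thesis by (simp add: fst_rat_class)
qed

end

context good_reduction
begin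

lemma generic_class_unramified:
  assumes x: "x \<noteq> 0" "x + of_int a \<noteq> 0" "x + of_int b \<noteq> 0"
    and sum: "rat_class x + rat_class (x + of_int a) + rat_class (x + of_int b) = 0"
  shows "fst (rat_class x) = 0 \<and> fst (rat_class (x + of_int a)) = 0"
proof (cases "padic_val_rat l x < 0")
  case True
  then have same: "rat_class (x + of_int a) = rat_class x" "rat_class (x + of_int b) = rat_class x"
    using rat_class_add_integer x by simp_all
  then have "rat_class x = 0" using sum rat_class_triple[OF x(1)] by (simp only:)
  then show ?thesis using same by simp
next
  case False
  then have integral: "val_ge l 0 x" "val_ge l 0 (x + of_int a)" "val_ge l 0 (x + of_int b)"
    using val_ge_add[OF _ val_ge_of_int] by (simp_all add: val_ge_def)
  have "\<not> (val_ge l 1 x \<and> val_ge l 1 (x + of_int a))"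
    using val_ge_diff[of 1 "x + of_int a" x] good(1) by (auto simp: val_ge_1_of_int_iff)
  moreover have "\<not> (val_ge l 1 x \<and> val_ge l 1 (x + of_int b))"
    using val_ge_diff[of 1 "x + of_int b" x] good(2) by (auto simp: val_ge_1_of_int_iff)
  moreover have "\<not> (val_ge l 1 (x + of_int a) \<and> val_ge l 1 (x + of_int b))"
    using val_ge_diff[of 1 "x + of_int a" "x + of_int b"] good(3) val_ge_1_of_int_iff[of "a - b"] by auto
  moreover have "fst (rat_class x) + fst (rat_class (x + of_int a)) + fst (rat_class (x + of_int b)) = 0"
    using arg_cong[OF sum, of fst] by simp
  ultimately show ?thesis using integral[THEN fst_rat_class_integral] by auto
qed

theorem kummer_image_good: "kummer_image rat_class (of_int a) (of_int b) = unramified_classes"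
proof (rule antisym[OF _ unramified_subset_kummer_image], rule subsetI)
  fix g assume "g \<in> kummer_image rat_class (of_int a) (of_int b)"
  then show "g \<in> unramified_classes"
  proof (cases rule: kummer_image_cases)
    case infinity
    then show ?thesis by (simp add: in_unramified_iff)
  next
    case zero
    then show ?thesis
      using rat_class_unit[of "a * b"] rat_class_unit[of a] good dvd_mult_iff by (simp add: in_unramified_iff)
  next
    case root_a
    then show ?thesis
      using rat_class_unit[of "- a"] rat_class_unit[of "- a * (b - a)"] good not_dvd_diff
        dvd_mult_iff[of "- a" "b - a"] by (simp add: in_unramified_iff)
  next
    case root_b
    then show ?thesis
      using rat_class_unit[of "- b"] rat_class_unit[of "a - b"] good by (simp add: in_unramified_iff)
  next
    case (generic x)
    then show ?thesis using generic_class_unramified by (simp add: in_unramified_iff)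
  qed
qed

theorem local_delta_good:
  assumes d: "\<not> int l dvd d"
  shows "local_delta (Qp l) (Qp_of_int l) (a + b) (a * b) d = 0"
proof -
  interpret twist: good_reduction l "d * a" "d * b"
    by unfold_locales (use good d dvd_mult_iff in \<open>auto simp flip: right_diff_distrib\<close>)
  have "elementary_2_subgroup unramified_classes"
    using elementary_2_subgroup_kummer_image[of "of_int a" "of_int b"] nonzero by (simp add: kummer_image_good)
  then have "coset_count unramified_classes unramified_classes * card unramified_classes = card unramified_classes"
    using coset_count_times_card_Int[of unramified_classes unramified_classes] card_unramified by simp
  then have "coset_count unramified_classes unramified_classes = 1" by (simp add: card_unramified)
  moreover have "d \<noteq> 0" using d by auto
  ultimately show ?thesis
    using local_delta_Qp[OF nonzero] twist.kummer_image_good by (simp add: kummer_image_good)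
qed

lemma fst_rat_class_ramified:
  assumes "\<not> int l dvd d'" "\<not> int l dvd k"
  shows "padic_val_rat l (of_int (int l * d' * k)) = 1" "fst (rat_class (of_int (int l * d' * k))) = 1"
proof -
  show val: "padic_val_rat l (of_int (int l * d' * k)) = 1"
    using val_of_int_uniformizer[of "d' * k"] assms dvd_mult_iff by (simp add: mult.assoc)
  have "(of_int (int l * d' * k) :: rat) \<noteq> 0" using assms by auto
  then show "fst (rat_class (of_int (int l * d' * k))) = 1" using val fst_rat_class by (simp del: of_int_mult)
qed

lemma generic_class_of_ramified_twist:
  assumes d: "\<not> int l dvd d'" "d = int l * d'"
    and x: "x \<noteq> 0" "x + of_int (d * a) \<noteq> 0"
    and sum: "rat_class x + rat_class (x + of_int (d * a)) + rat_class (x + of_int (d * b)) = 0"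
    and unramified: "fst (rat_class x) = 0" "fst (rat_class (x + of_int (d * a))) = 0"
  shows "rat_class x = 0 \<and> rat_class (x + of_int (d * a)) = 0"
proof -
  have val: "padic_val_rat l (of_int (d * a)) = 1" "padic_val_rat l (of_int (d * b)) = 1"
    using fst_rat_class_ramified(1)[OF d(1)] good by (simp_all add: d(2))
  have even: "even (padic_val_rat l x)" "even (padic_val_rat l (x + of_int (d * a)))"
    using unramified x fst_rat_class_eq_0_iff by blast+
  have "padic_val_rat l x \<le> 0"
  proof (rule ccontr)
    assume "\<not> padic_val_rat l x \<le> 0"
    then have "val_ge l 2 x" using even(1) by (cases "padic_val_rat l x = 1") (auto simp: val_ge_def)
    moreover have "(of_int (d * a) :: rat) \<noteq> 0" using d good by auto
    ultimately have "padic_val_rat l (of_int (d * a) + x) = 1"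
      using val_add_larger(2)[of "of_int (d * a)" x] val by simp
    then show False using even(2) by (simp add: add.commute)
  qed
  then have same: "rat_class (x + of_int (d * a)) = rat_class x" "rat_class (x + of_int (d * b)) = rat_class x"
    using rat_class_add_small(2)[OF x(1)] val by (simp_all add: val_ge_def)
  then have "rat_class x = 0" using rat_class_triple[OF x(1)] sum by (simp only:)
  then show ?thesis using same by simp
qed

lemma ramified_twist_Int_unramified:
  assumes d: "\<not> int l dvd d'" "d = int l * d'"
  shows "unramified_classes \<inter> kummer_image rat_class (of_int (d * a)) (of_int (d * b)) = {0}"
proof -
  have ramified: "fst (rat_class (of_int (d * k))) = 1" if "\<not> int l dvd k" for k
    using fst_rat_class_ramified(2)[OF d(1) that] d(2) by simp
  have "g = 0" if "g \<in> kummer_image rat_class (of_int (d * a)) (of_int (d * b))" "g \<in> unramified_classes" for g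
    using that
  proof (cases rule: kummer_image_cases)
    case infinity
    then show ?thesis by (simp add: zero_prod_def)
  next
    case zero
    then show ?thesis using that ramified[of a] good by (simp add: in_unramified_iff)
  next
    case root_a
    then show ?thesis using that ramified[of "- a"] good by (simp add: in_unramified_iff)
  next
    case root_b
    then show ?thesis using that ramified[of "- b"] good by (simp add: in_unramified_iff)
  next
    case (generic x)
    then have "fst (rat_class x) = 0" "fst (rat_class (x + of_int (d * a))) = 0"
      using that by (simp_all add: in_unramified_iff)
    then show ?thesis using generic_class_of_ramified_twist[OF d generic(1,2,4)] generic(5) by (simp add: zero_prod_def)
  qed
  moreover have "0 \<in> unramified_classes" by (simp add: in_unramified_iff)
  moreover have "0 \<in> kummer_image rat_class (of_int (d * a)) (of_int (d * b))"
    using torsion_in_kummer_image(1)[of rat_class "of_int (d * a)" "of_int (d * b)"]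
    by (simp add: zero_prod_def)
  ultimately show ?thesis by blast
qed

theorem local_delta_ramified:
  assumes d: "\<not> int l dvd d'" "d = int l * d'"
  shows "local_delta (Qp l) (Qp_of_int l) (a + b) (a * b) d = 2"
proof -
  define J where "J = kummer_image rat_class (of_int (d * a)) (of_int (d * b))"
  have d_nonzero: "d \<noteq> 0" using d by auto
  have "elementary_2_subgroup unramified_classes" "elementary_2_subgroup J"
    using elementary_2_subgroup_kummer_image[of "of_int a" "of_int b"]
      elementary_2_subgroup_kummer_image[of "of_int (d * a)" "of_int (d * b)"] nonzero d_nonzero
    by (simp_all add: kummer_image_good J_def)
  then have "coset_count unramified_classes J * card (unramified_classes \<inter> J) = card unramified_classes"
    using card_unramified by (intro coset_count_times_card_Int)
  then have "coset_count unramified_classes J = 4"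
    unfolding J_def ramified_twist_Int_unramified[OF d] by (simp add: card_unramified)
  moreover have "rat_class (of_int d) \<noteq> 0"
    using fst_rat_class_ramified(2)[OF d(1) not_dvd_1] by (auto simp: d(2))
  ultimately show ?thesis
    using local_delta_Qp[OF nonzero d_nonzero] by (simp add: kummer_image_good J_def log_2_4)
qed

end

context odd_place
begin

lemma exists_nonresidue: "\<exists>e. \<not> int l dvd e \<and> residue_class l e = 1"
proof (rule ccontr)
  assume none: "\<nexists>e. \<not> int l dvd e \<and> residue_class l e = 1"
  define sq where "sq x = x * x mod int l" for x
  have "{0..<int l} \<subseteq> sq ` {0..<int l}"
  proof
    fix e assume e: "e \<in> {0..<int l}"
    show "e \<in> sq ` {0..<int l}"
    proof (cases "int l dvd e")
      case True
      then have "e = sq 0" using e zdvd_not_zless[of e "int l"] by (cases "e = 0") (auto simp: sq_def)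
      then show ?thesis by auto
    next
      case False
      then obtain s where "int l dvd e - s * s" using none residue_class_eq_0_iff bit_not_one_iff by metis
      then have "e = sq (s mod int l)" using e by (simp add: sq_def mod_mult_eq flip: mod_eq_dvd_iff)
      then show ?thesis by auto
    qed
  qed
  then have inj: "inj_on sq {0..<int l}" by (rule finite_surj_inj[rotated]) simp
  have "2 < l" using l_odd prime_ge_2_nat[OF l_prime] by (cases "l = 2") auto
  moreover have "sq (int l - 1) = (- 1) * (- 1) mod int l"
    unfolding sq_def by (rule mod_mult_cong) (simp_all add: mod_eq_dvd_iff)
  then have "sq (int l - 1) = sq 1" by (simp add: sq_def)
  ultimately show False using inj_onD[OF inj, of "int l - 1" 1] by simp
qed

lemma shift_invariant_residues:
  assumes b: "\<not> int l dvd b"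
    and cong: "\<And>z w. int l dvd w - z \<Longrightarrow> P z \<Longrightarrow> P w" and shift: "\<And>z. P z \<Longrightarrow> P (z - b)" and zero: "P 0"
  shows "P e"
proof -
  have multiples: "P (- (int k * b))" for k
  proof (induction k)
    case (Suc k)
    moreover have "- (int (Suc k) * b) = - (int k * b) - b" by (simp add: algebra_simps)
    ultimately show ?case using shift by metis
  qed (simp add: zero)
  have "coprime b (int l)" using prime_imp_coprime[OF int_l_prime b] by (simp add: coprime_commute)
  then obtain y where y: "[b * y = 1] (mod int l)" using cong_solve_coprime_int by blast
  define k where "k = nat ((y * (- e)) mod int l)"
  have "[b * int k = b * (y * (- e))] (mod int l)" by (rule cong_scalar_left) (simp add: k_def cong_def)
  also have "[b * (y * (- e)) = - e] (mod int l)" using cong_scalar_right[OF y, of "- e"] by (simp add: mult.assoc)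
  finally have "int l dvd e - (- (int k * b))" by (simp add: cong_iff_dvd_diff algebra_simps)
  then show ?thesis using multiples cong by blast
qed

text \<open>Otherwise the squares modulo l would be stable under translation by -b.\<close>
lemma exists_nonresidue_shift:
  assumes b: "\<not> int l dvd b"
  shows "\<exists>s. \<not> int l dvd s * s - b \<and> residue_class l (s * s - b) = 1"
proof (rule ccontr)
  assume none: "\<nexists>s. \<not> int l dvd s * s - b \<and> residue_class l (s * s - b) = 1"
  define is_sq where "is_sq z \<longleftrightarrow> (\<exists>s. int l dvd z - s * s)" for z
  have cong: "is_sq w" if close: "int l dvd w - z" and "is_sq z" for w z
  proof -
    obtain s where "int l dvd z - s * s" using \<open>is_sq z\<close> by (auto simp: is_sq_def)
    then have "int l dvd (w - z) + (z - s * s)" using close by (intro dvd_add)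
    then show ?thesis by (auto simp: is_sq_def)
  qed
  have shift: "is_sq (s * s - b)" for s
  proof (cases "int l dvd s * s - b")
    case True
    then show ?thesis unfolding is_sq_def by (intro exI[of _ 0]) simp
  next
    case False
    then have "residue_class l (s * s - b) = 0" using none bit_not_one_iff by blast
    then show ?thesis using residue_class_eq_0_iff[OF False] by (simp add: is_sq_def)
  qed
  have "is_sq (z - b)" if "int l dvd z - s * s" for z s
    by (rule cong[OF _ shift[of s]]) (use that in simp)
  then have translate: "is_sq (z - b)" if "is_sq z" for z using that unfolding is_sq_def[of z] by blast
  have zero: "is_sq 0" unfolding is_sq_def by (intro exI[of _ 0]) simp
  obtain e where e: "\<not> int l dvd e" "residue_class l e = 1" using exists_nonresidue by blast
  have "is_sq e" by (rule shift_invariant_residues[OF b, of is_sq]; fact cong translate zero)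
  then show False using e residue_class_eq_0_iff[OF e(1)] by (simp add: is_sq_def)
qed

end

locale multiplicative_reduction = odd_place +
  fixes a a' b :: int
  assumes a: "a = int l * a'" "\<not> int l dvd a'" and b: "\<not> int l dvd b"
begin

abbreviation h :: bit where
  "h \<equiv> residue_class l b"

lemma nonzero: "a \<noteq> 0" "b \<noteq> 0" "a \<noteq> b"
  using a b by auto

lemma val_root: "padic_val_rat l (of_int a) = 1" "padic_val_rat l (of_int (- a)) = 1"
  using val_of_int_uniformizer[of a'] val_of_int_uniformizer[of "- a'"] a by (simp_all add: a(1))

lemma fst_rat_class_root: "fst (rat_class (of_int a)) = 1" "fst (rat_class (- of_int a)) = 1"
  using fst_rat_class[of "of_int a"] fst_rat_class[of "- of_int a"] val_root nonzero by simp_all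

lemma rat_class_unit_root: "rat_class (of_int b) = (0, h)"
  by (rule rat_class_unit[OF b])

lemma rat_class_diff: "rat_class (of_int b - of_int a) = (0, h)"
proof -
  have close: "int l dvd (b - a) - b" using a by simp
  then have "\<not> int l dvd b - a" using b by (metis dvd_diff_right_iff)
  then show ?thesis using rat_class_unit[of "b - a"] residue_class_cong[OF close] by simp
qed

lemma rat_class_add_root:
  assumes "x \<noteq> 0" "padic_val_rat l x \<le> 0"
  shows "x + of_int a \<noteq> 0" "rat_class (x + of_int a) = rat_class x"
proof -
  have "val_ge l (padic_val_rat l x + int 1) (of_int a)" using assms val_root by (simp add: val_ge_def)
  then show "x + of_int a \<noteq> 0" "rat_class (x + of_int a) = rat_class x"
    using rat_class_add_small[OF assms(1)] by blast+
qed

lemma root_b_class: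
  "rat_class (- of_int b) = (0, residue_class l (- b))"
  "rat_class (of_int a - of_int b) = (0, residue_class l (- b))"
proof -
  show unit: "rat_class (- of_int b) = (0, residue_class l (- b))"
    using rat_class_unit[of "- b"] b by simp
  have "padic_val_rat l (- of_int b) = 0" using val_of_int_unit[of "- b"] b by simp
  then show "rat_class (of_int a - of_int b) = (0, residue_class l (- b))"
    using rat_class_add_root(2)[of "- of_int b"] nonzero unit by simp
qed

lemma add_class_twice: "g + (0, h) + (0, h) = g" for g :: "bit \<times> bit"
  by (simp add: add.assoc zero_prod_def[symmetric])

lemma generic_class_integral:
  assumes x: "x \<noteq> 0" "x + of_int a \<noteq> 0" "0 < padic_val_rat l x"
    and sum: "rat_class x + rat_class (x + of_int a) + rat_class (x + of_int b) = 0"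
  shows "(rat_class x, rat_class (x + of_int a)) \<in> multiplicative_image h"
proof -
  have "rat_class (of_int b + x) = rat_class (of_int b)"
    using x val_of_int_unit[OF b] nonzero by (intro rat_class_add_small) (auto simp: val_ge_def)
  then have "rat_class x + (rat_class (x + of_int a) + (0, h)) = 0"
    using sum rat_class_unit_root by (simp only: add.assoc add.commute[of x])
  then have "rat_class (x + of_int a) + (0, h) = rat_class x" using rat_class_add_eq_0_iff[OF x(1)] by blast
  then have shift: "rat_class (x + of_int a) = rat_class x + (0, h)" by (metis add_class_twice)
  have "fst (rat_class x) = 1"
  proof (cases "padic_val_rat l x = 1")
    case True
    then show ?thesis using x by (simp add: fst_rat_class)
  next
    case False
    then have "rat_class (of_int a + x) = rat_class (of_int a)"
      using x val_root nonzero by (intro rat_class_add_small) (auto simp: val_ge_def)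
    then have "fst (rat_class x + (0, h)) = 1" using shift fst_rat_class_root(1) by (simp add: add.commute)
    then show ?thesis by simp
  qed
  then show ?thesis unfolding shift by (rule in_multiplicative_image_ramified)
qed

lemma generic_class_multiplicative:
  assumes x: "x \<noteq> 0" "x + of_int a \<noteq> 0" "x + of_int b \<noteq> 0"
    and sum: "rat_class x + rat_class (x + of_int a) + rat_class (x + of_int b) = 0"
  shows "(rat_class x, rat_class (x + of_int a)) \<in> multiplicative_image h"
proof (cases "0 < padic_val_rat l x")
  case True
  then show ?thesis using generic_class_integral x sum by blast
next
  case False
  then have same: "rat_class (x + of_int a) = rat_class x" using rat_class_add_root x by simp
  have "fst (rat_class x) = 0"
  proof (cases "padic_val_rat l x = 0")
    case True
    then show ?thesis using x by (simp add: fst_rat_class)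
  next
    case nonzero: False
    then have "rat_class (x + of_int b) = rat_class x" using rat_class_add_integer x False by simp
    then have "rat_class x = 0" using rat_class_triple[OF x(1)] sum by (simp only: same)
    then show ?thesis by simp
  qed
  then show ?thesis unfolding same by (rule in_multiplicative_image_unramified)
qed

lemma kummer_image_subset: "kummer_image rat_class (of_int a) (of_int b) \<subseteq> multiplicative_image h"
proof
  fix g assume "g \<in> kummer_image rat_class (of_int a) (of_int b)"
  then show "g \<in> multiplicative_image h"
  proof (cases rule: kummer_image_cases)
    case infinity
    then show ?thesis using in_multiplicative_image_unramified[of 0] by simp
  next
    case zero
    have "rat_class (of_int a * of_int b) = rat_class (of_int a) + (0, h)"
      using rat_class_mult nonzero rat_class_unit_root by simp
    moreover have "(rat_class (of_int a) + (0, h), rat_class (of_int a) + (0, h) + (0, h)) \<in> multiplicative_image h"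
      by (rule in_multiplicative_image_ramified) (simp add: fst_rat_class_root)
    ultimately show ?thesis unfolding zero by (simp only: add_class_twice)
  next
    case root_a
    have "rat_class (- of_int a * (of_int b - of_int a)) = rat_class (- of_int a) + (0, h)"
      using nonzero rat_class_mult[of "- of_int a" "of_int b - of_int a"] rat_class_diff by simp
    then show ?thesis
      using in_multiplicative_image_ramified[OF fst_rat_class_root(2)] unfolding root_a by (simp only:)
  next
    case root_b
    then show ?thesis using in_multiplicative_image_unramified[of "(0, residue_class l (- b))"] root_b_class by simp
  next
    case (generic x)
    then show ?thesis using generic_class_multiplicative by simp
  qed
qed

lemma unramified_class_in_kummer_image: "((0, 1), (0, 1)) \<in> kummer_image rat_class (of_int a) (of_int b)"
proof -
  obtain s where s: "\<not> int l dvd s * s - b" "residue_class l (s * s - b) = 1"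
    using exists_nonresidue_shift[OF b] by blast
  show ?thesis
  proof (cases "int l dvd s")
    case True
    then have "int l dvd (s * s - b) - (- b)" by simp
    then have "residue_class l (- b) = 1" using residue_class_cong s by metis
    then show ?thesis
      using torsion_in_kummer_image(4)[of rat_class "of_int b" "of_int a"] by (simp add: root_b_class)
  next
    case False
    define x :: rat where "x = of_int (s * s - b)"
    have "(of_int (s * s - b) :: rat) \<noteq> 0" using s(1) of_int_eq_0_iff by (metis dvd_0_right)
    then have x: "rat_class x = (0, 1)" "x \<noteq> 0" "padic_val_rat l x = 0"
      unfolding x_def using rat_class_unit[OF s(1)] s(2) val_of_int_unit[OF s(1)] by (simp_all del: of_int_diff)
    then have shift: "x + of_int a \<noteq> 0" "rat_class (x + of_int a) = (0, 1)"
      using rat_class_add_root[of x] by simp_all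
    have "x + of_int b = of_int s * of_int s" by (simp add: x_def)
    moreover have "(of_int s :: rat) \<noteq> 0" using False by auto
    ultimately have "x + of_int b \<noteq> 0" "rat_class (x + of_int b) = 0"
      using rat_class_double[of "of_int s"] by (simp_all add: rat_class_mult)
    then show ?thesis
      using generic_in_kummer_image[of x "of_int a" "of_int b" rat_class] x shift by (simp add: zero_prod_def)
  qed
qed

theorem kummer_image_multiplicative:
  "kummer_image rat_class (of_int a) (of_int b) = multiplicative_image h"
proof (rule antisym[OF kummer_image_subset], rule multiplicative_image_subset)
  show "elementary_2_subgroup (kummer_image rat_class (of_int a) (of_int b))"
    using elementary_2_subgroup_kummer_image nonzero by simp
  show "((0, 1), (0, 1)) \<in> kummer_image rat_class (of_int a) (of_int b)"
    by (rule unramified_class_in_kummer_image)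
  define t where "t = snd (rat_class (of_int a))"
  have t: "rat_class (of_int a) = (1, t)"
    unfolding t_def using fst_rat_class_root(1) by (metis prod.collapse)
  have "rat_class (of_int a * of_int b) = (1, t + h)"
    using rat_class_mult nonzero rat_class_unit_root t by simp
  then show "((1, t + h), (1, t)) \<in> kummer_image rat_class (of_int a) (of_int b)"
    using torsion_in_kummer_image(2)[of rat_class "of_int a" "of_int b"] t by simp
qed

theorem local_delta_multiplicative:
  assumes d: "\<not> int l dvd d"
  shows "local_delta (Qp l) (Qp_of_int l) (a + b) (a * b) d = (if residue_class l d = 0 then 0 else 1)"
proof -
  interpret twist: multiplicative_reduction l "d * a" "d * a'" "d * b"
    by unfold_locales (use a b d dvd_mult_iff in auto)
  have square: "rat_class (of_int d) = 0 \<longleftrightarrow> residue_class l d = 0"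
    using rat_class_unit[OF d] by (simp add: zero_prod_def)
  have twist_h: "twist.h = h + 1" if "residue_class l d \<noteq> 0"
    using that residue_class_mult[OF d b] by (simp add: add.commute)
  have "elementary_2_subgroup (multiplicative_image h)" "elementary_2_subgroup (multiplicative_image twist.h)"
    using elementary_2_subgroup_kummer_image[of "of_int a" "of_int b"] nonzero kummer_image_multiplicative
      elementary_2_subgroup_kummer_image[of "of_int (d * a)" "of_int (d * b)"] twist.nonzero
      twist.kummer_image_multiplicative by simp_all
  then have "coset_count (multiplicative_image h) (multiplicative_image twist.h) = 2" if "residue_class l d \<noteq> 0"
    using coset_count_times_card_Int[of "multiplicative_image h" "multiplicative_image twist.h"]
      card_multiplicative_image card_multiplicative_image_Int by (simp add: twist_h[OF that])
  moreover have "d \<noteq> 0" using d by auto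
  ultimately show ?thesis
    using local_delta_Qp[OF nonzero] twist.kummer_image_multiplicative square by (simp add: kummer_image_multiplicative)
qed

end

section \<open>The prime 2\<close>

lemma odd_mod_8: "odd (m::int) \<Longrightarrow> m mod 8 = 1 \<or> m mod 8 = 3 \<or> m mod 8 = 5 \<or> m mod 8 = 7"
  by presburger

definition class_mod_8 :: "int \<Rightarrow> bit \<times> bit" where
  "class_mod_8 m = (of_bool (m mod 8 = 3 \<or> m mod 8 = 7), of_bool (m mod 8 = 3 \<or> m mod 8 = 5))"

lemma class_mod_8_cong: "[m = n] (mod 8) \<Longrightarrow> class_mod_8 m = class_mod_8 n"
  by (simp add: class_mod_8_def cong_def)

lemma class_mod_8_mult:
  assumes "odd m" "odd n"
  shows "class_mod_8 (m * n) = class_mod_8 m + class_mod_8 n"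
proof -
  have "(m * n) mod 8 = (m mod 8) * (n mod 8) mod 8" by (simp add: mod_mult_eq)
  then show ?thesis
    using odd_mod_8[OF assms(1)] odd_mod_8[OF assms(2)] by (elim disjE) (simp_all add: class_mod_8_def)
qed

lemma class_mod_8_eq_0_iff: "odd m \<Longrightarrow> class_mod_8 m = 0 \<longleftrightarrow> m mod 8 = 1"
  using odd_mod_8[of m] by (auto simp: class_mod_8_def zero_prod_def)

interpretation two: hensel_place 2 3 class_mod_8
proof
  show "class_mod_8 (m * n) = class_mod_8 m + class_mod_8 n" if "\<not> int 2 dvd m" "\<not> int 2 dvd n" for m n
    using class_mod_8_mult that by simp
  show "class_mod_8 m + class_mod_8 m = 0" for m by (simp add: class_mod_8_def zero_prod_def)
  show "class_mod_8 m = class_mod_8 n" if "int 2 ^ 3 dvd m - n" for m n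
    using that by (intro class_mod_8_cong) (simp add: cong_iff_dvd_diff)
  show "\<exists>s. int 2 ^ 3 dvd m - s * s" if "\<not> int 2 dvd m" "class_mod_8 m = 0" for m
    using that class_mod_8_eq_0_iff[of m] by (intro exI[of _ 1]) (simp add: mod_eq_dvd_iff[of m 8 1, symmetric])
qed auto

abbreviation rat_class_2 :: "rat \<Rightarrow> bit \<times> bit \<times> bit" where
  "rat_class_2 \<equiv> two.rat_class"

abbreviation val_2 :: "rat \<Rightarrow> int" where
  "val_2 \<equiv> padic_val_rat 2"

definition class_of_minus_1 :: "bit \<times> bit \<times> bit" where
  "class_of_minus_1 = (0, (1, 0))"

definition class_of_5 :: "bit \<times> bit \<times> bit" where
  "class_of_5 = (0, (0, 1))"

lemma rat_class_2_values: "rat_class_2 (- 1) = class_of_minus_1" "rat_class_2 5 = class_of_5"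
  using two.rat_class_unit[of "- 1"] two.rat_class_unit[of 5]
  by (simp_all add: class_mod_8_def class_of_minus_1_def class_of_5_def)

lemma bit_triple_double [simp]: "g + g = 0" "g + (g + h) = h" for g h :: "bit \<times> bit \<times> bit"
proof -
  show "g + g = 0" by (cases g) (auto simp: zero_prod_def)
  then show "g + (g + h) = h" by (simp flip: add.assoc)
qed

lemma rat_class_2_minus: "x \<noteq> 0 \<Longrightarrow> rat_class_2 (- x) = class_of_minus_1 + rat_class_2 x"
  using two.rat_class_mult[of "- 1" x] by (simp add: rat_class_2_values)

lemma val_2_ge_add_equal_val:
  assumes "x \<noteq> 0" "y \<noteq> 0" "val_2 x = val_2 y"
  shows "val_ge 2 (val_2 x + 1) (x + y)"
proof -
  obtain m n where x: "unit_form 2 x (val_2 x) m n"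
    using two.unit_form_exists[OF assms(1)] two.val_unit_form by metis
  obtain m' n' where y: "unit_form 2 y (val_2 x) m' n'"
    using two.unit_form_exists[OF assms(2)] two.val_unit_form assms(3) by metis
  have "even (m * n' + m' * n)" using x y by (simp add: unit_form_def)
  then obtain k where k: "m * n' + m' * n = 2 * k" by blast
  have "(x + y) * of_int (n * n') = (x * of_int n) * of_int n' + (y * of_int n') * of_int n"
    by (simp add: algebra_simps)
  also have "\<dots> = of_nat 2 powi val_2 x * of_int (m * n' + m' * n)"
    using x y by (simp add: unit_form_def algebra_simps)
  also have "\<dots> = of_nat 2 powi (val_2 x + 1) * of_int k"
    unfolding k by (simp add: power_int_add)
  finally have "(x + y) * of_int (n * n') = of_nat 2 powi (val_2 x + 1) * of_int k" .
  moreover have "\<not> int 2 dvd n * n'" using x y by (simp add: unit_form_def)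
  ultimately show ?thesis unfolding two.val_ge_iff by blast
qed

text \<open>Here y/x is 4 times a unit, and every unit is 1 modulo 2, so that 1 + y/x is 5 modulo 8.\<close>
lemma rat_class_2_add_4_times_unit:
  assumes "x \<noteq> 0" "y \<noteq> 0" "val_2 y = val_2 x + 2"
  shows "rat_class_2 (x + y) = rat_class_2 x + class_of_5"
proof -
  define w where "w = y * inverse x"
  have val_4: "val_2 4 = 2" by (rule two.val_unit_form[of 4 2 1 1]) (simp add: unit_form_def)
  then have val_minus_4: "val_2 (- 4) = 2"
    using two.val_mult[of "- 1" 4] two.val_of_int_unit[of "- 1"] by simp
  have "val_2 w = 2" using assms two.val_mult[of y "inverse x"] two.val_inverse[of x] by (simp add: w_def)
  then have "val_ge 2 (val_2 5 + int 3) (w + (- 4))"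
    using val_2_ge_add_equal_val[of w "- 4"] assms val_minus_4 two.val_of_int_unit[of 5] by (simp add: w_def)
  then have shift: "5 + (w + (- 4)) \<noteq> 0" "rat_class_2 (5 + (w + (- 4))) = class_of_5"
    using two.rat_class_add_small[of 5 "w + (- 4)"] rat_class_2_values by simp_all
  have "x + y = x * (5 + (w + (- 4)))" using assms by (simp add: w_def field_simps)
  then show ?thesis using two.rat_class_mult[OF assms(1) shift(1)] shift(2) by simp
qed

lemma rat_class_2_add:
  assumes "x \<noteq> 0" "y \<noteq> 0" "val_2 x + 2 \<le> val_2 y"
  shows "rat_class_2 (x + y) = rat_class_2 x + (if val_2 y = val_2 x + 2 then class_of_5 else 0)"
proof (cases "val_2 y = val_2 x + 2")
  case True
  then show ?thesis using rat_class_2_add_4_times_unit assms by simp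
next
  case False
  then have "val_ge 2 (val_2 x + int 3) y" using assms by (simp add: val_ge_def)
  then show ?thesis using False two.rat_class_add_small(2)[OF assms(1)] by simp
qed

definition torsion_classes ::
  "bit \<times> bit \<times> bit \<Rightarrow> bit \<times> bit \<times> bit \<Rightarrow> bit \<times> bit \<times> bit \<Rightarrow> ((bit \<times> bit \<times> bit) \<times> (bit \<times> bit \<times> bit)) set"
where
  "torsion_classes \<alpha> \<beta> \<delta> = {(0, 0), (\<alpha> + \<beta>, \<alpha>), (class_of_minus_1 + \<alpha>, class_of_minus_1 + \<alpha> + \<delta>),
     (class_of_minus_1 + \<beta>, class_of_minus_1 + \<delta>)}"

definition two_adic_image ::
  "bit \<times> bit \<times> bit \<Rightarrow> bit \<times> bit \<times> bit \<Rightarrow> bit \<times> bit \<times> bit \<Rightarrow> ((bit \<times> bit \<times> bit) \<times> (bit \<times> bit \<times> bit)) set"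
where
  "two_adic_image \<alpha> \<beta> \<delta> = torsion_classes \<alpha> \<beta> \<delta> \<union> (+) (0, class_of_5) ` torsion_classes \<alpha> \<beta> \<delta>"

lemma in_two_adic_image:
  assumes "(x, y) \<in> torsion_classes \<alpha> \<beta> \<delta>" "e \<in> {0, class_of_5}"
  shows "(x, y + e) \<in> two_adic_image \<alpha> \<beta> \<delta>"
proof -
  have "(0, class_of_5) + (x, y) \<in> two_adic_image \<alpha> \<beta> \<delta>"
    unfolding two_adic_image_def using assms(1) by (intro UnI2 imageI)
  then show ?thesis using assms by (auto simp: two_adic_image_def add.commute)
qed

locale curve_at_2 =
  fixes a b u :: int
  assumes odd: "odd a" "odd b" "odd u" and diff: "b - a = 2 * u"
begin

abbreviation \<alpha> :: "bit \<times> bit \<times> bit" where "\<alpha> \<equiv> rat_class_2 (of_int a)"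
abbreviation \<beta> :: "bit \<times> bit \<times> bit" where "\<beta> \<equiv> rat_class_2 (of_int b)"
abbreviation \<delta> :: "bit \<times> bit \<times> bit" where "\<delta> \<equiv> rat_class_2 (of_int (b - a))"

lemma nonzero: "(of_int a :: rat) \<noteq> 0" "(of_int b :: rat) \<noteq> 0" "(of_int (b - a) :: rat) \<noteq> 0" "a \<noteq> b"
  using odd diff by auto

lemma val_root: "val_2 (of_int a) = 0" "val_2 (- of_int a) = 0" "val_2 (of_int b) = 0"
  using two.val_of_int_unit[of a] two.val_of_int_unit[of "- a"] two.val_of_int_unit[of b] odd by simp_all

lemma val_diff: "val_2 (of_int (b - a)) = 1"
  using two.val_of_int_uniformizer[of u] odd diff by simp

lemma swapped: "curve_at_2 b a (- u)"
  by unfold_locales (use odd diff in auto)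

lemma torsion_values:
  "rat_class_2 (of_int a * of_int b) = \<alpha> + \<beta>" "rat_class_2 (- of_int a) = class_of_minus_1 + \<alpha>"
  "rat_class_2 (- of_int a * (of_int b - of_int a)) = class_of_minus_1 + \<alpha> + \<delta>"
  "rat_class_2 (- of_int b) = class_of_minus_1 + \<beta>"
  "rat_class_2 (of_int a - of_int b) = class_of_minus_1 + \<delta>"
proof -
  show root: "rat_class_2 (- of_int a) = class_of_minus_1 + \<alpha>" "rat_class_2 (- of_int b) = class_of_minus_1 + \<beta>"
    using rat_class_2_minus nonzero by simp_all
  show "rat_class_2 (of_int a * of_int b) = \<alpha> + \<beta>"
      "rat_class_2 (- of_int a * (of_int b - of_int a)) = class_of_minus_1 + \<alpha> + \<delta>"
    using two.rat_class_mult[of "of_int a" "of_int b"] two.rat_class_mult[of "- of_int a" "of_int (b - a)"]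
      nonzero root by simp_all
  show "rat_class_2 (of_int a - of_int b) = class_of_minus_1 + \<delta>"
    using rat_class_2_minus[OF nonzero(3)] by simp
qed

lemma generic_near_infinity:
  assumes x: "x \<noteq> 0" "x + of_int a \<noteq> 0" "x + of_int b \<noteq> 0" "val_2 x < 0"
    and sum: "rat_class_2 x + rat_class_2 (x + of_int a) + rat_class_2 (x + of_int b) = 0"
  shows "(rat_class_2 x, rat_class_2 (x + of_int a)) \<in> two_adic_image \<alpha> \<beta> \<delta>"
proof -
  have "val_2 (x + of_int a) = val_2 x" "val_2 (x + of_int b) = val_2 x"
    using two.val_add_larger(2)[OF x(1)] x(4) val_root by (simp_all add: val_ge_def)
  then have "fst (rat_class_2 x) = 0"
    using arg_cong[OF sum, of fst] x by (simp add: two.fst_rat_class)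
  then have "even (val_2 x)" using two.fst_rat_class_eq_0_iff x by blast
  then have "val_2 x + 2 \<le> 0" using x(4) by presburger
  define e where "e = (if val_2 x = - 2 then class_of_5 else 0)"
  have shift: "rat_class_2 (x + of_int a) = rat_class_2 x + e" "rat_class_2 (x + of_int b) = rat_class_2 x + e"
    using rat_class_2_add[OF x(1)] nonzero val_root \<open>val_2 x + 2 \<le> 0\<close> by (auto simp: e_def)
  then have "rat_class_2 x = 0" using sum by (simp add: ac_simps)
  moreover have "(0, 0 + e) \<in> two_adic_image \<alpha> \<beta> \<delta>"
    by (rule in_two_adic_image) (auto simp: torsion_classes_def e_def)
  ultimately show ?thesis by (simp only: shift)
qed

lemma generic_near_zero:
  assumes x: "x \<noteq> 0" "x + of_int a \<noteq> 0" "x + of_int b \<noteq> 0" "0 < val_2 x"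
    and sum: "rat_class_2 x + rat_class_2 (x + of_int a) + rat_class_2 (x + of_int b) = 0"
  shows "(rat_class_2 x, rat_class_2 (x + of_int a)) \<in> two_adic_image \<alpha> \<beta> \<delta>"
proof -
  have "val_2 (of_int a + x) = 0" "val_2 (of_int b + x) = 0"
    using two.val_add_larger(2)[of "of_int a" x] two.val_add_larger(2)[of "of_int b" x] x(4) val_root nonzero
    by (simp_all add: val_ge_def)
  then have "fst (rat_class_2 x) = 0"
    using arg_cong[OF sum, of fst] x by (simp add: two.fst_rat_class add.commute)
  then have "even (val_2 x)" using two.fst_rat_class_eq_0_iff x by blast
  then have "2 \<le> val_2 x" using x(4) by presburger
  define e where "e = (if val_2 x = 2 then class_of_5 else 0)"
  have shift: "rat_class_2 (x + of_int a) = \<alpha> + e" "rat_class_2 (x + of_int b) = \<beta> + e"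
    using rat_class_2_add[OF nonzero(1) x(1)] rat_class_2_add[OF nonzero(2) x(1)] val_root \<open>2 \<le> val_2 x\<close>
    by (auto simp: e_def add.commute)
  have "rat_class_2 x + (\<alpha> + \<beta>) = 0" using sum unfolding shift by (simp add: ac_simps)
  then have "rat_class_2 x = \<alpha> + \<beta>" using two.rat_class_add_eq_0_iff[OF x(1)] by simp
  moreover have "(\<alpha> + \<beta>, \<alpha> + e) \<in> two_adic_image \<alpha> \<beta> \<delta>"
    by (rule in_two_adic_image) (auto simp: torsion_classes_def e_def)
  ultimately show ?thesis by (simp only: shift)
qed

lemma generic_near_root:
  assumes x: "x \<noteq> 0" "x + of_int a \<noteq> 0" "x + of_int b \<noteq> 0" "val_2 x = 0" "2 \<le> val_2 (x + of_int a)"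
    and sum: "rat_class_2 x + rat_class_2 (x + of_int a) + rat_class_2 (x + of_int b) = 0"
  obtains e where "e \<in> {0, class_of_5}" "rat_class_2 x = class_of_minus_1 + \<alpha>" "rat_class_2 (x + of_int b) = \<delta> + e"
proof
  define y where "y = x + of_int a"
  have y: "y \<noteq> 0" "x = - of_int a + y" "x + of_int b = of_int (b - a) + y"
    using x by (simp_all add: y_def)
  have "val_2 (x + of_int b) = 1"
    unfolding y(3) using two.val_add_larger(2)[OF nonzero(3), of y] x(5) val_diff by (simp add: val_ge_def y_def)
  then have "fst (rat_class_2 y) = 1"
    using arg_cong[OF sum, of fst] x by (simp add: two.fst_rat_class y_def)
  then have "odd (val_2 y)" using two.fst_rat_class_eq_0_iff[OF y(1)] by simp
  then have val_y: "3 \<le> val_2 y" using x(5) unfolding y_def by presburger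
  show "rat_class_2 x = class_of_minus_1 + \<alpha>"
    using rat_class_2_add[of "- of_int a" y] y nonzero val_root val_y torsion_values(2) by simp
  show "rat_class_2 (x + of_int b) = \<delta> + (if val_2 y = 3 then class_of_5 else 0)"
    unfolding y(3) using rat_class_2_add[OF nonzero(3) y(1)] val_diff val_y by simp
qed simp

lemma near_root_cases:
  assumes x: "x \<noteq> 0" "x + of_int a \<noteq> 0" "x + of_int b \<noteq> 0" "val_2 x = 0"
  obtains (near_a) "2 \<le> val_2 (x + of_int a)" | (near_b) "2 \<le> val_2 (x + of_int b)"
proof (cases "2 \<le> val_2 (x + of_int a)")
  case False
  moreover have "val_ge 2 (val_2 x + 1) (x + of_int a)"
    using val_2_ge_add_equal_val[of x "of_int a"] nonzero x val_root by simp
  ultimately have "val_2 (x + of_int a) = 1" using x by (simp add: val_ge_def)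
  then have "val_ge 2 2 (x + of_int a + of_int (b - a))"
    using val_2_ge_add_equal_val[OF x(2) nonzero(3)] val_diff by simp
  then show ?thesis using x that by (simp add: val_ge_def)
qed

lemma generic_unit:
  assumes x: "x \<noteq> 0" "x + of_int a \<noteq> 0" "x + of_int b \<noteq> 0" "val_2 x = 0"
    and sum: "rat_class_2 x + rat_class_2 (x + of_int a) + rat_class_2 (x + of_int b) = 0"
  shows "(rat_class_2 x, rat_class_2 (x + of_int a)) \<in> two_adic_image \<alpha> \<beta> \<delta>"
  using x
proof (cases rule: near_root_cases)
  case near_a
  obtain e where e: "e \<in> {0, class_of_5}" "rat_class_2 x = class_of_minus_1 + \<alpha>" "rat_class_2 (x + of_int b) = \<delta> + e"
    using generic_near_root x near_a sum by blast
  have "rat_class_2 (x + of_int a) + (rat_class_2 x + rat_class_2 (x + of_int b)) = 0"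
    using sum by (simp add: ac_simps)
  then have "rat_class_2 (x + of_int a) = class_of_minus_1 + \<alpha> + \<delta> + e"
    using two.rat_class_add_eq_0_iff[OF x(2)] e by (simp add: add.assoc)
  then show ?thesis using e in_two_adic_image by (simp add: torsion_classes_def)
next
  case near_b
  interpret swapped: curve_at_2 b a "- u" by (rule swapped)
  obtain e where e: "e \<in> {0, class_of_5}" "rat_class_2 x = class_of_minus_1 + \<beta>"
      "rat_class_2 (x + of_int a) = swapped.\<delta> + e"
    using swapped.generic_near_root[of x] x near_b sum by (auto simp: ac_simps)
  moreover have "swapped.\<delta> = class_of_minus_1 + \<delta>" using torsion_values(5) by simp
  ultimately show ?thesis using in_two_adic_image by (simp add: torsion_classes_def)
qed

lemma class_of_5_in_kummer_image: "(0, class_of_5) \<in> kummer_image rat_class_2 (of_int a) (of_int b)"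
proof -
  have form: "unit_form 2 (1 / 4) (- 2) 1 1" by (simp add: unit_form_def power_int_minus)
  have quarter: "val_2 (1 / 4) = - 2" "rat_class_2 (1 / 4) = 0"
    using two.val_unit_form[OF form] two.rat_class_unit_form[OF form]
    by (simp_all add: class_mod_8_def zero_prod_def)
  then have "rat_class_2 (1 / 4 + of_int a) = class_of_5" "rat_class_2 (1 / 4 + of_int b) = class_of_5"
    using rat_class_2_add[of "1 / 4"] nonzero val_root by simp_all
  moreover have "1 / 4 + of_int k \<noteq> (0 :: rat)" if "val_2 (of_int k) = 0" for k
    using two.val_add_larger(1)[of "1 / 4" "of_int k"] that quarter by (simp add: val_ge_def)
  ultimately show ?thesis
    using generic_in_kummer_image[of "1 / 4" "of_int a" "of_int b" rat_class_2] quarter val_root by simp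
qed

theorem kummer_image_two:
  "kummer_image rat_class_2 (of_int a) (of_int b) = two_adic_image \<alpha> \<beta> \<delta>" (is "?J = _")
proof (intro equalityI subsetI)
  fix g assume "g \<in> ?J"
  then show "g \<in> two_adic_image \<alpha> \<beta> \<delta>"
  proof (cases rule: kummer_image_cases)
    case root_a
    then show ?thesis unfolding torsion_values(2,3) by (simp add: two_adic_image_def torsion_classes_def)
  next
    case (generic x)
    then show ?thesis
      using generic_near_infinity generic_near_zero generic_unit by (metis linorder_cases)
  qed (simp_all add: torsion_values two_adic_image_def torsion_classes_def)
next
  have "torsion_classes \<alpha> \<beta> \<delta> \<subseteq> ?J"
    using torsion_in_kummer_image(1-3)[of rat_class_2 "of_int a" "of_int b"]
      torsion_in_kummer_image(4)[of rat_class_2 "of_int b" "of_int a"]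
    unfolding torsion_values torsion_classes_def by blast
  moreover have "elementary_2_subgroup ?J"
    using two.elementary_2_subgroup_kummer_image nonzero by simp
  ultimately show "g \<in> ?J" if "g \<in> two_adic_image \<alpha> \<beta> \<delta>" for g
    using that class_of_5_in_kummer_image unfolding two_adic_image_def elementary_2_subgroup_def by blast
qed

end

text \<open>The image for the curve with roots 0, -cr, -c(r+2).\<close>
definition twin_image :: "int \<Rightarrow> int \<Rightarrow> ((bit \<times> bit \<times> bit) \<times> (bit \<times> bit \<times> bit)) set" where
  "twin_image c r = two_adic_image (0, class_mod_8 (c * r)) (0, class_mod_8 (c * (r + 2))) (1, class_mod_8 c)"

lemma twin_image_cong: "[c = c'] (mod 8) \<Longrightarrow> [r = r'] (mod 8) \<Longrightarrow> twin_image c r = twin_image c' r'"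
  using class_mod_8_cong[of "c * r" "c' * r'"] class_mod_8_cong[of "c * (r + 2)" "c' * (r' + 2)"]
    class_mod_8_cong[of c c'] by (simp add: twin_image_def cong_mult cong_add)

lemma kummer_image_twin:
  assumes c: "odd c" and r: "odd r"
  shows "kummer_image rat_class_2 (of_int (c * r)) (of_int (c * (r + 2))) = twin_image c r"
proof -
  interpret curve_at_2 "c * r" "c * (r + 2)" c by unfold_locales (use assms in \<open>auto simp: algebra_simps\<close>)
  have "rat_class_2 (of_int (2 * c)) = (1, class_mod_8 c)"
    using two.rat_class_unit_form[of "of_int (2 * c)" 1 c 1] c by (simp add: unit_form_def two.chi_1)
  then have "\<delta> = (1, class_mod_8 c)" by (simp only: diff)
  then show ?thesis
    using kummer_image_two two.rat_class_unit[of "c * r"] two.rat_class_unit[of "c * (r + 2)"] odd(1,2)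
    by (simp add: twin_image_def del: of_int_mult of_int_diff)
qed

lemma card_twin_images:
  "\<forall>e\<in>{1, - 1}. \<forall>r\<in>{1, 3, 5, 7}. card (twin_image e r) = 8"
  "\<forall>e\<in>{1, - 1}. \<forall>k\<in>{3, 5, 7}. \<forall>r\<in>{1, 3, 5, 7}. card (twin_image e r \<inter> twin_image (k * e) r) =
    (if k = 5 \<or> (k = 7 \<and> r mod 4 = 3) \<or> (k = 3 \<and> r mod 4 = 1) then 4 else 2)"
  by code_simp+

lemma coset_count_twin_images:
  assumes e: "e \<in> {1, - 1}" and k: "k \<in> {3, 5, 7}" and r: "r \<in> {1, 3, 5, 7}"
  shows "coset_count (twin_image e r) (twin_image (k * e) r) =
    (if k = 5 \<or> (k = 7 \<and> r mod 4 = 3) \<or> (k = 3 \<and> r mod 4 = 1) then 2 else 4)"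
proof -
  have "odd e" "odd (k * e)" "odd r" using e k r by auto
  moreover have "elementary_2_subgroup (twin_image c r)" if "odd c" "odd r" for c
  proof -
    have "r + 2 \<noteq> 0" using that by presburger
    then show ?thesis
      unfolding kummer_image_twin[OF that, symmetric]
      using that by (intro two.elementary_2_subgroup_kummer_image) auto
  qed
  moreover have "finite (twin_image e r)" by (simp add: twin_image_def two_adic_image_def torsion_classes_def)
  ultimately have "coset_count (twin_image e r) (twin_image (k * e) r) *
      card (twin_image e r \<inter> twin_image (k * e) r) = card (twin_image e r)"
    by (intro coset_count_times_card_Int) simp_all
  then show ?thesis
    using card_twin_images(1)[rule_format, OF e r] card_twin_images(2)[rule_format, OF e k r]
    by (auto split: if_splits)
qed

theorem local_delta_two:
  assumes p: "odd p" and e: "e \<in> {1, - 1}" and d: "odd d"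
  shows "local_delta (Qp 2) (Qp_of_int 2) (e * p + e * (p + 2)) (e * p * (e * (p + 2))) d =
    (if d mod 8 = 1 then 0
     else if d mod 8 = 5 \<or> (d mod 8 = 7 \<and> p mod 4 = 3) \<or> (d mod 8 = 3 \<and> p mod 4 = 1) then 1 else 2)"
proof -
  have odd_e: "odd e" using e by auto
  have "p + 2 \<noteq> 0" using p by presburger
  then have nonzero: "e * p \<noteq> 0" "e * (p + 2) \<noteq> 0" "e * p \<noteq> e * (p + 2)" "d \<noteq> 0"
    using p odd_e d by auto
  have square: "rat_class_2 (of_int d) = 0 \<longleftrightarrow> d mod 8 = 1"
    using two.rat_class_unit[of d] d class_mod_8_eq_0_iff by (simp add: zero_prod_def)
  have residues: "p mod 8 \<in> {1, 3, 5, 7}" "d mod 8 \<in> {1, 3, 5, 7}" "p mod 8 mod 4 = p mod 4"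
    using odd_mod_8[OF p] odd_mod_8[OF d] by (auto simp: mod_mod_cancel)
  have "twin_image e p = twin_image e (p mod 8)" "twin_image (d * e) p = twin_image (d mod 8 * e) (p mod 8)"
    by (auto intro!: twin_image_cong cong_mult simp: cong_def)
  moreover have "kummer_image rat_class_2 (of_int (d * (e * p))) (of_int (d * (e * (p + 2)))) = twin_image (d * e) p"
    using kummer_image_twin[of "d * e" p] odd_e d p by (simp add: mult.assoc)
  moreover have "coset_count (twin_image e (p mod 8)) (twin_image (d mod 8 * e) (p mod 8)) =
    (if d mod 8 = 5 \<or> (d mod 8 = 7 \<and> p mod 4 = 3) \<or> (d mod 8 = 3 \<and> p mod 4 = 1) then 2 else 4)" if "d mod 8 \<noteq> 1"
    using coset_count_twin_images e residues that by auto
  ultimately show ?thesis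
    unfolding two.local_delta_Qp[OF nonzero] square kummer_image_twin[OF odd_e p] by (simp add: log_2_4)
qed

section \<open>The real place\<close>

definition sgn_class :: "rat \<Rightarrow> bit" where
  "sgn_class x = of_bool (x < 0)"

lemma real_field_simps [simp]:
  "carrier real_field = UNIV" "x \<otimes>\<^bsub>real_field\<^esub> y = x * y" "x \<oplus>\<^bsub>real_field\<^esub> y = x + y"
  "\<one>\<^bsub>real_field\<^esub> = 1" "\<zero>\<^bsub>real_field\<^esub> = 0"
  by (simp_all add: real_field_def)

lemma real_field_field: "field real_field"
proof -
  have "cring real_field"
  proof (rule cringI)
    show "abelian_group real_field" by (rule abelian_groupI) (auto intro: exI[of _ "- _"])
    show "comm_monoid real_field" by (rule comm_monoidI) auto
  qed (auto simp: algebra_simps)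
  then show ?thesis
    using right_inverse by (intro cring.cring_fieldI2) auto
qed

lemma real_approximation:
  fixes z :: real
  assumes C: "finite C" and nonzero: "\<And>r. r \<in> C \<Longrightarrow> z + of_rat r \<noteq> 0"
  obtains x where "\<And>r. r \<in> C \<Longrightarrow> 0 < (z + of_rat r) * of_rat (x + r)"
proof -
  define e where "e = Min (insert 1 ((\<lambda>r. \<bar>z + of_rat r\<bar>) ` C))"
  have "0 < e" unfolding e_def using C nonzero by (subst Min_gr_iff) auto
  then obtain x where x: "z < of_rat x" "of_rat x < z + e" using of_rat_dense[of z "z + e"] by auto
  have "e \<le> \<bar>z + of_rat r\<bar>" if "r \<in> C" for r unfolding e_def using C that by (intro Min_le) auto
  then have "0 < (z + of_rat r) * of_rat (x + r)" if "r \<in> C" for r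
    using that x by (force simp: zero_less_mult_iff of_rat_add abs_if split: if_splits)
  then show thesis using that by blast
qed

theorem place_real: "place real_field of_rat sgn_class"
proof -
  interpret field real_field by (rule real_field_field)
  have sqrt: "\<exists>s::real. s * s = y" if "0 \<le> y" for y
    using that by (intro exI[of _ "sqrt y"]) simp
  show ?thesis
  proof
    show "sgn_class (x * y) = sgn_class x + sgn_class y" if "x \<noteq> 0" "y \<noteq> 0" for x y
      using that by (auto simp: sgn_class_def mult_less_0_iff)
    have "(\<exists>s::real. s * s = of_rat x) \<longleftrightarrow> 0 \<le> x" for x
      using sqrt[of "of_rat x"] by (metis zero_le_of_rat_iff zero_le_square)
    then show "sgn_class x = 0 \<longleftrightarrow> (\<exists>s\<in>carrier real_field. s \<otimes>\<^bsub>real_field\<^esub> s = of_rat x)" for x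
      by (auto simp: sgn_class_def)
    fix z C
    assume C: "finite C" and nonzero: "\<And>r. r \<in> C \<Longrightarrow> z \<oplus>\<^bsub>real_field\<^esub> of_rat r \<noteq> \<zero>\<^bsub>real_field\<^esub>"
    obtain x where x: "\<And>r. r \<in> C \<Longrightarrow> 0 < (z + of_rat r) * of_rat (x + r)"
      using real_approximation[OF C, of z] nonzero by auto
    have "x + r \<noteq> 0 \<and> (\<exists>s. s * s = (z + of_rat r) * of_rat (x + r))" if "r \<in> C" for r
      using x[OF that] sqrt less_imp_le by (metis less_irrefl mult_zero_right of_rat_0)
    then show "\<exists>x. \<forall>r\<in>C. x + r \<noteq> 0 \<and> (\<exists>s\<in>carrier real_field. s \<otimes>\<^bsub>real_field\<^esub> s
        = (z \<oplus>\<^bsub>real_field\<^esub> of_rat r) \<otimes>\<^bsub>real_field\<^esub> of_rat (x + r))"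
      by auto
  qed (auto simp: of_rat_add of_rat_mult)
qed

lemma kummer_image_real_pos:
  assumes "0 < a" "a < b"
  shows "kummer_image sgn_class a b = {(0, 0), (1, 1)}"
proof -
  have "g \<in> {(0, 0), (1, 1)}" if "g \<in> kummer_image sgn_class a b" for g
    using that
    by (cases rule: kummer_image_cases)
      (use assms in \<open>auto simp: sgn_class_def mult_less_0_iff split: if_splits\<close>)
  moreover have "(1, 1) \<in> kummer_image sgn_class a b"
    using torsion_in_kummer_image(4)[of sgn_class b a] assms by (simp add: sgn_class_def)
  ultimately show ?thesis using torsion_in_kummer_image(1)[of sgn_class a b] by blast
qed

lemma kummer_image_real_neg:
  assumes "a < 0" "b < a"
  shows "kummer_image sgn_class a b = {(0, 0), (0, 1)}"
proof -
  have "g \<in> {(0, 0), (0, 1)}" if "g \<in> kummer_image sgn_class a b" for g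
    using that
    by (cases rule: kummer_image_cases)
      (use assms in \<open>auto simp: sgn_class_def mult_less_0_iff zero_less_mult_iff split: if_splits\<close>)
  moreover have "(0, 1) \<in> kummer_image sgn_class a b"
    using torsion_in_kummer_image(2)[of sgn_class a b] assms by (simp add: sgn_class_def mult_less_0_iff)
  ultimately show ?thesis using torsion_in_kummer_image(1)[of sgn_class a b] by blast
qed

lemma coset_count_real:
  "coset_count {(0, 0), (1, 1 :: bit)} {(0 :: bit, 0), (0, 1)} = 2"
  "coset_count {(0, 0), (0, 1 :: bit)} {(0 :: bit, 0), (1, 1)} = 2"
  unfolding coset_count_def by code_simp+

theorem local_delta_real:
  assumes ab: "0 < a \<and> a < b \<or> b < a \<and> a < 0" and d: "d \<noteq> 0"
  shows "local_delta real_field of_int (a + b) (a * b) d = (if d < 0 then 1 else 0)"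
proof -
  have nonzero: "a \<noteq> 0" "b \<noteq> 0" "a \<noteq> b" using ab by auto
  have delta: "local_delta real_field of_int (a + b) (a * b) d = (if sgn_class (of_int d) = 0 then 0
    else log 2 (coset_count (kummer_image sgn_class (of_int a) (of_int b))
      (kummer_image sgn_class (of_int (d * a)) (of_int (d * b)))))"
    by (rule place.local_delta_eq[OF place_real]) (use nonzero d in auto)
  have "coset_count (kummer_image sgn_class (of_int a) (of_int b))
      (kummer_image sgn_class (of_int (d * a)) (of_int (d * b))) = 2" if neg: "d < 0"
    using ab
  proof
    assume ab: "0 < a \<and> a < b"
    then have "d * a < 0" "d * b < d * a" using neg by (auto simp: mult_less_0_iff)
    then have "kummer_image sgn_class (of_int (d * a)) (of_int (d * b)) = {(0, 0), (0, 1)}"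
      by (intro kummer_image_real_neg) (simp_all only: of_int_less_0_iff of_int_less_iff)
    then show ?thesis using ab by (simp add: kummer_image_real_pos coset_count_real del: of_int_mult)
  next
    assume ab: "b < a \<and> a < 0"
    then have "0 < d * a" "d * a < d * b" using neg by (auto simp: zero_less_mult_iff)
    then have "kummer_image sgn_class (of_int (d * a)) (of_int (d * b)) = {(0, 0), (1, 1)}"
      by (intro kummer_image_real_pos) (simp_all only: of_int_0_less_iff of_int_less_iff)
    then show ?thesis using ab by (simp add: kummer_image_real_neg coset_count_real del: of_int_mult)
  qed
  then show ?thesis by (simp add: delta sgn_class_def)
qed

section \<open>The global norm index\<close>

lemma Legendre_eq_pm1: "\<not> int l dvd m \<Longrightarrow> Legendre m (int l) = 1 \<or> Legendre m (int l) = - 1"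
  by (auto simp: Legendre_def cong_0_iff)

locale twin_prime_curve =
  fixes p q :: nat and \<epsilon> \<mu> :: int and D :: nat and S :: "nat set"
  assumes prime_p: "prime p" and prime_q: "prime q" and odd_p: "odd p" and twin: "q = p + 2"
    and \<epsilon>: "\<epsilon> \<in> {1, - 1}" and \<mu>: "\<mu> \<in> {1, - 1}"
    and finite_S: "finite S" and S_prime: "l \<in> S \<Longrightarrow> prime l" and S_odd: "l \<in> S \<Longrightarrow> odd l"
    and D_eq: "D = \<Prod>S" and unramified_pq: "p \<notin> S" "q \<notin> S"
begin

abbreviation a :: int where "a \<equiv> \<epsilon> * int p"
abbreviation b :: int where "b \<equiv> \<epsilon> * int q"
abbreviation d :: int where "d \<equiv> \<mu> * int D"

abbreviation delta_at :: "nat option \<Rightarrow> real" where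
  "delta_at \<equiv> place_delta (a + b) (a * b) d"

lemma dvd_sign_mult_iff [simp]: "k dvd \<epsilon> * m \<longleftrightarrow> k dvd m" "k dvd \<mu> * m \<longleftrightarrow> k dvd m" for k m :: int
  using \<epsilon> \<mu> by auto

lemma prime_dvd_D_iff:
  assumes "prime l"
  shows "l dvd D \<longleftrightarrow> l \<in> S"
proof
  assume "l dvd D"
  then obtain k where "k \<in> S" "l dvd k"
    using assms finite_S unfolding D_eq by (auto simp: prime_dvd_prod_iff)
  then show "l \<in> S" using primes_dvd_imp_eq[of l k] assms S_prime by simp
qed (use dvd_prodI[OF finite_S, of l "\<lambda>l. l"] in \<open>simp add: D_eq\<close>)

lemma prime_dvd_d_iff: "prime l \<Longrightarrow> int l dvd d \<longleftrightarrow> l \<in> S"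
  by (simp add: prime_dvd_D_iff)

lemma D_pos: "0 < D"
  unfolding D_eq using S_prime by (intro prod_pos) (simp add: prime_gt_0_nat)

lemma odd_d: "odd d"
  using prime_dvd_d_iff[of 2] S_odd[of 2] by auto

lemma p_gt_2: "2 < p"
  using prime_gt_1_nat[OF prime_p] odd_p by (cases "p = 2") auto

lemma good_reduction:
  assumes l: "prime l" "l \<notin> {2, p, q}"
  shows "good_reduction l a b"
proof
  show "prime l" "odd l" using l prime_odd_nat[of l] prime_ge_2_nat[of l] by auto
  have "\<not> l dvd p" "\<not> l dvd q" "\<not> l dvd 2"
    using primes_dvd_imp_eq[OF l(1)] prime_p prime_q two_is_prime_nat l(2) by blast+
  then have "\<not> int l dvd int p" "\<not> int l dvd int q" "\<not> int l dvd 2"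
    using of_nat_dvd_iff[of l 2, where 'a = int] by simp_all
  moreover have "a - b = \<epsilon> * - 2" by (simp add: twin algebra_simps)
  ultimately show "\<not> int l dvd a" "\<not> int l dvd b" "\<not> int l dvd a - b" by simp_all
qed

lemma delta_at_infinity: "delta_at None = real_of_int ((1 - \<mu>) div 2)"
proof -
  have "0 < a \<and> a < b \<or> b < a \<and> a < 0" using \<epsilon> p_gt_2 by (auto simp: twin)
  moreover have "d \<noteq> 0" "d < 0 \<longleftrightarrow> \<mu> = - 1" using \<mu> D_pos by auto
  ultimately show ?thesis using local_delta_real[of a b d] \<mu> by (auto simp: place_delta_def)
qed

lemma delta_at_2: "delta_at (Some 2) = (if d mod 8 = 1 then 0
    else if d mod 8 = 5 \<or> (d mod 8 = 7 \<and> p mod 4 = 3) \<or> (d mod 8 = 3 \<and> p mod 4 = 1) then 1 else 2)"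
proof -
  have "int p mod 4 = int (p mod 4)" by (simp add: zmod_int)
  then have "int p mod 4 = 3 \<longleftrightarrow> p mod 4 = 3" "int p mod 4 = 1 \<longleftrightarrow> p mod 4 = 1" by linarith+
  then show ?thesis
    using local_delta_two[of "int p" \<epsilon> d] odd_p \<epsilon> odd_d by (simp add: place_delta_def twin add.commute)
qed

lemma local_delta_twin_prime:
  assumes "prime l" "odd l" "prime l'" "l \<noteq> l'" "l \<notin> S"
  shows "local_delta (Qp l) (Qp_of_int l) (\<epsilon> * int l + \<epsilon> * int l') (\<epsilon> * int l * (\<epsilon> * int l')) d
    = (if Legendre d (int l) = 1 then 0 else 1)"
proof -
  have "\<not> int l dvd \<epsilon>" using \<epsilon> prime_gt_1_nat[OF assms(1)] by auto
  moreover have "\<not> int l dvd int l'" using primes_dvd_imp_eq assms by auto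
  ultimately interpret multiplicative_reduction l "\<epsilon> * int l" \<epsilon> "\<epsilon> * int l'"
    using assms by unfold_locales simp_all
  show ?thesis
    using local_delta_multiplicative[of d] prime_dvd_d_iff assms by (simp add: residue_class_def)
qed

lemma delta_at_twin_primes:
  "delta_at (Some p) = (if Legendre d (int p) = 1 then 0 else 1)"
  "delta_at (Some q) = (if Legendre d (int q) = 1 then 0 else 1)"
  using local_delta_twin_prime[of p q] local_delta_twin_prime[of q p] prime_p prime_q odd_p unramified_pq
  by (simp_all add: place_delta_def twin add.commute mult.commute)

lemma delta_at_ramified:
  assumes l: "l \<in> S"
  shows "delta_at (Some l) = 2"
proof -
  interpret good_reduction l a b
    using l unramified_pq S_prime S_odd[of 2] by (intro good_reduction) auto
  define D' where "D' = \<Prod>(S - {l})"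
  have "D = l * D'" unfolding D_eq D'_def using prod.remove[OF finite_S l] by simp
  moreover have "\<not> l dvd D'"
  proof
    assume "l dvd D'"
    then obtain k where "k \<in> S - {l}" "l dvd k"
      unfolding D'_def using l_prime finite_S by (auto simp: prime_dvd_prod_iff)
    then show False using primes_dvd_imp_eq[of l k] S_prime l_prime by auto
  qed
  ultimately show ?thesis
    using local_delta_ramified[of "\<mu> * int D'" d] by (simp add: place_delta_def)
qed

lemma delta_at_unramified:
  assumes "prime l" "l \<notin> {2, p, q}" "l \<notin> S"
  shows "delta_at (Some l) = 0"
  using good_reduction.local_delta_good[OF good_reduction] prime_dvd_d_iff assms
  by (simp add: place_delta_def)

lemma delta_EQK_eq_sum: "delta_EQK (a + b) (a * b) d = (\<Sum>v\<in>{None, Some 2, Some p, Some q} \<union> Some ` S. delta_at v)"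
  unfolding delta_EQK_def
proof (rule sum.mono_neutral_left)
  show "{v \<in> places_Q. delta_at v \<noteq> 0} \<subseteq> {None, Some 2, Some p, Some q} \<union> Some ` S"
  proof
    fix v assume v: "v \<in> {v \<in> places_Q. delta_at v \<noteq> 0}"
    then show "v \<in> {None, Some 2, Some p, Some q} \<union> Some ` S"
      using delta_at_unramified by (cases v) (auto simp: places_Q_def)
  qed
  have "{None, Some 2, Some p, Some q} \<union> Some ` S \<subseteq> places_Q"
    using prime_p prime_q S_prime by (auto simp: places_Q_def)
  then show "\<forall>v\<in>{None, Some 2, Some p, Some q} \<union> Some ` S - {v \<in> places_Q. delta_at v \<noteq> 0}. delta_at v = 0"
    by blast
qed (simp add: finite_S)

theorem delta_EQK_eq:
  "delta_EQK (a + b) (a * b) d = real_of_int ((1 - \<mu>) div 2) + 2 * real (card S) +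
    (if d mod 8 = 1 then 0
     else if d mod 8 = 5 \<or> (d mod 8 = 7 \<and> p mod 4 = 3) \<or> (d mod 8 = 3 \<and> p mod 4 = 1) then 1 else 2) +
    (if Legendre d (int p) = 1 then 0 else 1) + (if Legendre d (int q) = 1 then 0 else 1)"
proof -
  have "2 \<notin> S" "p \<noteq> 2" "q \<noteq> 2" "p \<noteq> q" using S_odd[of 2] p_gt_2 twin by auto
  then have "{None, Some 2, Some p, Some q} \<inter> Some ` S = {}" using unramified_pq by auto
  then have "delta_EQK (a + b) (a * b) d
      = (\<Sum>v\<in>{None, Some 2, Some p, Some q}. delta_at v) + (\<Sum>l\<in>S. delta_at (Some l))"
    unfolding delta_EQK_eq_sum using finite_S by (subst sum.union_disjoint) (simp_all add: sum.reindex)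
  also have "(\<Sum>v\<in>{None, Some 2, Some p, Some q}. delta_at v)
      = delta_at None + delta_at (Some 2) + delta_at (Some p) + delta_at (Some q)"
    using \<open>p \<noteq> 2\<close> \<open>q \<noteq> 2\<close> \<open>p \<noteq> q\<close> by simp
  also have "(\<Sum>l\<in>S. delta_at (Some l)) = 2 * real (card S)"
    using delta_at_ramified by simp
  finally show ?thesis unfolding delta_at_infinity delta_at_2 delta_at_twin_primes by simp
qed

end

lemma cong_sign_mult_iff:
  fixes \<mu> m k :: int
  assumes "\<mu> \<in> {1, - 1}"
  shows "[m = k * \<mu>] (mod n) \<longleftrightarrow> (\<mu> * m) mod n = k mod n"
proof -
  have "m - k * \<mu> = \<mu> * (\<mu> * m - k)" using assms by (auto simp: algebra_simps)
  then have "n dvd m - k * \<mu> \<longleftrightarrow> n dvd \<mu> * m - k" using assms dvd_minus_iff[of n "\<mu> * m - k"] by auto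
  then show ?thesis by (simp add: cong_iff_dvd_diff mod_eq_dvd_iff)
qed

theorem theorem3p3:
  fixes p q :: nat and \<epsilon> \<mu> :: int and D n :: nat and S :: "nat set"
  assumes "prime p" "prime q" "odd p" "odd q" "int q - int p = 2"
    and "\<epsilon> \<in> {1, -1}"
    and "finite S" "card S = n" "\<forall>l\<in>S. prime l \<and> odd l" "D = \<Prod>S"
    and "coprime (p * q) D"
    and "\<mu> \<in> {1, -1}" "\<mu> * int D \<noteq> 1"
  defines "\<delta> \<equiv> delta_EQK (\<epsilon> * int p + \<epsilon> * int q) ((\<epsilon> * int p) * (\<epsilon> * int q)) (\<mu> * int D)"
    and "\<mu>0 \<equiv> (1 - \<mu>) div 2"
    and "Lp \<equiv> Legendre (\<mu> * int D) (int p)"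
    and "Lq \<equiv> Legendre (\<mu> * int D) (int q)"
  shows
    "real_of_int (2 * int n + \<mu>0) \<le> \<delta> \<and> \<delta> \<le> real_of_int (2 * int n + 4 + \<mu>0)
     \<and> (\<delta> = real_of_int (2 * int n + \<mu>0) \<longleftrightarrow>
          [int D = \<mu>] (mod 8) \<and> Lp = 1 \<and> Lq = 1)
     \<and> (\<delta> = real_of_int (2 * int n + 1 + \<mu>0) \<longleftrightarrow>
          ([int D = 5 * \<mu>] (mod 8) \<and> Lp = 1 \<and> Lq = 1)
        \<or> ([int D = 7 * \<mu>] (mod 8) \<and> [p = 3] (mod 4) \<and> Lp = 1 \<and> Lq = 1)
        \<or> ([int D = 3 * \<mu>] (mod 8) \<and> [p = 1] (mod 4) \<and> Lp = 1 \<and> Lq = 1)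
        \<or> ([int D = \<mu>] (mod 8) \<and> Lp + Lq = 0))
     \<and> (\<delta> = real_of_int (2 * int n + 2 + \<mu>0) \<longleftrightarrow>
          ([int D = 7 * \<mu>] (mod 8) \<and> [p = 1] (mod 4) \<and> Lp = 1 \<and> Lq = 1)
        \<or> ([int D = 3 * \<mu>] (mod 8) \<and> [p = 3] (mod 4) \<and> Lp = 1 \<and> Lq = 1)
        \<or> ([int D = 5 * \<mu>] (mod 8) \<and> Lp + Lq = 0)
        \<or> ([int D = 7 * \<mu>] (mod 8) \<and> [p = 3] (mod 4) \<and> Lp + Lq = 0)
        \<or> ([int D = 3 * \<mu>] (mod 8) \<and> [p = 1] (mod 4) \<and> Lp + Lq = 0)
        \<or> ([int D = \<mu>] (mod 8) \<and> Lp = -1 \<and> Lq = -1))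
     \<and> (\<delta> = real_of_int (2 * int n + 3 + \<mu>0) \<longleftrightarrow>
          ([int D = 7 * \<mu>] (mod 8) \<and> [p = 1] (mod 4) \<and> Lp + Lq = 0)
        \<or> ([int D = 3 * \<mu>] (mod 8) \<and> [p = 3] (mod 4) \<and> Lp + Lq = 0)
        \<or> ([int D = 5 * \<mu>] (mod 8) \<and> Lp = -1 \<and> Lq = -1)
        \<or> ([int D = 7 * \<mu>] (mod 8) \<and> [p = 3] (mod 4) \<and> Lp = -1 \<and> Lq = -1)
        \<or> ([int D = 3 * \<mu>] (mod 8) \<and> [p = 1] (mod 4) \<and> Lp = -1 \<and> Lq = -1))
     \<and> (\<delta> = real_of_int (2 * int n + 4 + \<mu>0) \<longleftrightarrow>
          ([int D = 7 * \<mu>] (mod 8) \<and> [p = 1] (mod 4) \<and> Lp = -1 \<and> Lq = -1)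
        \<or> ([int D = 3 * \<mu>] (mod 8) \<and> [p = 3] (mod 4) \<and> Lp = -1 \<and> Lq = -1))"
proof -
  have "p \<notin> S" "q \<notin> S"
    using dvd_prodI[OF assms(7), of _ "\<lambda>l. l"] coprime_common_divisor[OF assms(11)] assms(1,2,10)
    by (metis dvd_triv_left dvd_triv_right not_prime_unit)+
  then interpret twin_prime_curve p q \<epsilon> \<mu> D S
    using assms by unfold_locales auto
  have delta: "\<delta> = real_of_int \<mu>0 + 2 * real n + (if d mod 8 = 1 then 0
      else if d mod 8 = 5 \<or> (d mod 8 = 7 \<and> p mod 4 = 3) \<or> (d mod 8 = 3 \<and> p mod 4 = 1) then 1 else 2)
      + (if Lp = 1 then 0 else 1) + (if Lq = 1 then 0 else 1)"
    using delta_EQK_eq assms(8) by (simp add: \<delta>_def \<mu>0_def Lp_def Lq_def)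
  have residue: "[int D = \<mu>] (mod 8) \<longleftrightarrow> d mod 8 = 1" "[int D = k * \<mu>] (mod 8) \<longleftrightarrow> d mod 8 = k mod 8" for k
    using cong_sign_mult_iff[OF assms(12), of "int D" 1 8] cong_sign_mult_iff[OF assms(12)] by simp_all
  have "Lp = 1 \<or> Lp = - 1" "Lq = 1 \<or> Lq = - 1"
    using Legendre_eq_pm1 prime_dvd_d_iff assms(1,2) \<open>p \<notin> S\<close> \<open>q \<notin> S\<close> by (simp_all add: Lp_def Lq_def)
  moreover have "p mod 4 = 1 \<or> p mod 4 = 3" using assms(3) by presburger
  moreover have "d mod 8 = 1 \<or> d mod 8 = 3 \<or> d mod 8 = 5 \<or> d mod 8 = 7" using odd_mod_8 odd_d by blast
  ultimately show ?thesis
    unfolding delta residue by (elim disjE) (simp_all add: cong_def)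
qed

end
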